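(* Consider the SPD Q-learning algorithm described in the context. Assume that $\gamma_k=\gamma_0/\sqrt{k+1}$, $k\ge 0$, with some $\gamma_0>0$, that $\beta_k=\beta_0/(k+1)$, $k\ge 0$, for any real number $\beta_0>0$ (so that $\|M_k^{-1}-M_{k+1}^{-1}\|_2\le \beta_0/(k+1)$ for all $k\ge0$), and let $\eta=\frac{\sigma}{|\mathcal S|}\mathbf 1_{|\mathcal S|}$. Define $\kappa:=\max\{\kappa_1,\kappa_2\}$ with $$\kappa_1:=\left(\frac{12+4\beta_0}{\zeta^2|\mathcal S|^2|\mathcal A|^2\gamma_0}+26\gamma_0\right)^2,$$ $$\kappa_2:=(2184+416\sqrt{26})\gamma_0^2+(1066+416\sqrt{26})\gamma_0+832+16\sqrt{26}.$$ For any $\varepsilon\in(0,1)$ and $\delta\in(0,1/e)$, where $e$ is Euler's number, if $$T\ge\kappa\,\frac{\sigma^2|\mathcal S|^6|\mathcal A|^4}{\zeta^4(1-\alpha)^6}\,\frac1{\varepsilon^2}\ln\left(\frac1\delta\right),$$ then with probability at least $1-\delta$ we have $\|V^*-V^{\hat\pi_T^d}\|_\infty\le\varepsilon$, where $\hat\pi_T^d$ is the dual policy, i.e. the stochastic policy which in state $s$ takes action $a$ with probability $\hat\lambda_{a,T}(s)/\sum_{a'\in\mathcal A}\hat\lambda_{a',T}(s)$, with $\hat\lambda_T=\frac1T\sum_{k=0}^{T-1}\lambda^{(k)}$.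
   Context: **Discounted MDP.** $\mathcal S=\{1,\dots,|\mathcal S|\}$ and $\mathcal A=\{1,\dots,|\mathcal A|\}$ are finite state and action sets, $\alpha\in[0,1)$ is the discount factor, $P_a\in\mathbb R^{|\mathcal S|\times|\mathcal S|}$ ($a\in\mathcal A$) are row-stochastic transition matrices, $\hat r_{ss'a}\in[0,\sigma]$ are random rewards with mean $r_{ss'a}$, and $\sigma\ge1$. Put $R_a(s)=\sum_{s'}P_a(s,s')r_{ss'a}$; $P$ and $R$ are the $P_a$ and $R_a$ stacked over $a$. For a stochastic policy $\pi$ (with $\pi_s(a)$ the probability of action $a$ in state $s$), $V^\pi(s)$ is the expected infinite-horizon discounted reward $\mathbb E[\sum_{k\ge0}\alpha^k\hat r_{s_ks_{k+1}a_k}\mid s_0=s]$ under $\pi$, and $V^*$ is the optimal value function (maximum over policies). $\eta\in\mathbb R^{|\mathcal S|}$ has positive entries. Vectors $Q,\lambda,\mu\in\mathbb R^{|\mathcal S||\mathcal A|}$ have blocks $Q_a,\lambda_a,\mu_a\in\mathbb R^{|\mathcal S|}$, $a\in\mathcal A$. **State-action distributions.** The trajectory $(s_k,a_k)_{k\ge0}$ is observed from the environment, and $\tau_{a,k}(s)$ is the probability that the state and action at time $k$ are $(s,a)$; $\tau_k$ denotes this distribution. $M_k$ is the diagonal matrix with diagonal blocks $\mathrm{diag}(\tau_{a,k}(1),\dots,\tau_{a,k}(|\mathcal S|))$, $a\in\mathcal A$ (a deterministic sequence of matrices). Assumptions: there is $\zeta>0$ with $\tau_{a,k}(s)\ge\zeta$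 for all $k\ge0$, $s$, $a$; $M_k$ converges to a positive diagonal matrix $M_\infty$; there is a non-increasing sequence $\beta_k\to0$ with $\|M_k^{-1}-M_{k+1}^{-1}\|_2\le\beta_k$ for all $k\ge0$; the step sizes $\gamma_k$ are non-increasing with $\gamma_k\to0$. **Sets.** $\mathcal V=\{v\in\mathbb R^{|\mathcal S|}:v\ge0,\|v\|_\infty\le\frac{\sigma}{1-\alpha}\}$, $\mathcal L=\{\lambda\in\mathbb R^{|\mathcal S||\mathcal A|}:\lambda\ge0,\|\lambda\|_\infty\le\frac{\|\eta\|_1}{1-\alpha}\}$, $\mathcal M=\{\mu\in\mathbb R^{|\mathcal S||\mathcal A|}:\mu\ge0,\|\mu\|_\infty\le\frac{\|\eta\|_1}{\zeta(1-\alpha)}\}$, $\Xi=\{\lambda:\sum_a\lambda_a\ge\eta\}$, $\mathcal X=\mathcal V^{|\mathcal A|}\times\mathcal V$, $\mathcal Y=(\mathcal L\cap\Xi)\times\mathcal M$. Write $x=(Q,V)$, $y=(\lambda,\mu)$. $\Pi$ denotes Euclidean projection. **SPD Q-learning algorithm.** Initialize $V^{(0)}$ and $Q^{(0)}$ with entries in $[0,\frac{\sigma}{1-\alpha}]$, $\lambda^{(0)}$ with entries in $[0,\frac{\|\eta\|_1}{1-\alpha}]$, $\mu^{(0)}$ with entries in $[0,\frac{\|\eta\|_1}{\zeta(1-\alpha)}]$. Write $x_k=(Q^{(k)},V^{(k)})$, $y_k=(\lambda^{(k)},\mu^{(k)})$. At step $k=0,\dots,T-1$, observe $(s_k,a_k,s_{k+1},\hat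 r_{s_ks_{k+1}a_k})$ from the environment, where $(s_k,a_k)\sim\tau_k$ and $s_{k+1}$ is the next state, and sample $\hat s_k$ and $\hat a_k$ uniformly from $\mathcal S$ and $\mathcal A$. With $e_s$ the basis vectors of $\mathbb R^{|\mathcal S|}$ and $E_{s,a}$ the basis vector of $\mathbb R^{|\mathcal S||\mathcal A|}$ for the $s$-th entry of block $a$, set $$g^x_k=\begin{bmatrix}|\mathcal S||\mathcal A|\lambda^{(k)}_{\hat a_k}(\hat s_k)E_{\hat s_k,\hat a_k}-\mu^{(k)}_{a_k}(s_k)E_{s_k,a_k}\\ |\mathcal S|\eta(\hat s_k)e_{\hat s_k}-|\mathcal S||\mathcal A|\lambda^{(k)}_{\hat a_k}(\hat s_k)e_{\hat s_k}+\alpha\mu^{(k)}_{a_k}(s_k)e_{s_{k+1}}\end{bmatrix},$$ $$g^y_k=\begin{bmatrix}|\mathcal S||\mathcal A|(Q^{(k)}_{\hat a_k}(\hat s_k)-V^{(k)}(\hat s_k))E_{\hat s_k,\hat a_k}\\ (\alpha V^{(k)}(s_{k+1})+\hat r_{s_ks_{k+1}a_k}-Q^{(k)}_{a_k}(s_k))E_{s_k,a_k}\end{bmatrix},$$ and $x_{k+1}=\Pi_{\mathcal X}(x_k-\gamma_kg^x_k)$, $y_{k+1}=\Pi_{\mathcal Y}(y_k+\gamma_kg^y_k)$. With $L_{M_k}(x,y)=\eta^TV+\mu^TM_k(\alpha PV+R-Q)+\lambda^T(Q-(\mathbf 1_{|\mathcal A|}\otimes I_{|\mathcal S|})V)$,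 these are regarded as unbiased stochastic gradients $g_k^x=\nabla_xL_{M_k}(x_k,y_k)+\varepsilon_k$, $g_k^y=\nabla_yL_{M_k}(x_k,y_k)+\xi_k$, where $(\varepsilon_k,\xi_k)$ are (possibly dependent) random variables with zero mean. *)

theory Defs
  imports "HOL-Probability.Probability"
begin

text \<open>
  States and actions are the elements of two finite types. A row-stochastic matrix is given by
  its rows as probability mass functions, so \<open>P a s\<close> is the distribution of the next state.
  The law of the random reward for the transition from \<open>s\<close> to \<open>s'\<close> under \<open>a\<close> is \<open>rew s s' a\<close>.
  A vector consisting of one state vector per action is indexed by pairs \<open>(a, s)\<close>: entry \<open>s\<close> of
  block \<open>a\<close>.
\<close>

definition discounted_mdp :: "real \<Rightarrow> real \<Rightarrow> ('s::finite \<Rightarrow> 's \<Rightarrow> 'a::finite \<Rightarrow> real measure) \<Rightarrow> bool" where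
  "discounted_mdp \<alpha> \<sigma> rew \<longleftrightarrow>
     0 \<le> \<alpha> \<and> \<alpha> < 1 \<and> 1 \<le> \<sigma> \<and>
     (\<forall>s s' a. prob_space (rew s s' a) \<and> sets (rew s s' a) = sets borel \<and>
               (AE r in rew s s' a. 0 \<le> r \<and> r \<le> \<sigma>))"

definition mean_reward :: "('s \<Rightarrow> 's \<Rightarrow> 'a \<Rightarrow> real measure) \<Rightarrow> 's \<Rightarrow> 's \<Rightarrow> 'a \<Rightarrow> real" where
  "mean_reward rew s s' a = (\<integral>r. r \<partial>rew s s' a)"


subsection \<open>Value functions\<close>

text \<open>
  A trajectory from a given state is the sequence of the triples
  (action, next state, reward) of the successive steps. Its law is the Ionescu-Tulcea extension
  of the one-step kernels.
\<close>

definition step_space :: "('a \<times> 's \<times> real) measure" where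
  "step_space = count_space UNIV \<Otimes>\<^sub>M (count_space UNIV \<Otimes>\<^sub>M borel)"

definition step_law ::
  "('a::finite \<Rightarrow> 's::finite \<Rightarrow> 's pmf) \<Rightarrow> ('s \<Rightarrow> 's \<Rightarrow> 'a \<Rightarrow> real measure) \<Rightarrow> ('s \<Rightarrow> 'a pmf) \<Rightarrow> 's
     \<Rightarrow> ('a \<times> 's \<times> real) measure" where
  "step_law P rew \<pi> s =
     measure_pmf (\<pi> s) \<bind> (\<lambda>a. measure_pmf (P a s) \<bind>
       (\<lambda>s'. distr (rew s s' a) step_space (\<lambda>r. (a, s', r))))"

definition state_at :: "'s \<Rightarrow> nat \<Rightarrow> (nat \<Rightarrow> 'a \<times> 's \<times> real) \<Rightarrow> 's" where
  "state_at s n \<omega> = (case n of 0 \<Rightarrow> s | Suc m \<Rightarrow> fst (snd (\<omega> m)))"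

definition trajectory_kernel ::
  "('a::finite \<Rightarrow> 's::finite \<Rightarrow> 's pmf) \<Rightarrow> ('s \<Rightarrow> 's \<Rightarrow> 'a \<Rightarrow> real measure) \<Rightarrow> ('s \<Rightarrow> 'a pmf) \<Rightarrow> 's
     \<Rightarrow> nat \<Rightarrow> (nat \<Rightarrow> 'a \<times> 's \<times> real) \<Rightarrow> ('a \<times> 's \<times> real) measure" where
  "trajectory_kernel P rew \<pi> s n \<omega> = step_law P rew \<pi> (state_at s n \<omega>)"

definition trajectory_law ::
  "('a::finite \<Rightarrow> 's::finite \<Rightarrow> 's pmf) \<Rightarrow> ('s \<Rightarrow> 's \<Rightarrow> 'a \<Rightarrow> real measure) \<Rightarrow> ('s \<Rightarrow> 'a pmf) \<Rightarrow> 's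
     \<Rightarrow> (nat \<Rightarrow> 'a \<times> 's \<times> real) measure" where
  "trajectory_law P rew \<pi> s =
     projective_family.lim UNIV
       (Ionescu_Tulcea.CI (trajectory_kernel P rew \<pi> s) (\<lambda>_. step_space)) (\<lambda>_. step_space)"

lemma step_law_in_prob_algebra:
  assumes "discounted_mdp \<alpha> \<sigma> rew"
  shows "step_law P rew \<pi> s \<in> space (prob_algebra step_space)"
proof -
  have rew: "distr (rew s s' a) step_space (\<lambda>r. (a, s', r)) \<in> space (prob_algebra step_space)" for s' a
  proof -
    have [measurable_cong]: "sets (rew s s' a) = sets borel"
      using assms by (simp add: discounted_mdp_def)
    have "(\<lambda>r. (a, s', r)) \<in> rew s s' a \<rightarrow>\<^sub>M step_space"
      unfolding step_space_def by measurable
    moreover have "prob_space (rew s s' a)"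
      using assms by (simp add: discounted_mdp_def)
    ultimately show ?thesis
      by (simp add: space_prob_algebra prob_space.prob_space_distr)
  qed
  have bind: "measure_pmf p \<bind> f \<in> space (prob_algebra step_space)"
    if "\<And>x. f x \<in> space (prob_algebra step_space)" for p :: "'x pmf" and f
  proof -
    have f: "prob_space (f x)" "sets (f x) = sets step_space" for x
      using that[of x] by (auto simp: space_prob_algebra)
    have "f \<in> measure_pmf p \<rightarrow>\<^sub>M subprob_algebra step_space"
      using f by (auto simp: space_subprob_algebra prob_space_imp_subprob_space)
    then have "prob_space (measure_pmf p \<bind> f)"
      using f by (intro prob_space.prob_space_bind[OF prob_space_measure_pmf]) auto
    moreover have "sets (measure_pmf p \<bind> f) = sets step_space"
      using f by (intro sets_bind) auto
    ultimately show ?thesis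
      by (simp add: space_prob_algebra)
  qed
  show ?thesis
    unfolding step_law_def by (intro bind rew)
qed

lemma Ionescu_Tulcea_trajectory_kernel:
  assumes "discounted_mdp \<alpha> \<sigma> rew"
  shows "Ionescu_Tulcea (trajectory_kernel P rew \<pi> s) (\<lambda>_. step_space)"
proof (rule Ionescu_Tulcea.intro)
  fix n
  have state: "state_at s n \<in> PiM {0..<n} (\<lambda>_. step_space) \<rightarrow>\<^sub>M count_space UNIV"
  proof (cases n)
    case (Suc m)
    have "(\<lambda>\<omega>. \<omega> m) \<in> PiM {0..<n} (\<lambda>_. step_space) \<rightarrow>\<^sub>M
            count_space UNIV \<Otimes>\<^sub>M (count_space UNIV \<Otimes>\<^sub>M borel)"
      unfolding step_space_def using Suc by (intro measurable_component_singleton) auto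
    from measurable_compose[OF this, of "\<lambda>x. fst (snd x)" "count_space UNIV"]
    show ?thesis
      by (simp add: state_at_def[abs_def] Suc)
  qed (simp add: state_at_def[abs_def])
  have law: "step_law P rew \<pi> t \<in> space (subprob_algebra step_space)" "prob_space (step_law P rew \<pi> t)" for t
    using step_law_in_prob_algebra[OF assms, of P \<pi> t]
    by (auto simp: space_prob_algebra space_subprob_algebra prob_space_imp_subprob_space)
  have "step_law P rew \<pi> \<in> count_space UNIV \<rightarrow>\<^sub>M subprob_algebra step_space"
    using law by simp
  from measurable_compose[OF state this]
  show "trajectory_kernel P rew \<pi> s n \<in> PiM {0..<n} (\<lambda>_. step_space) \<rightarrow>\<^sub>M subprob_algebra step_space"
    by (simp add: trajectory_kernel_def[abs_def])
  show "prob_space (trajectory_kernel P rew \<pi> s n \<omega>)"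
    if "\<omega> \<in> space (PiM {0..<n} (\<lambda>_. step_space))" for \<omega>
    using law by (simp add: trajectory_kernel_def)
qed

definition policy_value ::
  "real \<Rightarrow> ('a::finite \<Rightarrow> 's::finite \<Rightarrow> 's pmf) \<Rightarrow> ('s \<Rightarrow> 's \<Rightarrow> 'a \<Rightarrow> real measure) \<Rightarrow> ('s \<Rightarrow> 'a pmf)
     \<Rightarrow> real^'s" where
  "policy_value \<alpha> P rew \<pi> =
     (\<chi> s. \<integral>\<omega>. (\<Sum>k. \<alpha>^k * snd (snd (\<omega> k))) \<partial>trajectory_law P rew \<pi> s)"

definition optimal_value ::
  "real \<Rightarrow> ('a::finite \<Rightarrow> 's::finite \<Rightarrow> 's pmf) \<Rightarrow> ('s \<Rightarrow> 's \<Rightarrow> 'a \<Rightarrow> real measure) \<Rightarrow> real^'s" where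
  "optimal_value \<alpha> P rew = (\<chi> s. SUP \<pi>. policy_value \<alpha> P rew \<pi> $ s)"

definition dual_policy :: "real^('a::finite \<times> 's::finite) \<Rightarrow> 's \<Rightarrow> 'a pmf" where
  "dual_policy lam s = embed_pmf (\<lambda>a. lam $ (a, s) / (\<Sum>a'\<in>UNIV. lam $ (a', s)))"


subsection \<open>The Lagrangian\<close>

definition stacked_P :: "('a::finite \<Rightarrow> 's::finite \<Rightarrow> 's pmf) \<Rightarrow> real^'s^('a \<times> 's)" where
  "stacked_P P = (\<chi> i s'. pmf (P (fst i) (snd i)) s')"

definition stacked_R ::
  "('a::finite \<Rightarrow> 's::finite \<Rightarrow> 's pmf) \<Rightarrow> ('s \<Rightarrow> 's \<Rightarrow> 'a \<Rightarrow> real measure) \<Rightarrow> real^('a \<times> 's)" where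
  "stacked_R P rew = (\<chi> i. \<Sum>s'\<in>UNIV. pmf (P (fst i) (snd i)) s' * mean_reward rew (snd i) s' (fst i))"

text \<open>The Kronecker product of the all-ones vector with the identity matrix.\<close>

definition stacked_I :: "real^('s::finite)^('a::finite \<times> 's)" where
  "stacked_I = (\<chi> i s. if snd i = s then 1 else 0)"

definition weight_matrix :: "('a::finite \<times> 's::finite) pmf \<Rightarrow> real^('a \<times> 's)^('a \<times> 's)" where
  "weight_matrix \<tau> = (\<chi> i j. if i = j then pmf \<tau> i else 0)"

definition spectral_norm :: "real^'n::finite^'n \<Rightarrow> real" where
  "spectral_norm B = onorm (\<lambda>v. B *v v)"

definition norm1 :: "real^'n::finite \<Rightarrow> real" where
  "norm1 v = (\<Sum>i\<in>UNIV. \<bar>v $ i\<bar>)"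

definition Lagrangian ::
  "real \<Rightarrow> ('a::finite \<Rightarrow> 's::finite \<Rightarrow> 's pmf) \<Rightarrow> ('s \<Rightarrow> 's \<Rightarrow> 'a \<Rightarrow> real measure) \<Rightarrow> real^'s
     \<Rightarrow> real^('a \<times> 's)^('a \<times> 's)
     \<Rightarrow> (real^('a \<times> 's)) \<times> (real^'s) \<Rightarrow> (real^('a \<times> 's)) \<times> (real^('a \<times> 's)) \<Rightarrow> real" where
  "Lagrangian \<alpha> P rew \<eta> W = (\<lambda>(Q, V) (lam, mu).
     \<eta> \<bullet> V + mu \<bullet> (W *v (\<alpha> *\<^sub>R (stacked_P P *v V) + stacked_R P rew - Q))
       + lam \<bullet> (Q - stacked_I *v V))"

definition grad :: "('v::real_inner \<Rightarrow> real) \<Rightarrow> 'v \<Rightarrow> 'v" where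
  "grad f x = (THE D. GDERIV f x :> D)"


subsection \<open>Stochastic primal-dual Q-learning\<close>

definition V_set :: "real \<Rightarrow> real \<Rightarrow> (real^'s::finite) set" where
  "V_set \<alpha> \<sigma> = {v. (\<forall>s. 0 \<le> v $ s) \<and> infnorm v \<le> \<sigma> / (1 - \<alpha>)}"

definition L_set :: "real \<Rightarrow> real^'s::finite \<Rightarrow> (real^('a::finite \<times> 's)) set" where
  "L_set \<alpha> \<eta> = {lam. (\<forall>i. 0 \<le> lam $ i) \<and> infnorm lam \<le> norm1 \<eta> / (1 - \<alpha>)}"

definition M_set :: "real \<Rightarrow> real \<Rightarrow> real^'s::finite \<Rightarrow> (real^('a::finite \<times> 's)) set" where
  "M_set \<alpha> \<zeta> \<eta> = {mu. (\<forall>i. 0 \<le> mu $ i) \<and> infnorm mu \<le> norm1 \<eta> / (\<zeta> * (1 - \<alpha>))}"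

definition Xi_set :: "real^'s::finite \<Rightarrow> (real^('a::finite \<times> 's)) set" where
  "Xi_set \<eta> = {lam. \<forall>s. (\<Sum>a\<in>UNIV. lam $ (a, s)) \<ge> \<eta> $ s}"

definition X_set :: "real \<Rightarrow> real \<Rightarrow> ((real^('a::finite \<times> 's::finite)) \<times> (real^'s)) set" where
  "X_set \<alpha> \<sigma> = {Q. \<forall>a. (\<chi> s. Q $ (a, s)) \<in> V_set \<alpha> \<sigma>} \<times> V_set \<alpha> \<sigma>"

definition Y_set ::
  "real \<Rightarrow> real \<Rightarrow> real^'s::finite \<Rightarrow> ((real^('a::finite \<times> 's)) \<times> (real^('a \<times> 's))) set" where
  "Y_set \<alpha> \<zeta> \<eta> = (L_set \<alpha> \<eta> \<inter> Xi_set \<eta>) \<times> M_set \<alpha> \<zeta> \<eta>"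

text \<open>
  A sample \<open>(s, a, s', r, su, au)\<close> consists of the observed state, action, next state and reward,
  and of the uniformly drawn state and action.
\<close>

type_synonym ('s, 'a) sample = "'s \<times> 'a \<times> 's \<times> real \<times> 's \<times> 'a"

definition grad_x ::
  "real \<Rightarrow> real^'s::finite \<Rightarrow> (real^('a::finite \<times> 's)) \<times> (real^('a \<times> 's)) \<Rightarrow> ('s, 'a) sample
     \<Rightarrow> (real^('a \<times> 's)) \<times> (real^'s)" where
  "grad_x \<alpha> \<eta> = (\<lambda>(lam, mu) (s, a, s', r, su, au).
     ((real CARD('s) * real CARD('a) * lam $ (au, su)) *\<^sub>R axis (au, su) 1
        - (mu $ (a, s)) *\<^sub>R axis (a, s) 1,
      (real CARD('s) * \<eta> $ su) *\<^sub>R axis su 1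
        - (real CARD('s) * real CARD('a) * lam $ (au, su)) *\<^sub>R axis su 1
        + (\<alpha> * mu $ (a, s)) *\<^sub>R axis s' 1))"

definition grad_y ::
  "real \<Rightarrow> (real^('a::finite \<times> 's::finite)) \<times> (real^'s) \<Rightarrow> ('s, 'a) sample
     \<Rightarrow> (real^('a \<times> 's)) \<times> (real^('a \<times> 's))" where
  "grad_y \<alpha> = (\<lambda>(Q, V) (s, a, s', r, su, au).
     ((real CARD('s) * real CARD('a) * (Q $ (au, su) - V $ su)) *\<^sub>R axis (au, su) 1,
      (\<alpha> * V $ s' + r - Q $ (a, s)) *\<^sub>R axis (a, s) 1))"

definition noise_x ::
  "real \<Rightarrow> ('a::finite \<Rightarrow> 's::finite \<Rightarrow> 's pmf) \<Rightarrow> ('s \<Rightarrow> 's \<Rightarrow> 'a \<Rightarrow> real measure) \<Rightarrow> real^'s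
     \<Rightarrow> ('a \<times> 's) pmf \<Rightarrow> (real^('a \<times> 's)) \<times> (real^'s) \<Rightarrow> (real^('a \<times> 's)) \<times> (real^('a \<times> 's))
     \<Rightarrow> ('s, 'a) sample \<Rightarrow> (real^('a \<times> 's)) \<times> (real^'s)" where
  "noise_x \<alpha> P rew \<eta> \<tau> x y smp =
     grad_x \<alpha> \<eta> y smp - grad (\<lambda>x'. Lagrangian \<alpha> P rew \<eta> (weight_matrix \<tau>) x' y) x"

definition noise_y ::
  "real \<Rightarrow> ('a::finite \<Rightarrow> 's::finite \<Rightarrow> 's pmf) \<Rightarrow> ('s \<Rightarrow> 's \<Rightarrow> 'a \<Rightarrow> real measure) \<Rightarrow> real^'s
     \<Rightarrow> ('a \<times> 's) pmf \<Rightarrow> (real^('a \<times> 's)) \<times> (real^'s) \<Rightarrow> (real^('a \<times> 's)) \<times> (real^('a \<times> 's))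
     \<Rightarrow> ('s, 'a) sample \<Rightarrow> (real^('a \<times> 's)) \<times> (real^('a \<times> 's))" where
  "noise_y \<alpha> P rew \<eta> \<tau> x y smp =
     grad_y \<alpha> x smp - grad (\<lambda>y'. Lagrangian \<alpha> P rew \<eta> (weight_matrix \<tau>) x y') y"

text \<open>
  Measurability and the inclusion of the \<sigma>-algebras are part of the definition because
  \<^const>\<open>real_cond_exp\<close> is constantly 0 without them.
\<close>

definition cond_mean_zero :: "'w measure \<Rightarrow> 'w measure \<Rightarrow> ('w \<Rightarrow> 'v::euclidean_space) \<Rightarrow> bool" where
  "cond_mean_zero M G f \<longleftrightarrow>
     subalgebra M G \<and> integrable M f \<and>
     (\<forall>b\<in>Basis. AE \<omega> in M. real_cond_exp M G (\<lambda>\<omega>. f \<omega> \<bullet> b) \<omega> = 0)"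

text \<open>
  The behaviour of the environment: \<open>\<tau> k\<close> is the distribution of the (action, state) pair at
  time \<open>k\<close> of a trajectory. The marginal condition says that the state at time \<open>k + 1\<close> is
  the successor of the state and action at time \<open>k\<close>; the choice of actions is not restricted.
\<close>

definition state_action_distributions ::
  "('a::finite \<Rightarrow> 's::finite \<Rightarrow> 's pmf) \<Rightarrow> real \<Rightarrow> (nat \<Rightarrow> real) \<Rightarrow> (nat \<Rightarrow> ('a \<times> 's) pmf) \<Rightarrow> bool" where
  "state_action_distributions P \<zeta> \<beta> \<tau> \<longleftrightarrow>
     (\<forall>k. map_pmf snd (\<tau> (Suc k)) = bind_pmf (\<tau> k) (\<lambda>(a, s). P a s)) \<and>
     0 < \<zeta> \<and> (\<forall>k i. \<zeta> \<le> pmf (\<tau> k) i) \<and>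
     (\<exists>W. (\<lambda>k. weight_matrix (\<tau> k)) \<longlonglongrightarrow> W \<and>
          (\<forall>i j. i \<noteq> j \<longrightarrow> W $ i $ j = 0) \<and> (\<forall>i. 0 < W $ i $ i)) \<and>
     antimono \<beta> \<and> \<beta> \<longlonglongrightarrow> 0 \<and>
     (\<forall>k. spectral_norm (matrix_inv (weight_matrix (\<tau> k)) - matrix_inv (weight_matrix (\<tau> (Suc k))))
            \<le> \<beta> k)"

definition has_sample_law ::
  "'w measure \<Rightarrow> ('a::finite \<Rightarrow> 's::finite \<Rightarrow> 's pmf) \<Rightarrow> ('s \<Rightarrow> 's \<Rightarrow> 'a \<Rightarrow> real measure)
     \<Rightarrow> ('a \<times> 's) pmf \<Rightarrow> ('w \<Rightarrow> ('s, 'a) sample) \<Rightarrow> bool" where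
  "has_sample_law M P rew \<tau> smp \<longleftrightarrow>
     smp \<in> M \<rightarrow>\<^sub>M count_space UNIV \<Otimes>\<^sub>M (count_space UNIV \<Otimes>\<^sub>M (count_space UNIV \<Otimes>\<^sub>M
              (borel \<Otimes>\<^sub>M (count_space UNIV \<Otimes>\<^sub>M count_space UNIV)))) \<and>
     (\<forall>s a s' su au. \<forall>B\<in>sets borel.
        measure M {\<omega> \<in> space M. \<exists>r\<in>B. smp \<omega> = (s, a, s', r, su, au)} =
          pmf \<tau> (a, s) * pmf (P a s) s' * measure (rew s s' a) B
            * (1 / real CARD('s)) * (1 / real CARD('a)))"

text \<open>
  A run of \<open>T\<close> steps on the probability space \<open>M\<close>, with \<open>F k\<close> the information
  available before the sample of step \<open>k\<close> is drawn. That the stochastic gradients are unbiased means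
  that the noise has mean zero given \<open>F k\<close>. The next state observed in step \<open>k\<close> is not
  required to be the same random variable as the state observed in step \<open>k + 1\<close>: if it
  were, the history would in general reveal the latter and contradict the unbiasedness.
\<close>

definition spd_q_learning ::
  "'w measure \<Rightarrow> (nat \<Rightarrow> 'w measure) \<Rightarrow> real \<Rightarrow> real
     \<Rightarrow> ('a::finite \<Rightarrow> 's::finite \<Rightarrow> 's pmf) \<Rightarrow> ('s \<Rightarrow> 's \<Rightarrow> 'a \<Rightarrow> real measure)
     \<Rightarrow> real^'s \<Rightarrow> real \<Rightarrow> (nat \<Rightarrow> ('a \<times> 's) pmf) \<Rightarrow> (nat \<Rightarrow> real) \<Rightarrow> nat
     \<Rightarrow> (nat \<Rightarrow> 'w \<Rightarrow> ('s, 'a) sample)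
     \<Rightarrow> (nat \<Rightarrow> 'w \<Rightarrow> (real^('a \<times> 's)) \<times> (real^'s))
     \<Rightarrow> (nat \<Rightarrow> 'w \<Rightarrow> (real^('a \<times> 's)) \<times> (real^('a \<times> 's))) \<Rightarrow> bool" where
  "spd_q_learning M F \<alpha> \<sigma> P rew \<eta> \<zeta> \<tau> \<gamma> T smp x y \<longleftrightarrow>
     prob_space M \<and> filtration (space M) F \<and>
     (\<forall>\<omega>\<in>space M.
        (\<forall>i. fst (x 0 \<omega>) $ i \<in> {0..\<sigma> / (1 - \<alpha>)}) \<and>
        (\<forall>s. snd (x 0 \<omega>) $ s \<in> {0..\<sigma> / (1 - \<alpha>)}) \<and>
        (\<forall>i. fst (y 0 \<omega>) $ i \<in> {0..norm1 \<eta> / (1 - \<alpha>)}) \<and>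
        (\<forall>i. snd (y 0 \<omega>) $ i \<in> {0..norm1 \<eta> / (\<zeta> * (1 - \<alpha>))})) \<and>
     (\<forall>k<T. \<forall>\<omega>\<in>space M.
        x (Suc k) \<omega> = closest_point (X_set \<alpha> \<sigma>) (x k \<omega> - \<gamma> k *\<^sub>R grad_x \<alpha> \<eta> (y k \<omega>) (smp k \<omega>)) \<and>
        y (Suc k) \<omega> = closest_point (Y_set \<alpha> \<zeta> \<eta>) (y k \<omega> + \<gamma> k *\<^sub>R grad_y \<alpha> (x k \<omega>) (smp k \<omega>))) \<and>
     (\<forall>k<T. has_sample_law M P rew (\<tau> k) (smp k)) \<and>
     (\<forall>k<T. x k \<in> borel_measurable (F k) \<and> y k \<in> borel_measurable (F k)) \<and>
     (\<forall>k<T. let \<epsilon> = (\<lambda>\<omega>. noise_x \<alpha> P rew \<eta> (\<tau> k) (x k \<omega>) (y k \<omega>) (smp k \<omega>));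
                 \<xi> = (\<lambda>\<omega>. noise_y \<alpha> P rew \<eta> (\<tau> k) (x k \<omega>) (y k \<omega>) (smp k \<omega>))
             in \<epsilon> \<in> borel_measurable (F (Suc k)) \<and> cond_mean_zero M (F k) \<epsilon> \<and>
                \<xi> \<in> borel_measurable (F (Suc k)) \<and> cond_mean_zero M (F k) \<xi>)"

definition dual_average ::
  "nat \<Rightarrow> (nat \<Rightarrow> 'w \<Rightarrow> (real^('a::finite \<times> 's::finite)) \<times> (real^('a \<times> 's))) \<Rightarrow> 'w \<Rightarrow> real^('a \<times> 's)" where
  "dual_average T y \<omega> = (1 / real T) *\<^sub>R (\<Sum>k<T. fst (y k \<omega>))"

end

theory Submission
  imports Defs
begin

text \<open>
  The Lagrangian is affine in \<open>x\<close> and in \<open>y\<close>. With \<open>\<lambda>\<^sup>*\<close> the discounted occupancy measure of an optimal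
  policy, the dual point \<open>y\<^sub>k\<^sup>* = (\<lambda>\<^sup>*, M\<^sub>k\<^sup>-\<^sup>1 \<lambda>\<^sup>*)\<close> makes \<open>L\<close> constant, equal to \<open>\<eta>\<^sup>T V\<^sup>*\<close>; and the primal
  point \<open>x\<^sup>\<pi> = (Q\<^sup>\<pi>, V\<^sup>\<pi>)\<close> of the averaged dual policy \<open>\<pi>\<close> satisfies
  \<open>L(x\<^sup>\<pi>, y\<^sub>k) = \<eta>\<^sup>T V\<^sup>\<pi> + \<lambda>\<^sub>k\<^sup>T (Q\<^sup>\<pi> - V\<^sup>\<pi>)\<close>, where the last term vanishes after averaging over \<open>k\<close> by
  the choice of \<open>\<pi>\<close>. Hence \<open>T \<eta>\<^sup>T (V\<^sup>* - V\<^sup>\<pi>)\<close> is a sum of regrets of projected gradient descent and ascent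
  against these comparison points, plus noise. The drift of \<open>y\<^sub>k\<^sup>*\<close> is controlled by \<open>\<beta>\<^sub>k\<close>.
  The noise contribution \<open>\<Sum>\<^sub>k \<langle>\<epsilon>\<^sub>k, x\<^sub>k - x\<^sup>\<pi>\<rangle>\<close> is not a martingale, because \<open>x\<^sup>\<pi>\<close> depends on the whole run.
  It is split at a shadow sequence \<open>u\<^sub>k\<close>, produced by projected gradient steps along the noise itself:
  \<open>\<langle>\<epsilon>\<^sub>k, u\<^sub>k - x\<^sup>\<pi>\<rangle>\<close> is again a regret, and \<open>\<langle>\<epsilon>\<^sub>k, x\<^sub>k - u\<^sub>k\<rangle>\<close> is a bounded martingale difference
  sequence, handled by the Azuma-Hoeffding inequality.
\<close>

subsection \<open>Value functions as discounted series\<close>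

text \<open>Affinity makes the pairing of a gradient with a difference of points equal to a
  difference of Lagrangian values. The gap therefore satisfies an exact identity at every step, and
  the whole estimate is an inequality at a fixed sample point. Probability enters only through one
  Azuma-Hoeffding event and the null set on which observed rewards leave their range. Two rates have
  to match: the steps shrink like 1/sqrt(k+1), and a drift of order 1/(k+1) in the dual comparison
  point, divided by the step, is again of order 1/sqrt(k+1). Everything thus sums to order sqrt(T).
  With step \<open>\<gamma>\<^sub>0\<close> for the iterates and half of it for the shadow sequence,
  the squared norms of gradients and noise contribute 8 + 16 + 2 = 26 multiples of
  \<open>\<gamma>\<^sub>0\<close>, which is the 26 in \<open>\<kappa>\<^sub>1\<close>. A separate
  obstacle is that values are integrals over an infinite product space while the averaged policy is
  itself random. Rewriting them as series in the policy gives both the Bellman equation and the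
  measurability of the final event.\<close>

lemma discounted_mdpD:
  assumes "discounted_mdp \<alpha> \<sigma> rew"
  shows "0 \<le> \<alpha>" "\<alpha> < 1" "1 \<le> \<sigma>" "prob_space (rew s s' a)" "sets (rew s s' a) = sets borel"
    "AE r in rew s s' a. 0 \<le> r \<and> r \<le> \<sigma>"
  using assms by (auto simp: discounted_mdp_def)

definition policy_trans :: "('a::finite \<Rightarrow> 's::finite \<Rightarrow> 's pmf) \<Rightarrow> ('s \<Rightarrow> 'a pmf) \<Rightarrow> 's \<Rightarrow> 's \<Rightarrow> real" where
  "policy_trans P \<pi> s t = (\<Sum>a\<in>UNIV. pmf (\<pi> s) a * pmf (P a s) t)"

definition policy_reward ::
  "('a::finite \<Rightarrow> 's::finite \<Rightarrow> 's pmf) \<Rightarrow> ('s \<Rightarrow> 's \<Rightarrow> 'a \<Rightarrow> real measure) \<Rightarrow> ('s \<Rightarrow> 'a pmf) \<Rightarrow> 's \<Rightarrow> real" where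
  "policy_reward P rew \<pi> s = (\<Sum>a\<in>UNIV. pmf (\<pi> s) a * stacked_R P rew $ (a, s))"

text \<open>\<open>K\<close> is left general: the policy kernel gives the expectation operator on
  functions of the state, and its transpose pushes state distributions forward in
  \<open>exists_occupancy\<close>.\<close>

definition apply_kernel :: "('s::finite \<Rightarrow> 's \<Rightarrow> real) \<Rightarrow> ('s \<Rightarrow> real) \<Rightarrow> 's \<Rightarrow> real" where
  "apply_kernel K h s = (\<Sum>t\<in>UNIV. K s t * h t)"

text \<open>Nonnegative integrals spare any tracking of integrability while kernels are composed;
  real expectations return only in \<open>policy_value_series\<close>.\<close>

lemma nn_integral_step_law:
  fixes P :: "'a::finite \<Rightarrow> 's::finite \<Rightarrow> 's pmf" and rew :: "'s \<Rightarrow> 's \<Rightarrow> 'a \<Rightarrow> real measure"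
  assumes mdp: "discounted_mdp \<alpha> \<sigma> rew" and f: "f \<in> borel_measurable step_space"
  shows "(\<integral>\<^sup>+z. f z \<partial>step_law P rew \<pi> s) =
    (\<Sum>a\<in>UNIV. \<Sum>s'\<in>UNIV. ennreal (pmf (\<pi> s) a * pmf (P a s) s') * (\<integral>\<^sup>+r. f (a, s', r) \<partial>rew s s' a))"
proof -
  note sets_rew[measurable_cong] = discounted_mdpD(5)[OF mdp]
  have pair: "(\<lambda>r. (a, s', r)) \<in> rew s s' a \<rightarrow>\<^sub>M step_space" for s' :: 's and a :: 'a
    unfolding step_space_def by measurable
  let ?D = "\<lambda>a s'. distr (rew s s' a) step_space (\<lambda>r. (a, s', r))"
  have D: "?D a s' \<in> space (subprob_algebra step_space)" for a s'
    using discounted_mdpD(4)[OF mdp] pair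
    by (auto simp: space_subprob_algebra intro!: prob_space_imp_subprob_space prob_space.prob_space_distr)
  have D': "?D a \<in> measurable (measure_pmf (P a s)) (subprob_algebra step_space)" for a
    using D by auto
  have E: "measure_pmf (P a s) \<bind> ?D a \<in> space (subprob_algebra step_space)" for a
    using subprob_space_bind[OF _ D'[of a]] D' sets_bind[of "measure_pmf (P a s)" "?D a" step_space]
    by (simp add: space_subprob_algebra measure_pmf.subprob_space_axioms)
  then have E': "(\<lambda>a. measure_pmf (P a s) \<bind> ?D a) \<in> measurable (measure_pmf (\<pi> s)) (subprob_algebra step_space)"
    by auto
  have "(\<integral>\<^sup>+z. f z \<partial>step_law P rew \<pi> s) = (\<integral>\<^sup>+a. \<integral>\<^sup>+s'. \<integral>\<^sup>+z. f z \<partial>?D a s' \<partial>measure_pmf (P a s) \<partial>measure_pmf (\<pi> s))"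
    unfolding step_law_def by (simp add: nn_integral_bind[OF f E'] nn_integral_bind[OF f D'])
  also have "\<dots> = (\<integral>\<^sup>+a. \<integral>\<^sup>+s'. \<integral>\<^sup>+r. f (a, s', r) \<partial>rew s s' a \<partial>measure_pmf (P a s) \<partial>measure_pmf (\<pi> s))"
    using f by (simp add: nn_integral_distr[OF pair])
  also have "\<dots> = (\<Sum>a\<in>UNIV. \<Sum>s'\<in>UNIV. ennreal (pmf (\<pi> s) a * pmf (P a s) s') * (\<integral>\<^sup>+r. f (a, s', r) \<partial>rew s s' a))"
    by (simp add: nn_integral_measure_pmf nn_integral_count_space_finite sum_distrib_left ennreal_mult mult.assoc)
  finally show ?thesis .
qed

lemma measurable_state_at [measurable]:
  assumes "{..<n} \<subseteq> I"
  shows "state_at s n \<in> PiM I (\<lambda>_. step_space) \<rightarrow>\<^sub>M count_space UNIV"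
proof (cases n)
  case (Suc m)
  have "(\<lambda>\<omega>. \<omega> m) \<in> PiM I (\<lambda>_. step_space) \<rightarrow>\<^sub>M count_space UNIV \<Otimes>\<^sub>M (count_space UNIV \<Otimes>\<^sub>M borel)"
    unfolding step_space_def using Suc assms by (intro measurable_component_singleton) auto
  from measurable_compose[OF this, of "\<lambda>x. fst (snd x)" "count_space UNIV"]
  show ?thesis
    by (simp add: state_at_def[abs_def] Suc)
qed (simp add: state_at_def[abs_def])

section \<open>Iterated transition kernels and their discounted series\<close>

abbreviation transition_operator where
  "transition_operator P \<pi> \<equiv> apply_kernel (policy_trans P \<pi>)"

lemma policy_trans_nonneg: "0 \<le> policy_trans P \<pi> s t"
  by (auto simp: policy_trans_def intro!: sum_nonneg)

lemma sum_policy_trans: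
  fixes P :: "'a::finite \<Rightarrow> 's::finite \<Rightarrow> 's pmf"
  shows "(\<Sum>t\<in>UNIV. policy_trans P \<pi> s t) = 1"
  unfolding policy_trans_def
  by (subst sum.swap) (simp add: sum_distrib_left[symmetric] sum_pmf_eq_1)

lemma apply_kernel_nonneg: "(\<And>s t. 0 \<le> K s t) \<Longrightarrow> (\<And>t. 0 \<le> h t) \<Longrightarrow> 0 \<le> apply_kernel K h s"
  by (auto simp: apply_kernel_def intro!: sum_nonneg)

lemma funpow_apply_kernel_nonneg:
  assumes "\<And>s t. 0 \<le> K s t" "\<And>t. 0 \<le> h t"
  shows "0 \<le> (apply_kernel K ^^ n) h s"
proof (induction n arbitrary: s)
  case (Suc n)
  then show ?case
    using apply_kernel_nonneg[of K "(apply_kernel K ^^ n) h", OF assms(1)] by simp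
qed (simp add: assms)

lemma mean_reward_bounds:
  assumes mdp: "discounted_mdp \<alpha> \<sigma> rew"
  shows "0 \<le> mean_reward rew s s' a" "mean_reward rew s s' a \<le> \<sigma>"
    "(\<integral>\<^sup>+r. ennreal r \<partial>rew s s' a) = ennreal (mean_reward rew s s' a)"
proof -
  interpret prob_space "rew s s' a" by (rule discounted_mdpD(4)[OF mdp])
  note [measurable_cong] = discounted_mdpD(5)[OF mdp]
  note ae = discounted_mdpD(6)[OF mdp, of s s' a]
  have int: "integrable (rew s s' a) (\<lambda>r. r)"
    by (rule integrable_const_bound[of _ \<sigma>]) (use ae in auto)
  show "0 \<le> mean_reward rew s s' a"
    unfolding mean_reward_def by (rule integral_nonneg_AE) (use ae in auto)
  show "mean_reward rew s s' a \<le> \<sigma>"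
    unfolding mean_reward_def by (rule integral_le_const[OF int]) (use ae in auto)
  show "(\<integral>\<^sup>+r. ennreal r \<partial>rew s s' a) = ennreal (mean_reward rew s s' a)"
    unfolding mean_reward_def by (rule nn_integral_eq_integral[OF int]) (use ae in auto)
qed

lemma stacked_R_bounds:
  assumes mdp: "discounted_mdp \<alpha> \<sigma> rew"
  shows "0 \<le> stacked_R P rew $ i" "stacked_R P rew $ i \<le> \<sigma>"
proof -
  show "0 \<le> stacked_R P rew $ i"
    using mean_reward_bounds(1)[OF mdp] by (auto simp: stacked_R_def intro!: sum_nonneg)
  have "stacked_R P rew $ i \<le> (\<Sum>s'\<in>UNIV. pmf (P (fst i) (snd i)) s' * \<sigma>)"
    using mean_reward_bounds(2)[OF mdp] by (auto simp: stacked_R_def intro!: sum_mono mult_left_mono)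
  then show "stacked_R P rew $ i \<le> \<sigma>"
    by (simp add: sum_distrib_right[symmetric] sum_pmf_eq_1)
qed

lemma policy_reward_bounds:
  assumes mdp: "discounted_mdp \<alpha> \<sigma> rew"
  shows "0 \<le> policy_reward P rew \<pi> s" "policy_reward P rew \<pi> s \<le> \<sigma>"
proof -
  show "0 \<le> policy_reward P rew \<pi> s"
    using stacked_R_bounds(1)[OF mdp] by (auto simp: policy_reward_def intro!: sum_nonneg)
  have "policy_reward P rew \<pi> s \<le> (\<Sum>a\<in>UNIV. pmf (\<pi> s) a * \<sigma>)"
    using stacked_R_bounds(2)[OF mdp] by (auto simp: policy_reward_def intro!: sum_mono mult_left_mono)
  then show "policy_reward P rew \<pi> s \<le> \<sigma>"
    by (simp add: sum_distrib_right[symmetric] sum_pmf_eq_1)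
qed

lemma funpow_transition_le:
  fixes P :: "'a::finite \<Rightarrow> 's::finite \<Rightarrow> 's pmf"
  assumes "\<And>t. h t \<le> c"
  shows "(transition_operator P \<pi> ^^ n) h s \<le> c"
proof (induction n arbitrary: s)
  case (Suc n)
  have "(transition_operator P \<pi> ^^ Suc n) h s \<le> (\<Sum>t\<in>UNIV. policy_trans P \<pi> s t * c)"
    unfolding funpow.simps comp_def apply_kernel_def[of _ "(transition_operator P \<pi> ^^ n) h"]
    by (intro sum_mono mult_left_mono Suc policy_trans_nonneg)
  then show ?case
    by (simp add: sum_distrib_right[symmetric] sum_policy_trans)
qed (simp add: assms)

text \<open>Domination by a geometric series permits splitting off the term n = 0 and exchanging the
  series with the finite sum over states. It serves twice: for values with the policy kernel, and
  for occupancy measures with its transpose.\<close>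

lemma discounted_series:
  fixes K :: "'s::finite \<Rightarrow> 's \<Rightarrow> real"
  assumes bound: "\<And>n s. \<bar>(apply_kernel K ^^ n) h s\<bar> \<le> B" and \<alpha>: "0 \<le> \<alpha>" "\<alpha> < 1"
  defines "v \<equiv> \<lambda>s. \<Sum>n. \<alpha> ^ n * (apply_kernel K ^^ n) h s"
  shows "summable (\<lambda>n. \<alpha> ^ n * (apply_kernel K ^^ n) h s)"
    and "v s = h s + \<alpha> * apply_kernel K v s"
proof -
  have sm: "summable (\<lambda>n. \<alpha> ^ n * (apply_kernel K ^^ n) h s)" for s
  proof (rule summable_comparison_test'[of "\<lambda>n. \<alpha> ^ n * B" 0])
    show "summable (\<lambda>n. \<alpha> ^ n * B)"
      using \<alpha> by (intro summable_mult2 summable_geometric) simp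
  qed (use \<alpha> bound in \<open>auto simp: abs_mult intro!: mult_left_mono\<close>)
  then show "summable (\<lambda>n. \<alpha> ^ n * (apply_kernel K ^^ n) h s)" .
  have "v s = h s + (\<Sum>n. \<alpha> ^ Suc n * (apply_kernel K ^^ Suc n) h s)"
    unfolding v_def using suminf_split_head[OF sm[of s]] by simp
  also have "(\<lambda>n. \<alpha> ^ Suc n * (apply_kernel K ^^ Suc n) h s) =
      (\<lambda>n. \<alpha> * (\<Sum>t\<in>UNIV. K s t * (\<alpha> ^ n * (apply_kernel K ^^ n) h t)))"
  proof
    fix n
    show "\<alpha> ^ Suc n * (apply_kernel K ^^ Suc n) h s = \<alpha> * (\<Sum>t\<in>UNIV. K s t * (\<alpha> ^ n * (apply_kernel K ^^ n) h t))"
      unfolding funpow.simps comp_def apply_kernel_def[of K "(apply_kernel K ^^ n) h"]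
      by (simp add: sum_distrib_left mult_ac)
  qed
  also have "suminf \<dots> = \<alpha> * (\<Sum>n. \<Sum>t\<in>UNIV. K s t * (\<alpha> ^ n * (apply_kernel K ^^ n) h t))"
    by (intro suminf_mult summable_sum summable_mult sm)
  also have "(\<Sum>n. \<Sum>t\<in>UNIV. K s t * (\<alpha> ^ n * (apply_kernel K ^^ n) h t)) =
      (\<Sum>t\<in>UNIV. \<Sum>n. K s t * (\<alpha> ^ n * (apply_kernel K ^^ n) h t))"
    by (intro suminf_sum summable_mult sm)
  also have "\<dots> = (\<Sum>t\<in>UNIV. K s t * v t)"
    unfolding v_def by (intro sum.cong refl suminf_mult sm)
  finally show "v s = h s + \<alpha> * apply_kernel K v s"
    by (simp add: apply_kernel_def)
qed

section \<open>Integrals over the trajectory law\<close>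

context
  fixes P :: "'a::finite \<Rightarrow> 's::finite \<Rightarrow> 's pmf" and rew :: "'s \<Rightarrow> 's \<Rightarrow> 'a \<Rightarrow> real measure" and \<alpha> \<sigma> :: real
  assumes mdp: "discounted_mdp \<alpha> \<sigma> rew"
begin

lemma trajectory_law_space:
  shows "prob_space (trajectory_law P rew \<pi> s)"
    "sets (trajectory_law P rew \<pi> s) = sets (PiM UNIV (\<lambda>_. step_space))"
proof -
  interpret Ionescu_Tulcea "trajectory_kernel P rew \<pi> s" "\<lambda>_. step_space"
    by (rule Ionescu_Tulcea_trajectory_kernel[OF mdp])
  show "sets (trajectory_law P rew \<pi> s) = sets (PiM UNIV (\<lambda>_. step_space))"
    by (simp add: trajectory_law_def PF.sets_lim)
  \<comment> \<open>Projecting onto no coordinates at all preserves mass, so the marginal over the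
    empty index set already shows that the total mass is 1.\<close>
  have d: "distr (trajectory_law P rew \<pi> s) (PiM {0..<0} (\<lambda>_. step_space)) (\<lambda>x. restrict x {0..<0}) = CI {0..<0}"
    unfolding trajectory_law_def by (rule distr_lim) auto
  have "prob_space (distr (trajectory_law P rew \<pi> s) (PiM {0..<0} (\<lambda>_. step_space)) (\<lambda>x. restrict x {0..<0}))"
    unfolding d by (rule PF.prob_space_P) auto
  then show "prob_space (trajectory_law P rew \<pi> s)"
    by (rule prob_space_distrD[rotated])
      (simp add: trajectory_law_def measurable_cong_sets[OF PF.sets_lim refl])
qed

text \<open>The bridge between the projective limit and the finite composition \<open>C\<close> of
  kernels. The starting point \<open>\<lambda>_. undefined\<close> is the only element of the
  product over the empty index set, that is, the empty history.\<close>

lemma nn_integral_trajectory_restrict: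
  assumes f: "f \<in> borel_measurable (PiM {0..<n} (\<lambda>_. step_space))"
  shows "(\<integral>\<^sup>+\<omega>. f (restrict \<omega> {0..<n}) \<partial>trajectory_law P rew \<pi> s) =
    (\<integral>\<^sup>+\<omega>. f \<omega> \<partial>Ionescu_Tulcea.C (trajectory_kernel P rew \<pi> s) (\<lambda>_. step_space) 0 n (\<lambda>_. undefined))"
proof -
  interpret Ionescu_Tulcea "trajectory_kernel P rew \<pi> s" "\<lambda>_. step_space"
    by (rule Ionescu_Tulcea_trajectory_kernel[OF mdp])
  have emb: "prod_emb {0..<n} (\<lambda>_. step_space) {0..<n} X = X"
    if "X \<in> sets (PiM {0..<n} (\<lambda>_. step_space))" for X :: "(nat \<Rightarrow> 'a \<times> 's \<times> real) set"
    using sets.sets_into_space[OF that] by (intro prod_emb_id) (simp add: space_PiM)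
  have "CI {0..<n} = C 0 n (\<lambda>_. undefined)"
    by (rule measure_eqI)
      (use emb in \<open>auto simp: CI_def sets_C emeasure_CI[unfolded CI_def, of _ n]\<close>)
  moreover have "distr (trajectory_law P rew \<pi> s) (PiM {0..<n} (\<lambda>_. step_space)) (\<lambda>x. restrict x {0..<n}) = CI {0..<n}"
    unfolding trajectory_law_def by (rule distr_lim) auto
  moreover have "f \<in> borel_measurable (C 0 n (\<lambda>_. undefined))"
    using f by (simp add: measurable_cong_sets[OF sets_C refl])
  ultimately show ?thesis
    using nn_integral_distr[of "\<lambda>x. restrict x {0..<n}" "trajectory_law P rew \<pi> s" "PiM {0..<n} (\<lambda>_. step_space)" f] f
    by (simp add: measurable_cong_sets[OF trajectory_law_space(2) refl])
qed

text \<open>The Markov property at a single time: the composition up to \<open>Suc n\<close> ends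
  with the kernel of step \<open>n\<close>, which sees the history only through the current
  state.\<close>

lemma nn_integral_trajectory_step:
  assumes f: "f \<in> borel_measurable step_space"
  shows "(\<integral>\<^sup>+\<omega>. f (\<omega> n) \<partial>trajectory_law P rew \<pi> s) =
    (\<integral>\<^sup>+\<omega>. (\<integral>\<^sup>+z. f z \<partial>step_law P rew \<pi> (state_at s n \<omega>)) \<partial>trajectory_law P rew \<pi> s)"
proof -
  interpret Ionescu_Tulcea "trajectory_kernel P rew \<pi> s" "\<lambda>_. step_space"
    by (rule Ionescu_Tulcea_trajectory_kernel[OF mdp])
  let ?g = "\<lambda>\<omega>. \<integral>\<^sup>+z. f z \<partial>step_law P rew \<pi> (state_at s n \<omega>)"
  have f': "(\<lambda>\<omega>. f (\<omega> n)) \<in> borel_measurable (PiM {0..<Suc n} (\<lambda>_. step_space))"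
    by (rule measurable_compose[OF _ f]) (simp add: measurable_component_singleton)
  have g': "?g \<in> borel_measurable (PiM {0..<n} (\<lambda>_. step_space))"
    by (rule measurable_compose[OF measurable_state_at]) auto
  have "(\<integral>\<^sup>+\<omega>. f (\<omega> n) \<partial>trajectory_law P rew \<pi> s) = (\<integral>\<^sup>+\<omega>. f (restrict \<omega> {0..<Suc n} n) \<partial>trajectory_law P rew \<pi> s)"
    by simp
  also have "\<dots> = (\<integral>\<^sup>+\<omega>. f (\<omega> n) \<partial>C 0 (Suc n) (\<lambda>_. undefined))"
    by (rule nn_integral_trajectory_restrict[OF f'])
  also have "\<dots> = (\<integral>\<^sup>+\<omega>. \<integral>\<^sup>+z. f (z n) \<partial>eP n \<omega> \<partial>C 0 n (\<lambda>_. undefined))"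
    using measurable_eP[of n] f'
    by (simp add: nn_integral_bind[where B="PiM {0..<Suc n} (\<lambda>_. step_space)"] measurable_cong_sets[OF sets_C refl])
  also have "\<dots> = (\<integral>\<^sup>+\<omega>. ?g \<omega> \<partial>C 0 n (\<lambda>_. undefined))"
    using f' by (intro nn_integral_cong) (simp add: space_C nn_integral_eP trajectory_kernel_def)
  also have "\<dots> = (\<integral>\<^sup>+\<omega>. ?g (restrict \<omega> {0..<n}) \<partial>trajectory_law P rew \<pi> s)"
    by (rule nn_integral_trajectory_restrict[OF g', symmetric])
  \<comment> \<open>\<open>state_at s n\<close> reads at most the coordinate n - 1, so cutting the
    trajectory at \<open>n\<close> does not change it.\<close>
  also have "\<dots> = (\<integral>\<^sup>+\<omega>. ?g \<omega> \<partial>trajectory_law P rew \<pi> s)"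
    by (intro nn_integral_cong arg_cong[where f="\<lambda>t. \<integral>\<^sup>+z. f z \<partial>step_law P rew \<pi> t"])
      (auto simp: state_at_def split: nat.split)
  finally show ?thesis .
qed

text \<open>The last step is integrated out first, which replaces \<open>h\<close> by its one-step
  expectation. Hence the induction runs over all \<open>h\<close>, and the new operator appears on
  the inside of the iterate.\<close>

lemma nn_integral_trajectory_state:
  assumes h: "\<And>t. 0 \<le> h t"
  shows "(\<integral>\<^sup>+\<omega>. ennreal (h (state_at s n \<omega>)) \<partial>trajectory_law P rew \<pi> s) =
    ennreal ((transition_operator P \<pi> ^^ n) h s)"
  using h
proof (induction n arbitrary: h)
  case 0
  interpret prob_space "trajectory_law P rew \<pi> s"
    by (rule trajectory_law_space)
  show ?case
    by (simp add: state_at_def emeasure_space_1)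
next
  case (Suc n)
  have *: "(\<integral>\<^sup>+z. ennreal (h (fst (snd z))) \<partial>step_law P rew \<pi> t) =
      ennreal (transition_operator P \<pi> h t)" for t
  proof -
    have "(\<lambda>z. ennreal (h (fst (snd z)))) \<in> borel_measurable (step_space :: ('a \<times> 's \<times> real) measure)"
      unfolding step_space_def by measurable
    then have "(\<integral>\<^sup>+z. ennreal (h (fst (snd z))) \<partial>step_law P rew \<pi> t) =
        (\<Sum>a\<in>UNIV. \<Sum>s'\<in>UNIV. ennreal (pmf (\<pi> t) a * pmf (P a t) s' * h s'))"
      using prob_space.emeasure_space_1[OF discounted_mdpD(4)[OF mdp]] Suc.prems
      by (simp add: nn_integral_step_law[OF mdp] ennreal_mult)
    also have "\<dots> = ennreal (\<Sum>a\<in>UNIV. \<Sum>s'\<in>UNIV. pmf (\<pi> t) a * pmf (P a t) s' * h s')"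
      using Suc.prems by (simp add: sum_ennreal sum_nonneg)
    also have "(\<Sum>a\<in>UNIV. \<Sum>s'\<in>UNIV. pmf (\<pi> t) a * pmf (P a t) s' * h s') = transition_operator P \<pi> h t"
      unfolding apply_kernel_def policy_trans_def by (subst sum.swap) (simp add: sum_distrib_right)
    finally show ?thesis .
  qed
  have "(\<lambda>z. ennreal (h (fst (snd z)))) \<in> borel_measurable (step_space :: ('a \<times> 's \<times> real) measure)"
    unfolding step_space_def by measurable
  from nn_integral_trajectory_step[OF this, of \<pi> s n]
  have "(\<integral>\<^sup>+\<omega>. ennreal (h (state_at s (Suc n) \<omega>)) \<partial>trajectory_law P rew \<pi> s) =
      (\<integral>\<^sup>+\<omega>. ennreal (transition_operator P \<pi> h (state_at s n \<omega>)) \<partial>trajectory_law P rew \<pi> s)"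
    by (simp add: * state_at_def[of s "Suc n"])
  also have "\<dots> = ennreal ((transition_operator P \<pi> ^^ n) (transition_operator P \<pi> h) s)"
    using Suc.prems by (intro Suc.IH apply_kernel_nonneg policy_trans_nonneg)
  finally show ?case
    by (simp add: funpow_swap1)
qed

lemma AE_trajectory_reward:
  "AE \<omega> in trajectory_law P rew \<pi> s. 0 \<le> snd (snd (\<omega> n)) \<and> snd (snd (\<omega> n)) \<le> \<sigma>"
proof -
  let ?B = "{z. \<not> (0 \<le> snd (snd z) \<and> snd (snd z) \<le> \<sigma>)} :: ('a \<times> 's \<times> real) set"
  note sets_rew[measurable_cong] = discounted_mdpD(5)[OF mdp]
  have B: "(indicator ?B :: _ \<Rightarrow> ennreal) \<in> borel_measurable step_space"
    unfolding step_space_def by measurable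
  have pred: "Measurable.pred (step_space :: ('a \<times> 's \<times> real) measure) (\<lambda>z. 0 \<le> snd (snd z) \<and> snd (snd z) \<le> \<sigma>)"
    unfolding step_space_def by measurable
  have zero: "(\<integral>\<^sup>+r. indicator ?B (a, s', r) \<partial>rew t s' a) = 0" for a s' t
  proof -
    have "(\<integral>\<^sup>+r. indicator ?B (a, s', r) \<partial>rew t s' a) = (\<integral>\<^sup>+r. 0 \<partial>rew t s' a)"
      by (rule nn_integral_cong_AE) (use discounted_mdpD(6)[OF mdp, of t s' a] in \<open>auto simp: indicator_def\<close>)
    then show ?thesis by simp
  qed
  have 0: "(\<integral>\<^sup>+\<omega>. indicator ?B (\<omega> n) \<partial>trajectory_law P rew \<pi> s) = 0"
    unfolding nn_integral_trajectory_step[OF B] nn_integral_step_law[OF mdp B] zero by simp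
  have "(\<lambda>\<omega>. indicator ?B (\<omega> n) :: ennreal) \<in> borel_measurable (trajectory_law P rew \<pi> s)"
    unfolding measurable_cong_sets[OF trajectory_law_space(2) refl]
    by (rule measurable_compose[OF _ B]) (simp add: measurable_component_singleton)
  from nn_integral_0_iff_AE[OF this] 0 show ?thesis
    by (auto simp: indicator_def elim: AE_mp)
qed

lemma nn_integral_trajectory_reward:
  "(\<integral>\<^sup>+\<omega>. ennreal (snd (snd (\<omega> n))) \<partial>trajectory_law P rew \<pi> s) =
    ennreal ((transition_operator P \<pi> ^^ n) (policy_reward P rew \<pi>) s)"
proof -
  have f: "(\<lambda>z. ennreal (snd (snd z))) \<in> borel_measurable (step_space :: ('a \<times> 's \<times> real) measure)"
    unfolding step_space_def by measurable
  have "(\<integral>\<^sup>+z. ennreal (snd (snd z)) \<partial>step_law P rew \<pi> t) = ennreal (policy_reward P rew \<pi> t)" for t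
  proof -
    have "(\<integral>\<^sup>+z. ennreal (snd (snd z)) \<partial>step_law P rew \<pi> t) =
        (\<Sum>a\<in>UNIV. \<Sum>s'\<in>UNIV. ennreal (pmf (\<pi> t) a * pmf (P a t) s' * mean_reward rew t s' a))"
      by (simp add: nn_integral_step_law[OF mdp f] mean_reward_bounds[OF mdp] ennreal_mult)
    also have "\<dots> = ennreal (\<Sum>a\<in>UNIV. \<Sum>s'\<in>UNIV. pmf (\<pi> t) a * pmf (P a t) s' * mean_reward rew t s' a)"
      by (simp add: sum_ennreal sum_nonneg mean_reward_bounds[OF mdp])
    also have "\<dots> = ennreal (policy_reward P rew \<pi> t)"
      by (simp add: policy_reward_def stacked_R_def sum_distrib_left mult.assoc)
    finally show ?thesis .
  qed
  then show ?thesis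
    by (simp add: nn_integral_trajectory_step[OF f] nn_integral_trajectory_state policy_reward_bounds[OF mdp])
qed

text \<open>Expectation and series may be exchanged because rewards lie in [0, \<sigma>] almost
  surely, so a geometric series dominates. All later facts about values come from this series and
  its Bellman equation, not from the trajectory law.\<close>

theorem policy_value_series:
  "policy_value \<alpha> P rew \<pi> $ s = (\<Sum>n. \<alpha> ^ n * (transition_operator P \<pi> ^^ n) (policy_reward P rew \<pi>) s)"
proof -
  let ?M = "trajectory_law P rew \<pi> s"
  interpret prob_space ?M by (rule trajectory_law_space)
  note \<alpha> = discounted_mdpD(1,2)[OF mdp]
  have meas: "(\<lambda>\<omega>. snd (snd (\<omega> n))) \<in> borel_measurable ?M" for n
  proof -
    have "(\<lambda>z. snd (snd z)) \<in> borel_measurable (step_space :: ('a \<times> 's \<times> real) measure)"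
      unfolding step_space_def by measurable
    then show ?thesis
      unfolding measurable_cong_sets[OF trajectory_law_space(2) refl]
      by (rule measurable_compose[rotated]) (simp add: measurable_component_singleton)
  qed
  have ae: "AE \<omega> in ?M. \<forall>n. 0 \<le> snd (snd (\<omega> n)) \<and> snd (snd (\<omega> n)) \<le> \<sigma>"
    using AE_trajectory_reward by (simp add: AE_all_countable)
  have int: "integrable ?M (\<lambda>\<omega>. snd (snd (\<omega> n)))" for n
    by (rule integrable_const_bound[of _ \<sigma>]) (use ae meas in auto)
  have E: "(\<integral>\<omega>. snd (snd (\<omega> n)) \<partial>?M) = (transition_operator P \<pi> ^^ n) (policy_reward P rew \<pi>) s" for n
  proof -
    have "AE \<omega> in ?M. 0 \<le> snd (snd (\<omega> n))"
      using ae by auto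
    then show ?thesis
      using nn_integral_eq_integral[OF int[of n]] nn_integral_trajectory_reward[of \<pi> s n]
        funpow_apply_kernel_nonneg[of "policy_trans P \<pi>" "policy_reward P rew \<pi>" n s,
          OF policy_trans_nonneg policy_reward_bounds(1)[OF mdp]]
      by (simp add: integral_nonneg_AE)
  qed
  have sm: "summable (\<lambda>n. \<alpha> ^ n * \<sigma>)"
    using \<alpha> by (intro summable_mult2 summable_geometric) simp
  have "(\<integral>\<omega>. (\<Sum>n. \<alpha> ^ n * snd (snd (\<omega> n))) \<partial>?M) = (\<Sum>n. \<integral>\<omega>. \<alpha> ^ n * snd (snd (\<omega> n)) \<partial>?M)"
  proof (rule integral_suminf)
    show "AE \<omega> in ?M. summable (\<lambda>n. norm (\<alpha> ^ n * snd (snd (\<omega> n))))"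
      using ae
    proof eventually_elim
      case (elim \<omega>)
      then show ?case
        using \<alpha> by (intro summable_comparison_test'[OF sm, of 0]) (auto simp: abs_mult intro!: mult_left_mono)
    qed
    show "summable (\<lambda>n. \<integral>\<omega>. norm (\<alpha> ^ n * snd (snd (\<omega> n))) \<partial>?M)"
    proof (rule summable_comparison_test'[OF sm, of 0])
      fix n
      have "(\<integral>\<omega>. norm (\<alpha> ^ n * snd (snd (\<omega> n))) \<partial>?M) \<le> \<alpha> ^ n * \<sigma>"
        by (rule integral_le_const) (use ae \<alpha> int[of n] in \<open>auto simp: abs_mult intro!: mult_left_mono\<close>)
      then show "norm (\<integral>\<omega>. norm (\<alpha> ^ n * snd (snd (\<omega> n))) \<partial>?M) \<le> \<alpha> ^ n * \<sigma>"
        by simp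
    qed
  qed (use int in auto)
  then show ?thesis
    by (simp add: policy_value_def E)
qed

lemma policy_value_Bellman:
  "policy_value \<alpha> P rew \<pi> $ s =
    policy_reward P rew \<pi> s + \<alpha> * transition_operator P \<pi> (\<lambda>t. policy_value \<alpha> P rew \<pi> $ t) s"
proof -
  have "\<bar>(transition_operator P \<pi> ^^ n) (policy_reward P rew \<pi>) s\<bar> \<le> \<sigma>" for n s
    using funpow_apply_kernel_nonneg[of "policy_trans P \<pi>" "policy_reward P rew \<pi>" n s,
        OF policy_trans_nonneg policy_reward_bounds(1)[OF mdp]]
      funpow_transition_le[of "policy_reward P rew \<pi>" \<sigma> n P \<pi> s, OF policy_reward_bounds(2)[OF mdp]]
    by simp
  from discounted_series(2)[where h="policy_reward P rew \<pi>" and K="policy_trans P \<pi>", OF this discounted_mdpD(1,2)[OF mdp], of s]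
  show ?thesis
    unfolding policy_value_series .
qed

end

subsection \<open>Optimal policies and occupancy measures\<close>

lemma sum_UNIV_pairs: "(\<Sum>i\<in>UNIV. f i) = (\<Sum>s\<in>UNIV. \<Sum>a\<in>UNIV. f (a::'a::finite, s::'s::finite))"
  by (subst sum.swap) (simp add: sum.cartesian_product UNIV_Times_UNIV)

text \<open>The Bellman backup of \<open>v\<close> before averaging over actions; at the value
  function of a policy it is the Q-function of that policy.\<close>

definition action_value ::
  "real \<Rightarrow> ('a::finite \<Rightarrow> 's::finite \<Rightarrow> 's pmf) \<Rightarrow> ('s \<Rightarrow> 's \<Rightarrow> 'a \<Rightarrow> real measure) \<Rightarrow> real^'s \<Rightarrow> real^('a \<times> 's)" where
  "action_value \<alpha> P rew v = \<alpha> *\<^sub>R (stacked_P P *v v) + stacked_R P rew"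

lemma action_value_nth:
  "action_value \<alpha> P rew v $ (a, s) = stacked_R P rew $ (a, s) + \<alpha> * (\<Sum>t\<in>UNIV. pmf (P a s) t * v $ t)"
  by (simp add: action_value_def stacked_P_def matrix_vector_mult_def)

lemma sum_action_value:
  "(\<Sum>a\<in>UNIV. pmf (\<pi> s) a * action_value \<alpha> P rew v $ (a, s)) =
    policy_reward P rew \<pi> s + \<alpha> * transition_operator P \<pi> (\<lambda>t. v $ t) s"
proof -
  have "(\<Sum>a\<in>UNIV. pmf (\<pi> s) a * (\<Sum>t\<in>UNIV. pmf (P a s) t * v $ t)) = transition_operator P \<pi> (\<lambda>t. v $ t) s"
    unfolding apply_kernel_def policy_trans_def sum_distrib_left sum_distrib_right
    by (subst sum.swap) (simp add: mult.assoc)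
  then show ?thesis
    by (simp add: action_value_nth policy_reward_def distrib_left sum.distrib sum_distrib_left[symmetric] mult.left_commute[of _ \<alpha>])
qed

lemma transition_operator_mono:
  "(\<And>t. g t \<le> h t) \<Longrightarrow> transition_operator P \<pi> g s \<le> transition_operator P \<pi> h s"
  unfolding apply_kernel_def by (intro sum_mono mult_left_mono policy_trans_nonneg)

lemma transition_operator_const: "transition_operator P \<pi> (\<lambda>_. c) s = c"
  by (simp add: apply_kernel_def sum_distrib_right[symmetric] sum_policy_trans)

lemma transition_operator_diff:
  "transition_operator P \<pi> (\<lambda>t. g t - h t) s = transition_operator P \<pi> g s - transition_operator P \<pi> h s"
  by (simp add: apply_kernel_def right_diff_distrib sum_subtractf)

text \<open>A minimum principle: at a state where \<open>d\<close> attains its minimum m, averaging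
  gives m at least \<alpha> m, and \<alpha> < 1 forces m to be nonnegative. It takes the place of a
  contraction argument in all comparisons of values.\<close>

lemma discounted_supersolution_nonneg:
  fixes d :: "'s::finite \<Rightarrow> real"
  assumes \<alpha>: "0 \<le> \<alpha>" "\<alpha> < 1" and d: "\<And>s. d s \<ge> \<alpha> * transition_operator P \<pi> d s"
  shows "0 \<le> d s"
proof -
  define m where "m = Min (range d)"
  have m: "m \<le> d s" for s
    by (auto simp: m_def)
  obtain s0 where s0: "d s0 = m"
    using Min_in[of "range d"] by (metis m_def finite_imageI finite_UNIV image_is_empty UNIV_not_empty imageE finite)
  have "\<alpha> * m \<le> \<alpha> * transition_operator P \<pi> d s0"
    using transition_operator_mono[of "\<lambda>_. m" d P \<pi> s0] m \<alpha> by (simp add: transition_operator_const mult_left_mono)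
  also have "\<dots> \<le> m"
    using d[of s0] s0 by simp
  finally have "0 \<le> (1 - \<alpha>) * m"
    by (simp add: algebra_simps)
  then have "0 \<le> m"
    using \<alpha> by (simp add: zero_le_mult_iff)
  then show ?thesis
    using m[of s] by simp
qed

lemma Lagrangian_weight_matrix:
  fixes P :: "'a::finite \<Rightarrow> 's::finite \<Rightarrow> 's pmf"
  shows "Lagrangian \<alpha> P rew \<eta> (weight_matrix \<tau>) (Q, V) (lam, mu) =
    \<eta> \<bullet> V + (\<Sum>i\<in>UNIV. pmf \<tau> i * mu $ i * (action_value \<alpha> P rew V $ i - Q $ i))
      + (\<Sum>i\<in>UNIV. lam $ i * (Q $ i - V $ (snd i)))"
proof -
  have W: "(weight_matrix \<tau> *v w) $ i = pmf \<tau> i * w $ i" for w i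
    by (simp add: weight_matrix_def matrix_vector_mult_def if_distrib[of "\<lambda>c. c * _"] cong: if_cong)
  have I: "(stacked_I *v V) $ i = V $ (snd i)" for i :: "'a \<times> 's"
    by (simp add: stacked_I_def matrix_vector_mult_def if_distrib[of "\<lambda>c. c * _"] cong: if_cong)
  show ?thesis
    unfolding Lagrangian_def action_value_def[symmetric] split_conv inner_vec_def[of mu] inner_vec_def[of lam]
    by (simp add: W I mult_ac)
qed

lemma sum_pmf_return: "(\<Sum>a\<in>UNIV. pmf (return_pmf (b::'a::finite)) a * g a :: real) = g b"
proof -
  have "(\<Sum>a\<in>UNIV. pmf (return_pmf b) a * g a) = (\<Sum>a\<in>UNIV. if a = b then g a else 0)"
    by (intro sum.cong) (auto simp: indicator_def)
  then show ?thesis by simp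
qed

context
  fixes P :: "'a::finite \<Rightarrow> 's::finite \<Rightarrow> 's pmf" and rew :: "'s \<Rightarrow> 's \<Rightarrow> 'a \<Rightarrow> real measure" and \<alpha> \<sigma> :: real
  assumes mdp: "discounted_mdp \<alpha> \<sigma> rew"
begin

lemma policy_value_fixpoint:
  "policy_value \<alpha> P rew \<pi> $ s = (\<Sum>a\<in>UNIV. pmf (\<pi> s) a * action_value \<alpha> P rew (policy_value \<alpha> P rew \<pi>) $ (a, s))"
  unfolding sum_action_value by (rule policy_value_Bellman[OF mdp])

text \<open>Subtracting the hypothesis from the Bellman equation of \<open>\<pi>\<close> leaves a
  supersolution of the homogeneous equation, to which the minimum principle applies.\<close>

lemma policy_value_ge:
  assumes "\<And>s. v $ s \<le> (\<Sum>a\<in>UNIV. pmf (\<pi> s) a * action_value \<alpha> P rew v $ (a, s))"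
  shows "v $ s \<le> policy_value \<alpha> P rew \<pi> $ s"
proof -
  let ?d = "\<lambda>s. policy_value \<alpha> P rew \<pi> $ s - v $ s"
  have "?d s \<ge> \<alpha> * transition_operator P \<pi> ?d s" for s
    using assms[of s] policy_value_Bellman[OF mdp, of P \<pi> s]
    by (simp add: sum_action_value transition_operator_diff right_diff_distrib)
  from discounted_supersolution_nonneg[OF discounted_mdpD(1,2)[OF mdp] this, of s] show ?thesis by simp
qed

lemma policy_value_le:
  assumes "\<And>s. (\<Sum>a\<in>UNIV. pmf (\<pi> s) a * action_value \<alpha> P rew v $ (a, s)) \<le> v $ s"
  shows "policy_value \<alpha> P rew \<pi> $ s \<le> v $ s"
proof -
  let ?d = "\<lambda>s. v $ s - policy_value \<alpha> P rew \<pi> $ s"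
  have "?d s \<ge> \<alpha> * transition_operator P \<pi> ?d s" for s
    using assms[of s] policy_value_Bellman[OF mdp, of P \<pi> s]
    by (simp add: sum_action_value transition_operator_diff right_diff_distrib)
  from discounted_supersolution_nonneg[OF discounted_mdpD(1,2)[OF mdp] this, of s] show ?thesis by simp
qed

text \<open>The upper end \<sigma>/(1 - \<alpha>) is the fixed point of the map c to \<sigma> +
  \<alpha> c, so a Bellman backup cannot leave the box.\<close>

lemma action_value_bounds:
  assumes "\<And>s. 0 \<le> v $ s" "\<And>s. v $ s \<le> \<sigma> / (1 - \<alpha>)"
  shows "0 \<le> action_value \<alpha> P rew v $ i" "action_value \<alpha> P rew v $ i \<le> \<sigma> / (1 - \<alpha>)"
proof -
  obtain a s where i: "i = (a, s)" by (cases i)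
  note \<alpha> = discounted_mdpD(1,2)[OF mdp]
  show "0 \<le> action_value \<alpha> P rew v $ i"
    using assms(1) \<alpha> stacked_R_bounds(1)[OF mdp] by (auto simp: i action_value_nth intro!: add_nonneg_nonneg mult_nonneg_nonneg sum_nonneg)
  have "(\<Sum>t\<in>UNIV. pmf (P a s) t * v $ t) \<le> (\<Sum>t\<in>UNIV. pmf (P a s) t * (\<sigma> / (1 - \<alpha>)))"
    by (intro sum_mono mult_left_mono assms) simp
  also have "\<dots> = \<sigma> / (1 - \<alpha>)"
    unfolding sum_distrib_right[symmetric] by (simp add: sum_pmf_eq_1)
  finally have "action_value \<alpha> P rew v $ i \<le> \<sigma> + \<alpha> * (\<sigma> / (1 - \<alpha>))"
    unfolding i action_value_nth using \<alpha> stacked_R_bounds(2)[OF mdp] by (intro add_mono mult_left_mono)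
  also have "\<dots> = \<sigma> / (1 - \<alpha>)"
    using \<alpha> by (simp add: field_simps)
  finally show "action_value \<alpha> P rew v $ i \<le> \<sigma> / (1 - \<alpha>)" .
qed

text \<open>The constants 0 and \<sigma>/(1 - \<alpha>) are a sub- and a supersolution of every
  Bellman equation.\<close>

lemma policy_value_bounds:
  "0 \<le> policy_value \<alpha> P rew \<pi> $ s" "policy_value \<alpha> P rew \<pi> $ s \<le> \<sigma> / (1 - \<alpha>)"
proof -
  note \<alpha> = discounted_mdpD(1-3)[OF mdp]
  have "0 \<le> action_value \<alpha> P rew 0 $ i" for i
    by (rule action_value_bounds) (use \<alpha> in auto)
  then have "0 \<le> (\<Sum>a\<in>UNIV. pmf (\<pi> s) a * action_value \<alpha> P rew 0 $ (a, s))" for s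
    by (intro sum_nonneg mult_nonneg_nonneg) auto
  then show "0 \<le> policy_value \<alpha> P rew \<pi> $ s"
    using policy_value_ge[of 0 \<pi> s] by simp
  let ?v = "\<chi> s. \<sigma> / (1 - \<alpha>) :: real^'s"
  have *: "action_value \<alpha> P rew ?v $ i \<le> \<sigma> / (1 - \<alpha>)" for i
    by (rule action_value_bounds) (use \<alpha> in auto)
  have "policy_value \<alpha> P rew \<pi> $ s \<le> ?v $ s"
  proof (rule policy_value_le)
    fix s
    have "(\<Sum>a\<in>UNIV. pmf (\<pi> s) a * action_value \<alpha> P rew ?v $ (a, s)) \<le> (\<Sum>a\<in>UNIV. pmf (\<pi> s) a * (\<sigma> / (1 - \<alpha>)))"
      by (intro sum_mono mult_left_mono *) simp
    then show "(\<Sum>a\<in>UNIV. pmf (\<pi> s) a * action_value \<alpha> P rew ?v $ (a, s)) \<le> ?v $ s"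
      unfolding sum_distrib_right[symmetric] by (simp add: sum_pmf_eq_1)
  qed
  then show "policy_value \<alpha> P rew \<pi> $ s \<le> \<sigma> / (1 - \<alpha>)"
    by simp
qed

section \<open>Existence of an optimal policy\<close>

text \<open>Policy improvement over the finitely many deterministic policies. A maximiser of the
  values summed over states is greedy for its own value, which is then a supersolution of the
  Bellman equation of every stochastic policy.\<close>

lemma exists_optimal_policy:
  "\<exists>\<pi>. \<forall>\<pi>' s. policy_value \<alpha> P rew \<pi>' $ s \<le> policy_value \<alpha> P rew \<pi> $ s"
proof -
  define V where "V f = policy_value \<alpha> P rew (\<lambda>s. return_pmf (f s))" for f :: "'s \<Rightarrow> 'a"
  have V_fixpoint: "action_value \<alpha> P rew (V f) $ (f s, s) = V f $ s" for f s
    using policy_value_fixpoint[of "\<lambda>s. return_pmf (f s)" s]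
    unfolding V_def sum_pmf_return by (rule sym)
  have V_ge: "v $ s \<le> V f $ s" if "\<And>s. v $ s \<le> action_value \<alpha> P rew v $ (f s, s)" for v f s
    unfolding V_def by (rule policy_value_ge) (unfold sum_pmf_return, rule that)
  let ?S = "\<lambda>f. \<Sum>s\<in>UNIV. V f $ s"
  have "Max (range ?S) \<in> range ?S"
    by (intro Max_in finite_imageI finite) simp
  then obtain f where f: "Max (range ?S) = ?S f"
    by (rule imageE)
  have greedy: "action_value \<alpha> P rew (V f) $ (a, s) \<le> V f $ s" for a s
  proof (rule ccontr)
    assume less: "\<not> action_value \<alpha> P rew (V f) $ (a, s) \<le> V f $ s"
    \<comment> \<open>Improvement at the single state \<open>s\<close>: the old value is a
      subsolution for \<open>g\<close>, so \<open>g\<close> is nowhere worse, and it is strictly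
      better at \<open>s\<close>, against the choice of \<open>f\<close>.\<close>
    define g where "g = f(s := a)"
    have "V f $ t \<le> action_value \<alpha> P rew (V f) $ (g t, t)" for t
      using less V_fixpoint[of f t] by (cases "t = s") (auto simp: g_def)
    then have ge: "V f $ t \<le> V g $ t" for t
      by (rule V_ge)
    have "V f $ s < action_value \<alpha> P rew (V f) $ (a, s)"
      using less by simp
    also have "\<dots> \<le> action_value \<alpha> P rew (V g) $ (a, s)"
      unfolding action_value_nth using ge discounted_mdpD(1)[OF mdp] by (intro add_left_mono mult_left_mono sum_mono) auto
    also have "\<dots> = V g $ s"
      using V_fixpoint[of g s] by (simp add: g_def)
    finally have "?S f < ?S g"
      using ge by (intro sum_strict_mono_ex1) auto
    moreover have "?S g \<le> Max (range ?S)"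
      by (intro Max_ge finite_imageI finite rangeI)
    ultimately show False
      using f by simp
  qed
  have "policy_value \<alpha> P rew \<pi>' $ s \<le> V f $ s" for \<pi>' s
  proof (rule policy_value_le)
    fix s
    have "(\<Sum>a\<in>UNIV. pmf (\<pi>' s) a * action_value \<alpha> P rew (V f) $ (a, s)) \<le> (\<Sum>a\<in>UNIV. pmf (\<pi>' s) a * V f $ s)"
      by (intro sum_mono mult_left_mono greedy) simp
    also have "\<dots> = V f $ s"
      unfolding sum_distrib_right[symmetric] by (simp add: sum_pmf_eq_1)
    finally show "(\<Sum>a\<in>UNIV. pmf (\<pi>' s) a * action_value \<alpha> P rew (V f) $ (a, s)) \<le> V f $ s" .
  qed
  then show ?thesis
    unfolding V_def by blast
qed

lemma optimal_value_attained:
  obtains \<pi> where "optimal_value \<alpha> P rew = policy_value \<alpha> P rew \<pi>"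
    and "\<And>\<pi>' s. policy_value \<alpha> P rew \<pi>' $ s \<le> policy_value \<alpha> P rew \<pi> $ s"
proof -
  obtain \<pi> where \<pi>: "\<And>\<pi>' s. policy_value \<alpha> P rew \<pi>' $ s \<le> policy_value \<alpha> P rew \<pi> $ s"
    using exists_optimal_policy by blast
  have "(SUP \<pi>'. policy_value \<alpha> P rew \<pi>' $ s) = policy_value \<alpha> P rew \<pi> $ s" for s
    by (rule cSup_eq_maximum) (use \<pi> in auto)
  then have "optimal_value \<alpha> P rew = policy_value \<alpha> P rew \<pi>"
    by (simp add: optimal_value_def vec_eq_iff)
  then show ?thesis
    using \<pi> that by blast
qed

section \<open>Discounted occupancy measures\<close>

text \<open>The Neumann series of the transposed kernel applied to \<eta>. Every iterate keeps the
  mass of \<eta>, which bounds the terms. Summing the balance equation over all states yields the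
  total mass, and no entry exceeds it.\<close>

lemma exists_occupancy:
  assumes \<eta>: "\<And>s. 0 \<le> \<eta> s"
  obtains \<rho> where "\<And>t. \<rho> t = \<eta> t + \<alpha> * (\<Sum>s\<in>UNIV. \<rho> s * policy_trans P \<pi> s t)"
    and "\<And>t. \<eta> t \<le> \<rho> t" and "\<And>t. \<rho> t \<le> (\<Sum>s\<in>UNIV. \<eta> s) / (1 - \<alpha>)"
proof -
  note \<alpha> = discounted_mdpD(1,2)[OF mdp]
  define K where "K t s = policy_trans P \<pi> s t" for s t
  let ?h = "\<lambda>n. (apply_kernel K ^^ n) \<eta>"
  have nonneg: "0 \<le> ?h n s" for n s
    using \<eta> by (intro funpow_apply_kernel_nonneg) (auto simp: K_def policy_trans_nonneg)
  have mass: "(\<Sum>t\<in>UNIV. ?h n t) = (\<Sum>s\<in>UNIV. \<eta> s)" for n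
  proof (induction n)
    case (Suc n)
    have "(\<Sum>t\<in>UNIV. ?h (Suc n) t) = (\<Sum>t\<in>UNIV. \<Sum>s\<in>UNIV. policy_trans P \<pi> s t * ?h n s)"
      by (simp add: apply_kernel_def[of K "(apply_kernel K ^^ n) \<eta>"] K_def)
    also have "\<dots> = (\<Sum>s\<in>UNIV. ?h n s)"
      by (subst sum.swap) (simp add: sum_distrib_right[symmetric] sum_policy_trans)
    finally show ?case
      using Suc by simp
  qed simp
  have bound: "\<bar>?h n s\<bar> \<le> (\<Sum>s\<in>UNIV. \<eta> s)" for n s
    using nonneg mass[of n] member_le_sum[of s UNIV "?h n"] by simp
  define \<rho> where "\<rho> s = (\<Sum>n. \<alpha> ^ n * ?h n s)" for s
  have sm: "summable (\<lambda>n. \<alpha> ^ n * ?h n s)" for s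
    by (rule discounted_series(1)[OF bound \<alpha>])
  have balance: "\<rho> t = \<eta> t + \<alpha> * (\<Sum>s\<in>UNIV. \<rho> s * policy_trans P \<pi> s t)" for t
    using discounted_series(2)[OF bound \<alpha>, of t]
    unfolding \<rho>_def[symmetric] apply_kernel_def[of K \<rho>] K_def by (simp only: mult.commute)
  have pos: "0 \<le> \<rho> t" for t
    unfolding \<rho>_def by (intro suminf_nonneg sm mult_nonneg_nonneg zero_le_power \<alpha> nonneg)
  have ge: "\<eta> t \<le> \<rho> t" for t
  proof -
    have "0 \<le> \<alpha> * (\<Sum>s\<in>UNIV. \<rho> s * policy_trans P \<pi> s t)"
      by (intro mult_nonneg_nonneg sum_nonneg \<alpha> pos policy_trans_nonneg)
    then show ?thesis using balance[of t] by simp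
  qed
  have "(\<Sum>t\<in>UNIV. \<rho> t) = (\<Sum>t\<in>UNIV. \<eta> t) + \<alpha> * (\<Sum>t\<in>UNIV. \<Sum>s\<in>UNIV. \<rho> s * policy_trans P \<pi> s t)"
    by (subst balance) (simp add: sum.distrib sum_distrib_left)
  also have "(\<Sum>t\<in>UNIV. \<Sum>s\<in>UNIV. \<rho> s * policy_trans P \<pi> s t) = (\<Sum>s\<in>UNIV. \<rho> s)"
    by (subst sum.swap) (simp add: sum_distrib_left[symmetric] sum_policy_trans)
  finally have "(\<Sum>t\<in>UNIV. \<rho> t) = (\<Sum>t\<in>UNIV. \<eta> t) / (1 - \<alpha>)"
    using \<alpha> by (simp add: field_simps)
  then have "\<rho> t \<le> (\<Sum>s\<in>UNIV. \<eta> s) / (1 - \<alpha>)" for t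
    using member_le_sum[of t UNIV \<rho>] pos by simp
  with balance ge show ?thesis
    by (rule that)
qed

text \<open>At each state the policy average of the advantage vanishes by the Bellman equation,
  whatever the weight \<open>c s\<close>. Both the occupancy measure and the averaged dual iterate
  have this product form.\<close>

lemma advantage_sum_eq_0:
  assumes lam: "\<And>a s. lam $ (a, s) = c s * pmf (\<pi> s) a"
  shows "(\<Sum>i\<in>UNIV. lam $ i * (action_value \<alpha> P rew (policy_value \<alpha> P rew \<pi>) $ i - policy_value \<alpha> P rew \<pi> $ (snd i))) = 0"
proof -
  have "(\<Sum>i\<in>UNIV. lam $ i * (action_value \<alpha> P rew (policy_value \<alpha> P rew \<pi>) $ i - policy_value \<alpha> P rew \<pi> $ (snd i))) =
      (\<Sum>s\<in>UNIV. c s * ((\<Sum>a\<in>UNIV. pmf (\<pi> s) a * action_value \<alpha> P rew (policy_value \<alpha> P rew \<pi>) $ (a, s))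
        - (\<Sum>a\<in>UNIV. pmf (\<pi> s) a) * policy_value \<alpha> P rew \<pi> $ s))"
    by (simp add: sum_UNIV_pairs lam right_diff_distrib sum_subtractf sum_distrib_left sum_distrib_right mult.assoc)
  then show ?thesis
    by (simp add: sum_pmf_eq_1 policy_value_fixpoint[symmetric])
qed

text \<open>\<open>balance\<close> cancels all terms linear in \<open>V\<close>, and
  \<open>mu\<close> cancels those linear in \<open>Q\<close>. The remaining constant is found by
  inserting the value function of \<open>\<pi>\<close>, where the advantage sum is zero.\<close>

lemma Lagrangian_occupancy:
  assumes balance: "\<And>t. \<rho> t = \<eta> $ t + \<alpha> * (\<Sum>s\<in>UNIV. \<rho> s * policy_trans P \<pi> s t)"
    and lam: "\<And>a s. lam $ (a, s) = \<rho> s * pmf (\<pi> s) a"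
    and mu: "\<And>i. pmf \<tau> i * mu $ i = lam $ i"
  shows "Lagrangian \<alpha> P rew \<eta> (weight_matrix \<tau>) (Q, V) (lam, mu) = \<eta> \<bullet> policy_value \<alpha> P rew \<pi>"
proof -
  have const: "\<eta> \<bullet> v + (\<Sum>i\<in>UNIV. lam $ i * (action_value \<alpha> P rew v $ i - v $ (snd i))) =
      (\<Sum>s\<in>UNIV. \<rho> s * policy_reward P rew \<pi> s)" for v
  proof -
    have "(\<Sum>i\<in>UNIV. lam $ i * (action_value \<alpha> P rew v $ i - v $ (snd i))) =
        (\<Sum>s\<in>UNIV. \<rho> s * ((\<Sum>a\<in>UNIV. pmf (\<pi> s) a * action_value \<alpha> P rew v $ (a, s)) - (\<Sum>a\<in>UNIV. pmf (\<pi> s) a) * v $ s))"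
      by (simp add: sum_UNIV_pairs lam right_diff_distrib sum_subtractf sum_distrib_left sum_distrib_right mult.assoc)
    also have "\<dots> = (\<Sum>s\<in>UNIV. \<rho> s * (policy_reward P rew \<pi> s + \<alpha> * transition_operator P \<pi> (\<lambda>t. v $ t) s - v $ s))"
      by (simp add: sum_pmf_eq_1 sum_action_value)
    also have "\<dots> = (\<Sum>s\<in>UNIV. \<rho> s * policy_reward P rew \<pi> s)
        + \<alpha> * (\<Sum>s\<in>UNIV. \<rho> s * transition_operator P \<pi> (\<lambda>t. v $ t) s) - (\<Sum>s\<in>UNIV. \<rho> s * v $ s)"
      by (simp add: algebra_simps sum.distrib sum_subtractf sum_distrib_left)
    also have "(\<Sum>s\<in>UNIV. \<rho> s * transition_operator P \<pi> (\<lambda>t. v $ t) s) =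
        (\<Sum>t\<in>UNIV. (\<Sum>s\<in>UNIV. \<rho> s * policy_trans P \<pi> s t) * v $ t)"
      unfolding apply_kernel_def sum_distrib_left sum_distrib_right by (subst sum.swap) (simp add: mult.assoc)
    also have "(\<Sum>s\<in>UNIV. \<rho> s * v $ s) = (\<Sum>t\<in>UNIV. (\<eta> $ t + \<alpha> * (\<Sum>s\<in>UNIV. \<rho> s * policy_trans P \<pi> s t)) * v $ t)"
      by (subst balance) simp
    finally show ?thesis
      by (simp add: inner_vec_def algebra_simps sum.distrib sum_distrib_left)
  qed
  have "Lagrangian \<alpha> P rew \<eta> (weight_matrix \<tau>) (Q, V) (lam, mu) =
      \<eta> \<bullet> V + (\<Sum>i\<in>UNIV. lam $ i * (action_value \<alpha> P rew V $ i - V $ (snd i)))"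
    unfolding Lagrangian_weight_matrix mu by (simp add: sum.distrib[symmetric] algebra_simps)
  also have "\<dots> = \<eta> \<bullet> policy_value \<alpha> P rew \<pi> + (\<Sum>i\<in>UNIV. lam $ i *
      (action_value \<alpha> P rew (policy_value \<alpha> P rew \<pi>) $ i - policy_value \<alpha> P rew \<pi> $ (snd i)))"
    by (simp add: const)
  finally show ?thesis
    using advantage_sum_eq_0[OF lam] by simp
qed

end

lemma pmf_dual_policy:
  fixes lam :: "real^('a::finite \<times> 's::finite)"
  assumes "\<And>i. 0 \<le> lam $ i" "0 < (\<Sum>a\<in>UNIV. lam $ (a, s))"
  shows "pmf (dual_policy lam s) a = lam $ (a, s) / (\<Sum>a'\<in>UNIV. lam $ (a', s))"
  unfolding dual_policy_def
proof (rule pmf_embed_pmf)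
  show "0 \<le> lam $ (a, s) / (\<Sum>a'\<in>UNIV. lam $ (a', s))" for a
    using assms by simp
  have "(\<Sum>a\<in>UNIV. ennreal (lam $ (a, s) / (\<Sum>a'\<in>UNIV. lam $ (a', s)))) = 1"
    using assms by (simp add: sum_ennreal sum_divide_distrib[symmetric])
  then show "(\<integral>\<^sup>+ a. ennreal (lam $ (a, s) / (\<Sum>a'\<in>UNIV. lam $ (a', s))) \<partial>count_space UNIV) = 1"
    by (simp add: nn_integral_count_space_finite)
qed

subsection \<open>The Azuma-Hoeffding inequality\<close>

text \<open>Hoeffding's auxiliary inequality with success probability 1/2 and width 2 y, once
  exp(-y) is factored out of cosh y.\<close>

lemma cosh_le_exp_half_square:
  fixes y :: real
  assumes "0 \<le> y"
  shows "cosh y \<le> exp (y\<^sup>2 / 2)"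
proof -
  have pos: "0 < 1 + (1/2) * (exp (2 * y) - 1)"
    using exp_gt_zero[of "2 * y"] by (simp add: field_simps del: exp_gt_zero)
  have "- (2 * y) * (1/2) + ln (1 + (1/2) * (exp (2 * y) - 1)) \<le> (2 * y)\<^sup>2 / 8"
    using Hoeffdings_lemma_aux[of "2 * y" "1/2"] assms by simp
  then have "ln (1 + (1/2) * (exp (2 * y) - 1)) \<le> y + y\<^sup>2 / 2"
    by (simp add: power2_eq_square)
  then have "1 + (1/2) * (exp (2 * y) - 1) \<le> exp (y + y\<^sup>2 / 2)"
    using pos by (metis exp_le_cancel_iff exp_ln)
  then have "exp (- y) * (1 + (1/2) * (exp (2 * y) - 1)) \<le> exp (- y) * exp (y + y\<^sup>2 / 2)"
    by (intro mult_left_mono) auto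
  also have "\<dots> = exp (y\<^sup>2 / 2)"
    by (simp add: exp_add[symmetric])
  also have "exp (- y) * (1 + (1/2) * (exp (2 * y) - 1)) = (exp (- y) + exp (- y + 2 * y)) / 2"
    unfolding exp_add by (simp add: field_simps)
  finally show ?thesis
    by (simp add: cosh_def)
qed

text \<open>The chord of the exponential over [-c, c]. It is affine in \<open>x\<close>, so its
  second term disappears under a conditional expectation that vanishes.\<close>

lemma exp_le_cosh_sinh:
  fixes x c l :: real
  assumes "0 < c" "\<bar>x\<bar> \<le> c" "0 \<le> l"
  shows "exp (l * x) \<le> cosh (l * c) + x / c * sinh (l * c)"
proof -
  define p where "p = (1 + x / c) / 2"
  have p: "0 \<le> p" "p \<le> 1"
    using assms by (auto simp: p_def field_simps)
  have "p * c + (1 - p) * (- c) = x"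
    using assms by (simp add: p_def field_simps)
  then have "exp (l * x) \<le> p * exp (l * c) + (1 - p) * exp (l * - c)"
    using convex_onD[OF convex_on_exp[OF assms(3)], of p "- c" c] p by (simp add: algebra_simps)
  also have "\<dots> = cosh (l * c) + x / c * sinh (l * c)"
    using assms(1) by (simp add: p_def cosh_def sinh_def) (simp add: field_simps)
  finally show ?thesis .
qed

text \<open>Everything is asked only below \<open>T\<close>, since a run of \<open>T\<close> steps
  says nothing about later samples. The bound is almost sure because the observed rewards are
  bounded only almost surely.\<close>

locale bounded_martingale_differences = prob_space M for M :: "'w measure" +
  fixes F :: "nat \<Rightarrow> 'w measure" and X :: "nat \<Rightarrow> 'w \<Rightarrow> real" and T :: nat and c :: real
  assumes c_pos: "0 < c"
    and subalgebra: "\<And>k. k < T \<Longrightarrow> subalgebra M (F k)"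
    and adapted: "\<And>k. k < T \<Longrightarrow> (\<lambda>\<omega>. \<Sum>j<k. X j \<omega>) \<in> borel_measurable (F k)"
    and measurable_X: "\<And>k. k < T \<Longrightarrow> X k \<in> borel_measurable M"
    and AE_bounded: "\<And>k. k < T \<Longrightarrow> AE \<omega> in M. \<bar>X k \<omega>\<bar> \<le> c"
    and cond_exp_zero: "\<And>k. k < T \<Longrightarrow> AE \<omega> in M. real_cond_exp M (F k) (X k) \<omega> = 0"
begin

lemma measurable_partial_sum: "n \<le> T \<Longrightarrow> (\<lambda>\<omega>. \<Sum>j<n. X j \<omega>) \<in> borel_measurable M"
  by (intro borel_measurable_sum measurable_X) auto

lemma AE_partial_sum_le: "n \<le> T \<Longrightarrow> AE \<omega> in M. \<bar>\<Sum>j<n. X j \<omega>\<bar> \<le> real n * c"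
proof (induction n)
  case (Suc n)
  then have "AE \<omega> in M. \<bar>\<Sum>j<n. X j \<omega>\<bar> \<le> real n * c" "AE \<omega> in M. \<bar>X n \<omega>\<bar> \<le> c"
    using AE_bounded by auto
  then show ?case
    by eventually_elim (auto simp: algebra_simps)
qed simp

text \<open>The exponential \<open>?Z\<close> of the past is \<open>F n\<close>-measurable and can
  be pulled out, so the term linear in \<open>X n\<close> has expectation zero. Each step then costs
  a factor cosh (l c).\<close>

lemma exponential_moment:
  assumes "0 \<le> l" "n \<le> T"
  shows "integrable M (\<lambda>\<omega>. exp (l * (\<Sum>j<n. X j \<omega>)))"
    and "expectation (\<lambda>\<omega>. exp (l * (\<Sum>j<n. X j \<omega>))) \<le> exp (real n * (l * c)\<^sup>2 / 2)"
proof -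
  have int: "integrable M (\<lambda>\<omega>. exp (l * (\<Sum>j<n. X j \<omega>)))" if "n \<le> T" for n
  proof (rule integrable_const_bound[of _ "exp (l * (real n * c))"])
    show "AE \<omega> in M. norm (exp (l * (\<Sum>j<n. X j \<omega>))) \<le> exp (l * (real n * c))"
      using AE_partial_sum_le[OF that] by eventually_elim (use \<open>0 \<le> l\<close> in \<open>auto intro!: mult_left_mono\<close>)
  qed (use measurable_partial_sum[OF that] in measurable)
  then show "integrable M (\<lambda>\<omega>. exp (l * (\<Sum>j<n. X j \<omega>)))"
    using \<open>n \<le> T\<close> .
  show "expectation (\<lambda>\<omega>. exp (l * (\<Sum>j<n. X j \<omega>))) \<le> exp (real n * (l * c)\<^sup>2 / 2)"
    using \<open>n \<le> T\<close>
  proof (induction n)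
    case 0
    then show ?case by (simp add: prob_space)
  next
    case (Suc n)
    then have n: "n < T" "n \<le> T" by auto
    let ?Z = "\<lambda>\<omega>. exp (l * (\<Sum>j<n. X j \<omega>))"
    interpret finite_measure_subalgebra M "F n"
      by unfold_locales (rule subalgebra[OF n(1)])
    note [measurable] = measurable_X[OF n(1)]
    have Z[measurable]: "?Z \<in> borel_measurable (F n)"
      using adapted[OF n(1)] by measurable
    have ZM[measurable]: "?Z \<in> borel_measurable M"
      using measurable_partial_sum[OF n(2)] by measurable
    have ZX: "integrable M (\<lambda>\<omega>. ?Z \<omega> * X n \<omega>)"
    proof (rule Bochner_Integration.integrable_bound[of _ "\<lambda>\<omega>. c * ?Z \<omega>"])
      show "AE \<omega> in M. norm (?Z \<omega> * X n \<omega>) \<le> norm (c * ?Z \<omega>)"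
        using AE_bounded[OF n(1)] by eventually_elim (use c_pos in \<open>auto simp: abs_mult\<close>)
    qed (use int[OF n(2)] in auto)
    have "expectation (\<lambda>\<omega>. ?Z \<omega> * X n \<omega>) = expectation (\<lambda>\<omega>. ?Z \<omega> * real_cond_exp M (F n) (X n) \<omega>)"
      by (rule real_cond_exp_intg(2)[OF ZX Z, symmetric]) measurable
    also have "\<dots> = expectation (\<lambda>\<omega>. 0)"
      by (rule integral_cong_AE) (use cond_exp_zero[OF n(1)] in auto)
    finally have zero: "expectation (\<lambda>\<omega>. ?Z \<omega> * X n \<omega>) = 0" by simp
    have step: "exp (l * (\<Sum>j<Suc n. X j \<omega>)) \<le> cosh (l * c) * ?Z \<omega> + sinh (l * c) / c * (?Z \<omega> * X n \<omega>)"
      if bound: "\<bar>X n \<omega>\<bar> \<le> c" for \<omega>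
    proof -
      have "exp (l * (\<Sum>j<Suc n. X j \<omega>)) = ?Z \<omega> * exp (l * X n \<omega>)"
        unfolding sum.lessThan_Suc distrib_left exp_add ..
      also have "\<dots> \<le> ?Z \<omega> * (cosh (l * c) + X n \<omega> / c * sinh (l * c))"
        by (rule mult_left_mono[OF exp_le_cosh_sinh[OF c_pos bound \<open>0 \<le> l\<close>]]) simp
      also have "\<dots> = cosh (l * c) * ?Z \<omega> + sinh (l * c) / c * (?Z \<omega> * X n \<omega>)"
        by (simp only: distrib_left times_divide_eq_left times_divide_eq_right mult_ac)
      finally show ?thesis .
    qed
    have "expectation (\<lambda>\<omega>. exp (l * (\<Sum>j<Suc n. X j \<omega>))) \<le>
        expectation (\<lambda>\<omega>. cosh (l * c) * ?Z \<omega> + sinh (l * c) / c * (?Z \<omega> * X n \<omega>))"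
    proof (rule integral_mono_AE)
      show "AE \<omega> in M. exp (l * (\<Sum>j<Suc n. X j \<omega>)) \<le> cosh (l * c) * ?Z \<omega> + sinh (l * c) / c * (?Z \<omega> * X n \<omega>)"
        using AE_bounded[OF n(1)] by eventually_elim (rule step)
    qed (use int[OF Suc.prems] int[OF n(2)] ZX in auto)
    also have "\<dots> = cosh (l * c) * expectation ?Z"
      using int[OF n(2)] ZX by (simp add: zero)
    also have "\<dots> \<le> exp ((l * c)\<^sup>2 / 2) * exp (real n * (l * c)\<^sup>2 / 2)"
      using Suc.IH[OF n(2)] c_pos \<open>0 \<le> l\<close>
      by (intro mult_mono cosh_le_exp_half_square) auto
    also have "\<dots> = exp (real (Suc n) * (l * c)\<^sup>2 / 2)"
      unfolding exp_add[symmetric] by (rule arg_cong[of _ _ exp]) (simp add: distrib_right add_divide_distrib)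
    finally show ?case .
  qed
qed

theorem Azuma_Hoeffding:
  assumes "0 < T" "0 < \<delta>" "\<delta> < 1"
  shows "prob {\<omega> \<in> space M. c * sqrt (2 * real T * ln (1 / \<delta>)) < (\<Sum>j<T. X j \<omega>)} \<le> \<delta>"
proof -
  let ?S = "\<lambda>\<omega>. \<Sum>j<T. X j \<omega>"
  define L where "L = ln (1 / \<delta>)"
  define q where "q = sqrt (2 * real T * L)"
  \<comment> \<open>The minimiser of the Chernoff exponent T (l c)^2 / 2 - l c q. Its two parts
    become L and 2 L, which leaves exp (- L) = \<delta>.\<close>
  define l where "l = q / (real T * c)"
  have L: "0 < L" using assms by (simp add: L_def)
  have q: "0 < q" "q * q = 2 * real T * L"
    using L assms by (simp_all add: q_def)
  have l: "0 < l" using q assms c_pos by (simp add: l_def)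
  have [measurable]: "?S \<in> borel_measurable M"
    using measurable_partial_sum by simp
  let ?t = "c * q"
  have "l * ?t = q * q / real T"
    using assms c_pos by (simp add: l_def)
  then have lt: "l * ?t = 2 * L"
    using assms by (simp add: q(2))
  have "(l * c)\<^sup>2 = q * q / (real T)\<^sup>2"
    using c_pos by (simp add: l_def power2_eq_square)
  then have lc: "real T * (l * c)\<^sup>2 / 2 = L"
    using assms by (simp add: q(2) power2_eq_square)
  have "prob {\<omega> \<in> space M. ?t < ?S \<omega>} \<le> prob {\<omega> \<in> space M. exp (l * ?t) \<le> exp (l * ?S \<omega>)}"
    using l by (intro finite_measure_mono) auto
  also have "\<dots> \<le> expectation (\<lambda>\<omega>. exp (l * ?S \<omega>)) / exp (l * ?t)"
    by (rule integral_Markov_inequality_measure[where A="space M" and u="\<lambda>\<omega>. exp (l * ?S \<omega>)", simplified])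
      (use exponential_moment(1)[of l T] l in auto)
  also have "\<dots> \<le> exp L / exp (2 * L)"
    using exponential_moment(2)[of l T] l by (simp add: lt lc divide_right_mono)
  also have "\<dots> = exp (- L)"
    unfolding exp_diff[symmetric] by simp
  also have "\<dots> = \<delta>"
    using assms by (simp add: L_def ln_div)
  finally show ?thesis
    by (simp add: L_def q_def)
qed

end

subsection \<open>Regret of projected gradient steps\<close>

lemma sum_inverse_sqrt_le: "(\<Sum>k<n. 1 / sqrt (real k + 1)) \<le> 2 * sqrt (real n)"
proof (induction n)
  case (Suc n)
  let ?a = "sqrt (real n)" and ?b = "sqrt (real n + 1)"
  have b: "0 < ?b" by simp
  have sq: "?a * ?a = real n" "?b * ?b = real n + 1" by simp_all
  \<comment> \<open>With b^2 - a^2 = 1 this gives 1/b at most 2 (b - a), the increment of the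
    right-hand side.\<close>
  have "0 \<le> (?b - ?a) * (?b - ?a)" by simp
  then have "2 * ?a * ?b + 1 \<le> 2 * (?b * ?b)"
    using sq by (simp add: algebra_simps)
  then have "2 * ?a + 1 / ?b \<le> 2 * ?b"
    using b by (simp add: field_simps)
  then show ?case
    using Suc by (simp add: add.commute)
qed simp

text \<open>The projection is nonexpansive and fixes the comparison point.\<close>

lemma closest_point_step:
  fixes S :: "'v::euclidean_space set"
  assumes "convex S" "closed S" "z \<in> S"
  shows "(norm (closest_point S w - z))\<^sup>2 \<le> (norm (w - z))\<^sup>2"
proof -
  have "dist (closest_point S w) (closest_point S z) \<le> dist w z"
    using assms by (intro closest_point_lipschitz) auto
  then show ?thesis
    using assms by (simp add: closest_point_self dist_norm power_mono)
qed

text \<open>Abel summation. The weights will be inverse step sizes, which grow; each growth of the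
  weight is charged to the uniform bound \<open>B\<close>.\<close>

lemma weighted_telescope:
  fixes a w :: "nat \<Rightarrow> real"
  assumes "\<And>k. k \<le> n \<Longrightarrow> a k \<le> B" "\<And>k. 0 \<le> w k" "\<And>k. w k \<le> w (Suc k)"
  shows "(\<Sum>k<Suc n. w k * (a k - a (Suc k))) \<le> w n * (B - a (Suc n))"
  using assms(1)
proof (induction n)
  case 0
  then show ?case
    using assms(2)[of 0] by (simp add: mult_left_mono)
next
  case (Suc n)
  have "(\<Sum>k<Suc (Suc n). w k * (a k - a (Suc k))) \<le>
      w n * (B - a (Suc n)) + w (Suc n) * (a (Suc n) - a (Suc (Suc n)))"
    using Suc by simp
  also have "\<dots> \<le> w (Suc n) * (B - a (Suc n)) + w (Suc n) * (a (Suc n) - a (Suc (Suc n)))"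
    using Suc.prems[of "Suc n"] assms(3)[of n] by (intro add_right_mono mult_right_mono) auto
  finally show ?case
    by (simp add: algebra_simps)
qed

text \<open>The squared distance to a moving comparison point is the potential. \<open>B\<close>
  pays for the telescoped distances, \<open>G\<close> for the step lengths and \<open>C\<close> for
  the movement of \<open>z\<close>; the last two are summed with 1/sqrt(k+1). Steps go along
  \<open>+ d\<close>, so descent is obtained with \<open>d\<close> the negative gradient.\<close>

lemma projected_gradient_regret:
  fixes S :: "'v::euclidean_space set" and w d z :: "nat \<Rightarrow> 'v" and g B G C :: real
  assumes S: "convex S" "closed S" and g: "0 < g" and T: "0 < T"
    and step: "\<And>k. k < T \<Longrightarrow> w (Suc k) = closest_point S (w k + (g / sqrt (real k + 1)) *\<^sub>R d k)"
    and z: "\<And>k. z k \<in> S"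
    and B: "\<And>k. k < T \<Longrightarrow> (norm (w k - z k))\<^sup>2 \<le> B"
    and G: "\<And>k. k < T \<Longrightarrow> (norm (d k))\<^sup>2 \<le> G"
    and C: "\<And>k. k < T \<Longrightarrow> (norm (w (Suc k) - z (Suc k)))\<^sup>2 \<le> (norm (w (Suc k) - z k))\<^sup>2 + C / (real k + 1)"
    and nonneg: "0 \<le> G" "0 \<le> C"
  shows "(\<Sum>k<T. - (d k \<bullet> (w k - z k))) \<le> sqrt (real T) * (B / (2 * g) + G * g + C / g)"
proof -
  define r where "r k = sqrt (real k + 1)" for k :: nat
  define a where "a k = (norm (w k - z k))\<^sup>2" for k
  have r: "0 < r k" "r k * r k = real k + 1" for k
    by (simp_all add: r_def)
  have inner: "- (d k \<bullet> (w k - z k)) \<le>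
      r k / (2 * g) * (a k - a (Suc k)) + (C / (2 * g) + g * G / 2) * (1 / r k)" if k: "k < T" for k
  proof -
    let ?\<gamma> = "g / r k"
    have \<gamma>: "0 < ?\<gamma>" using g r(1) by simp
    have "a (Suc k) - C / (real k + 1) \<le> (norm (w (Suc k) - z k))\<^sup>2"
      using C[OF k] by (simp add: a_def)
    also have "\<dots> \<le> (norm (w k + ?\<gamma> *\<^sub>R d k - z k))\<^sup>2"
      unfolding step[OF k] r_def by (rule closest_point_step[OF S z])
    also have "\<dots> = (norm ((w k - z k) + ?\<gamma> *\<^sub>R d k))\<^sup>2"
      by (simp add: algebra_simps)
    also have "\<dots> = a k + 2 * ?\<gamma> * (d k \<bullet> (w k - z k)) + ?\<gamma>\<^sup>2 * (norm (d k))\<^sup>2"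
      unfolding a_def power2_norm_eq_inner
      by (simp add: inner_add_left inner_add_right inner_commute power2_eq_square)
    also have "\<dots> \<le> a k + 2 * ?\<gamma> * (d k \<bullet> (w k - z k)) + ?\<gamma>\<^sup>2 * G"
      using G[OF k] by (simp add: mult_left_mono)
    finally have "2 * ?\<gamma> * (- (d k \<bullet> (w k - z k))) \<le> a k - a (Suc k) + C / (real k + 1) + ?\<gamma>\<^sup>2 * G"
      by simp
    then have "(- (d k \<bullet> (w k - z k))) * (2 * ?\<gamma>) \<le> a k - a (Suc k) + C / (r k * r k) + ?\<gamma>\<^sup>2 * G"
      unfolding r(2) by (subst mult.commute)
    moreover have "0 < 2 * ?\<gamma>" using \<gamma> by simp
    ultimately have "- (d k \<bullet> (w k - z k)) \<le> (a k - a (Suc k) + C / (r k * r k) + ?\<gamma>\<^sup>2 * G) / (2 * ?\<gamma>)"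
      by (simp only: pos_le_divide_eq)
    also have "\<dots> = r k / (2 * g) * (a k - a (Suc k)) + (C / (2 * g) + g * G / 2) * (1 / r k)"
      using g r(1)[of k] by (simp add: field_simps power2_eq_square)
    finally show ?thesis .
  qed
  obtain n where n: "T = Suc n" using T by (cases T) auto
  have "(\<Sum>k<T. r k / (2 * g) * (a k - a (Suc k))) \<le> r n / (2 * g) * (B - a (Suc n))"
    unfolding n
  proof (rule weighted_telescope)
    show "r k / (2 * g) \<le> r (Suc k) / (2 * g)" for k
      using g by (intro divide_right_mono) (auto simp: r_def)
  qed (use g r(1) B in \<open>auto simp: n a_def less_imp_le\<close>)
  also have "\<dots> \<le> r n / (2 * g) * B"
    using g r(1)[of n] by (intro mult_left_mono) (auto simp: a_def less_imp_le)
  also have "r n = sqrt (real T)"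
    by (simp add: n r_def add.commute)
  finally have tele: "(\<Sum>k<T. r k / (2 * g) * (a k - a (Suc k))) \<le> sqrt (real T) / (2 * g) * B" .
  have "(\<Sum>k<T. (C / (2 * g) + g * G / 2) * (1 / r k)) \<le> (C / (2 * g) + g * G / 2) * (2 * sqrt (real T))"
    unfolding sum_distrib_left[symmetric] r_def using g nonneg by (intro mult_left_mono sum_inverse_sqrt_le) auto
  moreover have "(\<Sum>k<T. - (d k \<bullet> (w k - z k))) \<le> (\<Sum>k<T. r k / (2 * g) * (a k - a (Suc k)))
      + (\<Sum>k<T. (C / (2 * g) + g * G / 2) * (1 / r k))"
    unfolding sum.distrib[symmetric] by (intro sum_mono inner) simp
  ultimately have "(\<Sum>k<T. - (d k \<bullet> (w k - z k))) \<le>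
      sqrt (real T) / (2 * g) * B + (C / (2 * g) + g * G / 2) * (2 * sqrt (real T))"
    using tele by linarith
  also have "\<dots> = sqrt (real T) * (B / (2 * g) + G * g + C / g)"
    using g by (simp add: field_simps)
  finally show ?thesis .
qed

section \<open>Arithmetic of the constants\<close>

text \<open>
  The proof averages the two lower bounds \<open>(12 + 4 \<beta>\<^sub>0) u\<^sup>2 / (N\<^sup>2 \<gamma>\<^sub>0) + 26 \<gamma>\<^sub>0\<close> and
  \<open>50 \<gamma>\<^sub>0 + 30\<close> on the square root of \<open>\<kappa>\<close>.
\<close>

lemma kappa_bound:
  fixes \<gamma>\<^sub>0 \<beta>\<^sub>0 u N \<kappa> :: real
  assumes pos: "0 < \<gamma>\<^sub>0" "0 < \<beta>\<^sub>0" and N: "1 \<le> N" "N \<le> u"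
    and \<kappa>\<^sub>1: "((12 + 4 * \<beta>\<^sub>0) * u\<^sup>2 / (N\<^sup>2 * \<gamma>\<^sub>0) + 26 * \<gamma>\<^sub>0)\<^sup>2 \<le> \<kappa>"
    and \<kappa>\<^sub>2: "(2184 + 416 * sqrt 26) * \<gamma>\<^sub>0^2 + (1066 + 416 * sqrt 26) * \<gamma>\<^sub>0 + 832 + 16 * sqrt 26 \<le> \<kappa>"
  shows "(4 * u^3 + 2 * \<beta>\<^sub>0 * u\<^sup>2) / \<gamma>\<^sub>0 + 26 * u\<^sup>2 * \<gamma>\<^sub>0 + 17 * u \<le> N\<^sup>2 * u\<^sup>2 * sqrt \<kappa>"
proof -
  have u: "1 \<le> u" using N by simp
  \<comment> \<open>With this the coefficients 2184 + 416 sqrt 26, 1066 + 416 sqrt 26 and 832 + 16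
    sqrt 26 are at least 4264, 3146 and 912, hence above the 2500, 3000 and 900 in the square of 50
    \<open>\<gamma>\<^sub>0\<close> + 30.\<close>
  have sqrt26: "5 \<le> sqrt 26"
    by (rule real_le_rsqrt) simp
  have "(50 * \<gamma>\<^sub>0 + 30)\<^sup>2 = 2500 * \<gamma>\<^sub>0\<^sup>2 + 3000 * \<gamma>\<^sub>0 + 900"
    by (simp add: power2_eq_square algebra_simps)
  also have "\<dots> \<le> (2184 + 416 * sqrt 26) * \<gamma>\<^sub>0^2 + (1066 + 416 * sqrt 26) * \<gamma>\<^sub>0 + 832 + 16 * sqrt 26"
  proof -
    have "2500 * \<gamma>\<^sub>0\<^sup>2 \<le> (2184 + 416 * sqrt 26) * \<gamma>\<^sub>0^2" "3000 * \<gamma>\<^sub>0 \<le> (1066 + 416 * sqrt 26) * \<gamma>\<^sub>0"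
      using sqrt26 pos by (intro mult_right_mono; simp)+
    then show ?thesis using sqrt26 by linarith
  qed
  finally have s2: "50 * \<gamma>\<^sub>0 + 30 \<le> sqrt \<kappa>"
    using \<kappa>\<^sub>2 by (intro real_le_rsqrt) simp
  have s1: "(12 + 4 * \<beta>\<^sub>0) * u\<^sup>2 / (N\<^sup>2 * \<gamma>\<^sub>0) + 26 * \<gamma>\<^sub>0 \<le> sqrt \<kappa>"
    by (rule real_le_rsqrt[OF \<kappa>\<^sub>1])
  have half: "(6 + 2 * \<beta>\<^sub>0) * u\<^sup>2 / (N\<^sup>2 * \<gamma>\<^sub>0) = (12 + 4 * \<beta>\<^sub>0) * u\<^sup>2 / (N\<^sup>2 * \<gamma>\<^sub>0) / 2"
  proof -
    have "(6 + 2 * \<beta>\<^sub>0) * x = (12 + 4 * \<beta>\<^sub>0) * x / 2" for x :: real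
      by (simp add: algebra_simps)
    from this[of "u\<^sup>2 / (N\<^sup>2 * \<gamma>\<^sub>0)"] show ?thesis
      by (simp only: times_divide_eq_right)
  qed
  \<comment> \<open>Halving gives 13 + 25 = 38 multiples of \<open>\<gamma>\<^sub>0\<close> and the
    constant 15.\<close>
  have avg: "(6 + 2 * \<beta>\<^sub>0) * u\<^sup>2 / (N\<^sup>2 * \<gamma>\<^sub>0) + (38 * \<gamma>\<^sub>0 + 15) \<le> sqrt \<kappa>"
    unfolding half using s1 s2 by argo
  have "N\<^sup>2 * u\<^sup>2 * ((6 + 2 * \<beta>\<^sub>0) * u\<^sup>2 / (N\<^sup>2 * \<gamma>\<^sub>0)) = (6 + 2 * \<beta>\<^sub>0) * u^4 / \<gamma>\<^sub>0"
    using N pos by (simp add: field_simps power2_eq_square power4_eq_xxxx)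
  moreover have "u\<^sup>2 * (38 * \<gamma>\<^sub>0 + 15) \<le> N\<^sup>2 * u\<^sup>2 * (38 * \<gamma>\<^sub>0 + 15)"
    using N pos by (intro mult_right_mono) (auto simp: mult_le_cancel_right1 one_le_power)
  moreover have "N\<^sup>2 * u\<^sup>2 * ((6 + 2 * \<beta>\<^sub>0) * u\<^sup>2 / (N\<^sup>2 * \<gamma>\<^sub>0) + (38 * \<gamma>\<^sub>0 + 15)) \<le> N\<^sup>2 * u\<^sup>2 * sqrt \<kappa>"
    by (intro mult_left_mono avg) simp
  ultimately have lower: "(6 + 2 * \<beta>\<^sub>0) * u^4 / \<gamma>\<^sub>0 + u\<^sup>2 * (38 * \<gamma>\<^sub>0 + 15) \<le> N\<^sup>2 * u\<^sup>2 * sqrt \<kappa>"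
    by (simp add: distrib_left)
  have p: "u^3 \<le> u^4" "u\<^sup>2 \<le> u^4" "u \<le> u\<^sup>2"
    using u power_increasing[of 3 4 u] power_increasing[of 2 4 u] power_increasing[of 1 2 u] by auto
  have "4 * u^3 + 2 * \<beta>\<^sub>0 * u\<^sup>2 + 2 * u\<^sup>2 \<le> (6 + 2 * \<beta>\<^sub>0) * u^4"
  proof -
    have "2 * \<beta>\<^sub>0 * u\<^sup>2 \<le> 2 * \<beta>\<^sub>0 * u^4"
      using pos by (intro mult_left_mono p) auto
    then show ?thesis
      unfolding distrib_right using p by linarith
  qed
  then have "(4 * u^3 + 2 * \<beta>\<^sub>0 * u\<^sup>2) / \<gamma>\<^sub>0 + 2 * u\<^sup>2 / \<gamma>\<^sub>0 \<le> (6 + 2 * \<beta>\<^sub>0) * u^4 / \<gamma>\<^sub>0"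
    using pos by (simp add: add_divide_distrib[symmetric] divide_right_mono)
  \<comment> \<open>The target 17 u exceeds the available 15 u^2 by at most 2 u^2. This is paid by
    the reserve 2 u^2 / \<open>\<gamma>\<^sub>0\<close> kept just above and by the 38 - 26 = 12
    spare multiples of u^2 \<open>\<gamma>\<^sub>0\<close>.\<close>
  moreover have "2 * u\<^sup>2 \<le> 2 * u\<^sup>2 / \<gamma>\<^sub>0 + 12 * u\<^sup>2 * \<gamma>\<^sub>0"
  proof -
    have "0 \<le> (\<gamma>\<^sub>0 - 1)\<^sup>2" "0 \<le> \<gamma>\<^sub>0\<^sup>2" by simp_all
    then have "2 * \<gamma>\<^sub>0 \<le> 2 + 12 * \<gamma>\<^sub>0\<^sup>2"
      unfolding power2_diff mult_1_right one_power2 by linarith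
    then have "2 \<le> 2 / \<gamma>\<^sub>0 + 12 * \<gamma>\<^sub>0"
      using pos by (simp add: field_simps power2_eq_square)
    then have "u\<^sup>2 * 2 \<le> u\<^sup>2 * (2 / \<gamma>\<^sub>0 + 12 * \<gamma>\<^sub>0)"
      by (intro mult_left_mono) auto
    then show ?thesis by (simp add: algebra_simps)
  qed
  ultimately show ?thesis
    using lower p by (simp add: algebra_simps)
qed

text \<open>\<open>u\<close> stands for 1/\<zeta>, \<open>S\<close> for the number of states,
  \<open>L\<close> for ln(1/\<delta>) and \<open>gap\<close> for the loss at one state. Since U = u
  D, every term on the right is a multiple of D^2, and 1 \<le> L lets the factor sqrt L of the noise
  term multiply the regrets as well.\<close>

lemma error_bound:
  fixes T :: nat and D U N u \<gamma>\<^sub>0 \<beta>\<^sub>0 \<kappa> \<epsilon> \<delta> \<alpha> \<sigma> S gap L :: real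
  assumes pos: "0 < \<gamma>\<^sub>0" "0 < \<beta>\<^sub>0" "0 < \<epsilon>" "1 \<le> \<sigma>" "0 \<le> \<alpha>" "\<alpha> < 1" "0 < S" "1 \<le> L" and N: "1 \<le> N" "N \<le> u"
    and W: "(4 * u^3 + 2 * \<beta>\<^sub>0 * u\<^sup>2) / \<gamma>\<^sub>0 + 26 * u\<^sup>2 * \<gamma>\<^sub>0 + 17 * u \<le> N\<^sup>2 * u\<^sup>2 * sqrt \<kappa>"
    and \<kappa>: "0 \<le> \<kappa>"
    and D: "D = \<sigma> / (1 - \<alpha>)" and U: "U = u * D"
    and T: "\<kappa> * (\<sigma>\<^sup>2 * S\<^sup>2 * N^4 * u^4 / (1 - \<alpha>)^6) * (1 / \<epsilon>\<^sup>2) * L \<le> real T" and T0: "0 < T"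
    and gap: "real T * (\<sigma> / S * gap) \<le> sqrt (real T) * (N * D\<^sup>2 / \<gamma>\<^sub>0 + 8 * U\<^sup>2 * \<gamma>\<^sub>0)
      + sqrt (real T) * (2 * N * D\<^sup>2 / \<gamma>\<^sub>0 + 16 * U\<^sup>2 * \<gamma>\<^sub>0)
      + sqrt (real T) * (N * U\<^sup>2 / \<gamma>\<^sub>0 + 2 * U\<^sup>2 * \<gamma>\<^sub>0 + 2 * \<beta>\<^sub>0 * N * D * U / \<gamma>\<^sub>0)
      + 12 * U * D * sqrt (2 * real T * L)"
  shows "gap \<le> \<epsilon>"
proof -
  let ?W = "(4 * u^3 + 2 * \<beta>\<^sub>0 * u\<^sup>2) / \<gamma>\<^sub>0 + 26 * u\<^sup>2 * \<gamma>\<^sub>0 + 17 * u"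
  have u: "1 \<le> u" using N by simp
  have D0: "0 < D" using pos D by simp
  have L1: "1 \<le> sqrt L" using pos by simp
  have sT: "0 < sqrt (real T)" using T0 by simp
  have TT: "real T = sqrt (real T) * sqrt (real T)" by simp
  \<comment> \<open>The noise term carries 12 sqrt 2, which becomes the 17 of
    \<open>?W\<close>.\<close>
  have sqrt2: "sqrt 2 \<le> 17 / 12"
    by (rule real_le_lsqrt) (auto simp: power2_eq_square)
  have bound: "N * D\<^sup>2 / \<gamma>\<^sub>0 + 8 * U\<^sup>2 * \<gamma>\<^sub>0 + (2 * N * D\<^sup>2 / \<gamma>\<^sub>0 + 16 * U\<^sup>2 * \<gamma>\<^sub>0)
      + (N * U\<^sup>2 / \<gamma>\<^sub>0 + 2 * U\<^sup>2 * \<gamma>\<^sub>0 + 2 * \<beta>\<^sub>0 * N * D * U / \<gamma>\<^sub>0) + 17 * U * D * sqrt L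
      \<le> ?W * D\<^sup>2 * sqrt L"
  proof -
    \<comment> \<open>Left are the numerators over \<open>\<gamma>\<^sub>0\<close> of the three
      regrets, divided by D^2. The bound N \<le> u removes N in favour of powers of u.\<close>
    have "3 * N + N * u\<^sup>2 + 2 * \<beta>\<^sub>0 * N * u \<le> 4 * u^3 + 2 * \<beta>\<^sub>0 * u\<^sup>2"
    proof -
      have "N * u\<^sup>2 \<le> u^3"
        using N mult_right_mono[of N u "u\<^sup>2"] by (simp add: power3_eq_cube power2_eq_square)
      moreover have "2 * \<beta>\<^sub>0 * N * u \<le> 2 * \<beta>\<^sub>0 * u * u"
        using N pos by (intro mult_right_mono mult_left_mono) auto
      moreover have "N \<le> u^3"
        using N u power_increasing[of 1 3 u] by simp
      ultimately show ?thesis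
        unfolding power2_eq_square mult.assoc[symmetric] by linarith
    qed
    then have "(3 * N + N * u\<^sup>2 + 2 * \<beta>\<^sub>0 * N * u) / \<gamma>\<^sub>0 \<le> (4 * u^3 + 2 * \<beta>\<^sub>0 * u\<^sup>2) / \<gamma>\<^sub>0"
      using pos by (intro divide_right_mono) auto
    then have le: "(3 * N + N * u\<^sup>2 + 2 * \<beta>\<^sub>0 * N * u) / \<gamma>\<^sub>0 + 26 * u\<^sup>2 * \<gamma>\<^sub>0 \<le> (4 * u^3 + 2 * \<beta>\<^sub>0 * u\<^sup>2) / \<gamma>\<^sub>0 + 26 * u\<^sup>2 * \<gamma>\<^sub>0"
      (is "?l \<le> ?r") by simp
    have "0 \<le> ?r" using pos u by simp
    then have "?l \<le> ?r * sqrt L"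
      using le L1 mult_left_mono[OF L1, of ?r] by simp
    then have "D\<^sup>2 * (?l + 17 * u * sqrt L) \<le> D\<^sup>2 * (?r * sqrt L + 17 * u * sqrt L)"
      by (intro mult_left_mono) auto
    moreover have "N * D\<^sup>2 / \<gamma>\<^sub>0 + 8 * U\<^sup>2 * \<gamma>\<^sub>0 + (2 * N * D\<^sup>2 / \<gamma>\<^sub>0 + 16 * U\<^sup>2 * \<gamma>\<^sub>0)
      + (N * U\<^sup>2 / \<gamma>\<^sub>0 + 2 * U\<^sup>2 * \<gamma>\<^sub>0 + 2 * \<beta>\<^sub>0 * N * D * U / \<gamma>\<^sub>0) + 17 * U * D * sqrt L = D\<^sup>2 * (?l + 17 * u * sqrt L)"
      using pos by (simp add: U field_simps power2_eq_square)
    ultimately show ?thesis by (simp add: algebra_simps)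
  qed
  have "12 * U * D * sqrt (2 * real T * L) = sqrt (real T) * (12 * sqrt 2 * (U * D * sqrt L))"
    by (simp add: real_sqrt_mult)
  also have "\<dots> \<le> sqrt (real T) * (17 * (U * D * sqrt L))"
    using sqrt2 D0 u L1 by (intro mult_left_mono mult_right_mono) (auto simp: U)
  finally have "real T * (\<sigma> / S * gap) \<le> sqrt (real T) * (?W * D\<^sup>2 * sqrt L)"
    using gap mult_left_mono[OF bound, of "sqrt (real T)"] by (simp add: algebra_simps)
  then have "sqrt (real T) * (sqrt (real T) * (\<sigma> / S * gap)) \<le> sqrt (real T) * (?W * D\<^sup>2 * sqrt L)"
    using TT by (metis mult.assoc)
  then have g1: "sqrt (real T) * (\<sigma> / S * gap) \<le> ?W * D\<^sup>2 * sqrt L"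
    using sT by (simp only: mult_le_cancel_left_pos)
  \<comment> \<open>The square root of the requirement on T turns the sixth power of 1 - \<alpha>
    into the third. Two of these factors cancel D^2, and the third survives until the final
    estimate.\<close>
  have "(\<sigma> * S * (N\<^sup>2 * u\<^sup>2 * sqrt \<kappa>) * sqrt L / ((1 - \<alpha>)^3 * \<epsilon>))\<^sup>2
      = \<kappa> * (\<sigma>\<^sup>2 * S\<^sup>2 * N^4 * u^4 / (1 - \<alpha>)^6) * (1 / \<epsilon>\<^sup>2) * L"
    using pos \<kappa> by (simp add: power_mult_distrib power_divide power_mult[symmetric])
  then have "\<sigma> * S * (N\<^sup>2 * u\<^sup>2 * sqrt \<kappa>) * sqrt L / ((1 - \<alpha>)^3 * \<epsilon>) \<le> sqrt (real T)"
    using T by (intro real_le_rsqrt) simp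
  then have "\<sigma> * S * (N\<^sup>2 * u\<^sup>2 * sqrt \<kappa>) * sqrt L \<le> sqrt (real T) * ((1 - \<alpha>)^3 * \<epsilon>)"
    using pos by (simp add: pos_divide_le_eq)
  moreover have "\<sigma> * S * ?W * sqrt L \<le> \<sigma> * S * (N\<^sup>2 * u\<^sup>2 * sqrt \<kappa>) * sqrt L"
    using W pos by (intro mult_right_mono mult_left_mono) auto
  ultimately have g2: "\<sigma> * S * ?W * sqrt L \<le> sqrt (real T) * ((1 - \<alpha>)^3 * \<epsilon>)"
    by linarith
  have "sqrt (real T) * (\<sigma> * \<sigma> * gap) = (sqrt (real T) * (\<sigma> / S * gap)) * (\<sigma> * S)"
    using pos by simp
  also have "\<dots> \<le> (?W * D\<^sup>2 * sqrt L) * (\<sigma> * S)"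
    using g1 pos by (intro mult_right_mono) auto
  also have "\<dots> = (\<sigma> * S * ?W * sqrt L) * D\<^sup>2"
    by (simp only: mult_ac)
  also have "\<dots> \<le> sqrt (real T) * ((1 - \<alpha>)^3 * \<epsilon>) * D\<^sup>2"
    using g2 by (intro mult_right_mono) auto
  also have "\<dots> = sqrt (real T) * (\<sigma> * \<sigma> * ((1 - \<alpha>) * \<epsilon>))"
    using pos by (simp add: D power2_eq_square power3_eq_cube)
  finally have "\<sigma> * \<sigma> * gap \<le> \<sigma> * \<sigma> * ((1 - \<alpha>) * \<epsilon>)"
    using sT by (simp only: mult_le_cancel_left_pos)
  then have "gap \<le> (1 - \<alpha>) * \<epsilon>"
    using pos by simp
  also have "\<dots> \<le> 1 * \<epsilon>"
    using pos by (intro mult_right_mono) auto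
  finally show ?thesis by simp
qed

subsection \<open>Gradients of the Lagrangian\<close>

lemma infnorm_le_cart_iff: "infnorm (v::real^'n::finite) \<le> c \<longleftrightarrow> (\<forall>i. \<bar>v $ i\<bar> \<le> c)"
proof
  assume "infnorm v \<le> c"
  then show "\<forall>i. \<bar>v $ i\<bar> \<le> c"
    using component_le_infnorm_cart order_trans by blast
next
  assume "\<forall>i. \<bar>v $ i\<bar> \<le> c"
  then have "\<bar>v \<bullet> b\<bar> \<le> c" if "b \<in> Basis" for b
    using that by (auto simp: Basis_vec_def inner_axis)
  then show "infnorm v \<le> c"
    unfolding infnorm_Max by (intro Max.boundedI) auto
qed

lemma mem_cbox_vec: "(v::real^'n::finite) \<in> cbox 0 (vec c) \<longleftrightarrow> (\<forall>i. 0 \<le> v $ i \<and> v $ i \<le> c)"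
  by (auto simp: mem_box_cart)

lemma nonneg_infnorm_le_eq_cbox:
  "{v :: real^'n::finite. (\<forall>i. 0 \<le> v $ i) \<and> infnorm v \<le> c} = cbox 0 (vec c)"
  by (auto simp: infnorm_le_cart_iff mem_cbox_vec)

lemma V_set_eq: "V_set \<alpha> \<sigma> = cbox 0 (vec (\<sigma> / (1 - \<alpha>)))"
  unfolding V_set_def by (rule nonneg_infnorm_le_eq_cbox)

lemma L_set_eq: "L_set \<alpha> \<eta> = cbox 0 (vec (norm1 \<eta> / (1 - \<alpha>)))"
  unfolding L_set_def by (rule nonneg_infnorm_le_eq_cbox)

lemma M_set_eq: "M_set \<alpha> \<zeta> \<eta> = cbox 0 (vec (norm1 \<eta> / (\<zeta> * (1 - \<alpha>))))"
  unfolding M_set_def by (rule nonneg_infnorm_le_eq_cbox)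

lemma X_set_eq: "X_set \<alpha> \<sigma> = cbox 0 (vec (\<sigma> / (1 - \<alpha>))) \<times> cbox 0 (vec (\<sigma> / (1 - \<alpha>)))"
  unfolding X_set_def V_set_eq by (auto simp: mem_cbox_vec)

lemma convex_closed_X_set: "convex (X_set \<alpha> \<sigma>)" "closed (X_set \<alpha> \<sigma>)"
  unfolding X_set_eq by (auto intro: convex_Times closed_Times)

text \<open>An intersection of half-spaces, one per state, whose normal vector selects the entries
  of that state in all blocks.\<close>

lemma convex_closed_Xi_set:
  fixes \<eta> :: "real^'s::finite"
  defines "\<Xi> \<equiv> Xi_set \<eta> :: (real^('a::finite \<times> 's)) set"
  shows "convex \<Xi>" "closed \<Xi>"
proof -
  have "\<Xi> = (\<Inter>s. {lam. (\<chi> i. if snd i = s then 1 else 0) \<bullet> lam \<ge> \<eta> $ s})"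
    by (auto simp: \<Xi>_def Xi_set_def inner_vec_def sum_UNIV_pairs if_distrib[of "\<lambda>c. c * _"] sum.swap[of _ UNIV UNIV]
      cong: if_cong)
  then show "convex \<Xi>" "closed \<Xi>"
    by (simp_all add: convex_INT closed_INT convex_halfspace_ge closed_halfspace_ge)
qed

lemma convex_closed_Y_set: "convex (Y_set \<alpha> \<zeta> \<eta>)" "closed (Y_set \<alpha> \<zeta> \<eta>)"
  unfolding Y_set_def L_set_eq M_set_eq using convex_closed_Xi_set[of \<eta>]
  by (auto intro!: convex_Times closed_Times convex_Int closed_Int)

lemma norm1_axis [simp]: "norm1 (c *\<^sub>R axis i 1) = \<bar>c\<bar>"
proof -
  have "norm1 (c *\<^sub>R axis i 1) = (\<Sum>j\<in>UNIV. if j = i then \<bar>c\<bar> else 0)"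
    unfolding norm1_def by (intro sum.cong) (auto simp: axis_def)
  then show ?thesis by simp
qed

lemma norm1_add: "norm1 (a + b) \<le> norm1 a + norm1 b"
  unfolding norm1_def sum.distrib[symmetric] by (intro sum_mono) simp

lemma norm1_diff: "norm1 (a - b) \<le> norm1 a + norm1 b"
  unfolding norm1_def sum.distrib[symmetric] by (intro sum_mono) simp

lemma norm_le_norm1: "norm v \<le> norm1 v"
  unfolding norm1_def by (rule norm_le_l1_cart)

text \<open>Hoelder's inequality between the 1-norm and the sup norm. Sparse noise against box
  differences is bounded without the dimension factor that Cauchy-Schwarz would bring into the
  martingale bound.\<close>

lemma abs_inner_le_norm1:
  assumes "\<And>i. \<bar>w $ i\<bar> \<le> c"
  shows "\<bar>v \<bullet> w\<bar> \<le> norm1 v * c"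
proof -
  have "\<bar>v \<bullet> w\<bar> \<le> (\<Sum>i\<in>UNIV. \<bar>v $ i * w $ i\<bar>)"
    unfolding inner_vec_def by simp
  also have "\<dots> \<le> (\<Sum>i\<in>UNIV. \<bar>v $ i\<bar> * c)"
    unfolding abs_mult using assms by (intro sum_mono mult_left_mono) auto
  finally show ?thesis
    by (simp add: norm1_def sum_distrib_right)
qed

section \<open>The Lagrangian as an affine function of each argument\<close>

text \<open>\<open>grad\<close> is a definite description, so besides the derivative of an affine
  map its uniqueness is needed: the inner products with all vectors determine the gradient.\<close>

lemma grad_eqI:
  assumes "\<And>z. f z = G \<bullet> z + c"
  shows "grad f x = G"
  unfolding grad_def
proof (rule the_equality)
  have f: "f = (\<lambda>z. z \<bullet> G + c)"
    using assms by (simp add: fun_eq_iff inner_commute)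
  then show "GDERIV f x :> G"
    unfolding gderiv_def f by (auto intro!: derivative_eq_intros)
  then show "D = G" if "GDERIV f x :> D" for D
    using that has_derivative_unique unfolding gderiv_def by (metis vector_eq_ldot)
qed

text \<open>The linear part of the Lagrangian in \<open>x\<close>, in coordinates.
  \<open>Lagrangian_affine_x\<close> justifies the formula, and \<open>noise_x_eq\<close> identifies
  it with the gradient inside the noise.\<close>

definition lagr_grad_x ::
  "real \<Rightarrow> ('a::finite \<Rightarrow> 's::finite \<Rightarrow> 's pmf) \<Rightarrow> real^'s \<Rightarrow> ('a \<times> 's) pmf
     \<Rightarrow> (real^('a \<times> 's)) \<times> (real^('a \<times> 's)) \<Rightarrow> (real^('a \<times> 's)) \<times> (real^'s)" where
  "lagr_grad_x \<alpha> P \<eta> \<tau> y =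
     (\<chi> i. fst y $ i - pmf \<tau> i * snd y $ i,
      \<chi> s. \<eta> $ s - (\<Sum>a\<in>UNIV. fst y $ (a, s))
        + \<alpha> * (\<Sum>i\<in>UNIV. pmf (P (fst i) (snd i)) s * (pmf \<tau> i * snd y $ i)))"

definition lagr_grad_y ::
  "real \<Rightarrow> ('a::finite \<Rightarrow> 's::finite \<Rightarrow> 's pmf) \<Rightarrow> ('s \<Rightarrow> 's \<Rightarrow> 'a \<Rightarrow> real measure) \<Rightarrow> ('a \<times> 's) pmf
     \<Rightarrow> (real^('a \<times> 's)) \<times> (real^'s) \<Rightarrow> (real^('a \<times> 's)) \<times> (real^('a \<times> 's))" where
  "lagr_grad_y \<alpha> P rew \<tau> x =
     (\<chi> i. fst x $ i - snd x $ (snd i), \<chi> i. pmf \<tau> i * (action_value \<alpha> P rew (snd x) $ i - fst x $ i))"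

lemma Lagrangian_affine_x:
  fixes P :: "'a::finite \<Rightarrow> 's::finite \<Rightarrow> 's pmf"
  shows "Lagrangian \<alpha> P rew \<eta> (weight_matrix \<tau>) x y =
    lagr_grad_x \<alpha> P \<eta> \<tau> y \<bullet> x + (\<Sum>i\<in>UNIV. pmf \<tau> i * snd y $ i * stacked_R P rew $ i)"
proof -
  obtain Q V lam mu where xy [simp]: "x = (Q, V)" "y = (lam, mu)" by (cases x, cases y)
  define W where "W i = (\<Sum>s\<in>UNIV. pmf (P (fst i) (snd i)) s * V $ s)" for i
  have av: "action_value \<alpha> P rew V $ i = stacked_R P rew $ i + \<alpha> * W i" for i
    by (cases i) (simp add: action_value_nth W_def)
  have P: "(\<Sum>s\<in>UNIV. (\<Sum>i\<in>UNIV. pmf (P (fst i) (snd i)) s * (pmf \<tau> i * mu $ i)) * V $ s) =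
      (\<Sum>i\<in>UNIV. pmf \<tau> i * mu $ i * W i)"
    unfolding W_def sum_distrib_left sum_distrib_right by (subst sum.swap) (simp add: mult_ac)
  have I: "(\<Sum>i\<in>UNIV. lam $ i * V $ (snd i)) = (\<Sum>s\<in>UNIV. (\<Sum>a\<in>UNIV. lam $ (a, s)) * V $ s)"
    by (simp add: sum_UNIV_pairs sum_distrib_right)
  have "(\<Sum>i\<in>UNIV. pmf \<tau> i * mu $ i * (stacked_R P rew $ i + \<alpha> * W i - Q $ i)) =
      (\<Sum>i\<in>UNIV. pmf \<tau> i * mu $ i * stacked_R P rew $ i) + \<alpha> * (\<Sum>i\<in>UNIV. pmf \<tau> i * mu $ i * W i)
      - (\<Sum>i\<in>UNIV. pmf \<tau> i * mu $ i * Q $ i)"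
    unfolding sum_distrib_left[of \<alpha>] sum.distrib[symmetric] sum_subtractf[symmetric]
    by (rule sum.cong[OF refl]) (simp add: algebra_simps)
  moreover have "(\<Sum>i\<in>UNIV. lam $ i * (Q $ i - V $ (snd i))) =
      (\<Sum>i\<in>UNIV. lam $ i * Q $ i) - (\<Sum>i\<in>UNIV. lam $ i * V $ (snd i))"
    by (simp add: right_diff_distrib sum_subtractf)
  moreover have "lagr_grad_x \<alpha> P \<eta> \<tau> y \<bullet> x =
      (\<Sum>i\<in>UNIV. (lam $ i - pmf \<tau> i * mu $ i) * Q $ i)
      + (\<Sum>s\<in>UNIV. (\<eta> $ s - (\<Sum>a\<in>UNIV. lam $ (a, s))
          + \<alpha> * (\<Sum>i\<in>UNIV. pmf (P (fst i) (snd i)) s * (pmf \<tau> i * mu $ i))) * V $ s)"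
    by (simp add: lagr_grad_x_def inner_vec_def)
  moreover have "(\<Sum>i\<in>UNIV. (lam $ i - pmf \<tau> i * mu $ i) * Q $ i) =
      (\<Sum>i\<in>UNIV. lam $ i * Q $ i) - (\<Sum>i\<in>UNIV. pmf \<tau> i * mu $ i * Q $ i)"
    by (simp add: left_diff_distrib sum_subtractf)
  moreover have "(\<Sum>s\<in>UNIV. (\<eta> $ s - (\<Sum>a\<in>UNIV. lam $ (a, s))
          + \<alpha> * (\<Sum>i\<in>UNIV. pmf (P (fst i) (snd i)) s * (pmf \<tau> i * mu $ i))) * V $ s) =
      (\<Sum>s\<in>UNIV. \<eta> $ s * V $ s) - (\<Sum>s\<in>UNIV. (\<Sum>a\<in>UNIV. lam $ (a, s)) * V $ s)
      + \<alpha> * (\<Sum>s\<in>UNIV. (\<Sum>i\<in>UNIV. pmf (P (fst i) (snd i)) s * (pmf \<tau> i * mu $ i)) * V $ s)"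
    by (simp only: distrib_right left_diff_distrib sum.distrib sum_subtractf mult.assoc[of \<alpha>] sum_distrib_left[of \<alpha>, symmetric])
  moreover have "\<eta> \<bullet> V = (\<Sum>s\<in>UNIV. \<eta> $ s * V $ s)"
    by (simp add: inner_vec_def)
  ultimately show ?thesis
    unfolding \<open>x = (Q, V)\<close> \<open>y = (lam, mu)\<close> Lagrangian_weight_matrix av P I snd_conv by linarith
qed

lemma Lagrangian_affine_y:
  fixes P :: "'a::finite \<Rightarrow> 's::finite \<Rightarrow> 's pmf"
  shows "Lagrangian \<alpha> P rew \<eta> (weight_matrix \<tau>) x y = lagr_grad_y \<alpha> P rew \<tau> x \<bullet> y + \<eta> \<bullet> snd x"
  by (cases x, cases y)
    (simp add: Lagrangian_weight_matrix lagr_grad_y_def inner_vec_def[of "vec_lambda _"] mult_ac)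

lemma noise_x_eq: "noise_x \<alpha> P rew \<eta> \<tau> x y z = grad_x \<alpha> \<eta> y z - lagr_grad_x \<alpha> P \<eta> \<tau> y"
  unfolding noise_x_def grad_eqI[OF Lagrangian_affine_x] ..

lemma noise_y_eq: "noise_y \<alpha> P rew \<eta> \<tau> x y z = grad_y \<alpha> x z - lagr_grad_y \<alpha> P rew \<tau> x"
  unfolding noise_y_def grad_eqI[OF Lagrangian_affine_y] ..

text \<open>For an affine function the first-order inequality of convexity is an equality. This is
  how regrets become differences of Lagrangian values.\<close>

lemma lagr_grad_x_inner_diff:
  "lagr_grad_x \<alpha> P \<eta> \<tau> y \<bullet> (x - x') =
    Lagrangian \<alpha> P rew \<eta> (weight_matrix \<tau>) x y - Lagrangian \<alpha> P rew \<eta> (weight_matrix \<tau>) x' y"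
  by (simp add: Lagrangian_affine_x inner_diff_right)

lemma lagr_grad_y_inner_diff:
  "lagr_grad_y \<alpha> P rew \<tau> x \<bullet> (y - y') =
    Lagrangian \<alpha> P rew \<eta> (weight_matrix \<tau>) x y - Lagrangian \<alpha> P rew \<eta> (weight_matrix \<tau>) x y'"
  by (simp add: Lagrangian_affine_y inner_diff_right)

text \<open>For fixed discrete components the sample law gives the probability of every Borel set of
  rewards. On the complement of [0, \<sigma>] it is zero, and there are only finitely many discrete
  components.\<close>

lemma AE_sample_reward:
  fixes rew :: "'s::finite \<Rightarrow> 's \<Rightarrow> 'a::finite \<Rightarrow> real measure"
  assumes mdp: "discounted_mdp \<alpha> \<sigma> rew" and M: "prob_space M" and law: "has_sample_law M P rew \<tau> smp"
  shows "AE \<omega> in M. \<forall>s a s' r su au. smp \<omega> = (s, a, s', r, su, au) \<longrightarrow> 0 \<le> r \<and> r \<le> \<sigma>"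
proof -
  interpret prob_space M by (rule M)
  have meas: "smp \<in> M \<rightarrow>\<^sub>M count_space UNIV \<Otimes>\<^sub>M (count_space UNIV \<Otimes>\<^sub>M (count_space UNIV \<Otimes>\<^sub>M
              (borel \<Otimes>\<^sub>M (count_space UNIV \<Otimes>\<^sub>M count_space UNIV))))"
    using law by (simp add: has_sample_law_def)
  have "AE \<omega> in M. \<not> (\<exists>r\<in>- {0..\<sigma>}. smp \<omega> = (s, a, s', r, su, au))" for s a s' su au
  proof -
    let ?A = "{\<omega> \<in> space M. \<exists>r\<in>- {0..\<sigma>}. smp \<omega> = (s, a, s', r, su, au)}"
    interpret rew: prob_space "rew s s' a" by (rule discounted_mdpD(4)[OF mdp])
    have "measure (rew s s' a) (- {0..\<sigma>}) = 0"
    proof -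
      have "AE r in rew s s' a. r \<notin> - {0..\<sigma>}"
        using discounted_mdpD(6)[OF mdp, of s s' a] by eventually_elim auto
      then show ?thesis
        by (subst rew.prob_eq_0) (auto simp: discounted_mdpD(5)[OF mdp])
    qed
    then have zero: "measure M ?A = 0"
      using law unfolding has_sample_law_def by (auto simp: Ball_def)
    have "?A = smp -` ({s} \<times> {a} \<times> {s'} \<times> (- {0..\<sigma>}) \<times> {su} \<times> {au}) \<inter> space M"
      by auto
    also have "\<dots> \<in> sets M"
      by (rule measurable_sets[OF meas]) (intro pair_measureI; simp)
    finally have "?A \<in> sets M" .
    with zero have "AE \<omega> in M. \<omega> \<notin> ?A"
      by (simp add: prob_eq_0)
    with AE_space show ?thesis
      by eventually_elim auto
  qed
  then have "AE \<omega> in M. \<forall>s a s' su au. \<not> (\<exists>r\<in>- {0..\<sigma>}. smp \<omega> = (s, a, s', r, su, au))"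
    by (simp add: AE_all_countable)
  then show ?thesis
    by eventually_elim (metis ComplI atLeastAtMost_iff)
qed

lemma sum_pmf_le:
  fixes \<tau> :: "'b::finite pmf"
  assumes "\<And>i. 0 \<le> h i" "\<And>i. h i \<le> c"
  shows "(\<Sum>i\<in>UNIV. pmf \<tau> i * h i) \<le> c"
proof -
  have "(\<Sum>i\<in>UNIV. pmf \<tau> i * h i) \<le> (\<Sum>i\<in>UNIV. pmf \<tau> i * c)"
    using assms by (intro sum_mono mult_left_mono) auto
  then show ?thesis
    by (simp add: sum_distrib_right[symmetric] sum_pmf_eq_1)
qed

lemma norm_prod_le:
  assumes "norm1 (fst v) \<le> a" "norm1 (snd v) \<le> b"
  shows "(norm v)\<^sup>2 \<le> a\<^sup>2 + b\<^sup>2"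
proof -
  have "norm (fst v) \<le> a" "norm (snd v) \<le> b"
    using assms norm_le_norm1 order_trans by blast+
  then have "(norm (fst v))\<^sup>2 \<le> a\<^sup>2" "(norm (snd v))\<^sup>2 \<le> b\<^sup>2"
    by (auto intro: power_mono)
  then show ?thesis
    by (simp add: norm_prod_def)
qed

lemma abs_diff_le_box: "0 \<le> a \<Longrightarrow> a \<le> c \<Longrightarrow> 0 \<le> b \<Longrightarrow> b \<le> c \<Longrightarrow> \<bar>a - b\<bar> \<le> (c::real)"
  by simp

lemma norm_box_le:
  assumes "\<And>i. \<bar>v $ i\<bar> \<le> c"
  shows "(norm (v::real^'n::finite))\<^sup>2 \<le> real CARD('n) * c\<^sup>2"
proof -
  have "(norm v)\<^sup>2 = (\<Sum>i\<in>UNIV. (v $ i)\<^sup>2)"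
    by (simp add: norm_vec_def L2_set_def sum_nonneg)
  also have "\<dots> \<le> (\<Sum>i\<in>(UNIV::'n set). c\<^sup>2)"
    using assms by (intro sum_mono) (simp add: abs_le_square_iff[symmetric] order_trans[OF _ abs_ge_self])
  finally show ?thesis by simp
qed

section \<open>Uniform bounds on gradients, noise and distances\<close>

text \<open>\<open>D\<close> bounds the entries of \<open>Q\<close>, \<open>V\<close> and \<lambda>
  alike because the 1-norm of \<eta> is \<sigma>; \<open>U\<close> bounds those of \<mu>.
  \<open>N_\<zeta>\<close> reflects that \<open>N\<close> probabilities of size at least \<zeta> add
  up to 1; it yields N D \<le> U, so that the weight \<open>N\<close> of the uniform samples is
  absorbed in \<open>U\<close>.\<close>

locale spd_bounds =
  fixes P :: "'a::finite \<Rightarrow> 's::finite \<Rightarrow> 's pmf" and rew :: "'s \<Rightarrow> 's \<Rightarrow> 'a \<Rightarrow> real measure"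
    and \<alpha> \<sigma> \<zeta> D U N :: real and \<eta> :: "real^'s"
  assumes mdp: "discounted_mdp \<alpha> \<sigma> rew"
    and \<zeta>_pos: "0 < \<zeta>"
    and \<eta>_eq: "\<eta> = (\<chi> s. \<sigma> / real CARD('s))"
    and D_eq: "D = \<sigma> / (1 - \<alpha>)"
    and U_eq: "U = D / \<zeta>"
    and N_eq: "N = real CARD('s) * real CARD('a)"
    and N_\<zeta>: "N * \<zeta> \<le> 1"
begin

lemmas \<alpha> = discounted_mdpD(1,2)[OF mdp]
lemmas \<sigma> = discounted_mdpD(3)[OF mdp]

lemma card_ge_1: "1 \<le> real CARD('s)" "1 \<le> real CARD('a)"
  by (simp_all add: Suc_le_eq)

lemma N_ge_1: "1 \<le> N"
  unfolding N_eq using mult_mono[OF card_ge_1] by simp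

lemma D_pos: "0 < D" and \<sigma>_le_D: "\<sigma> \<le> D"
  using \<alpha> \<sigma> by (auto simp: D_eq pos_le_divide_eq mult_le_cancel_left1)

lemma N_D_le_U: "N * D \<le> U" and D_le_N_D: "D \<le> N * D"
  using N_\<zeta> \<zeta>_pos D_pos N_ge_1 mult_right_mono[OF N_\<zeta>, of D] by (simp_all add: U_eq pos_le_divide_eq mult_ac mult_le_cancel_left1)

lemma D_le_U: "D \<le> U" and U_pos: "0 < U"
  using order_trans[OF D_le_N_D N_D_le_U] D_pos by simp_all

lemma discounted_D: "\<alpha> * D + \<sigma> = D"
  using \<alpha> by (simp add: D_eq field_simps)

lemma norm1_\<eta>: "norm1 \<eta> = \<sigma>"
  using \<sigma> by (simp add: norm1_def \<eta>_eq)

lemma \<eta>_bounds: "0 \<le> \<eta> $ s" "\<eta> $ s \<le> \<sigma>" "\<eta> $ s \<le> D" "real CARD('s) * \<eta> $ s = \<sigma>"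
proof -
  show "0 \<le> \<eta> $ s" "real CARD('s) * \<eta> $ s = \<sigma>"
    using \<sigma> by (auto simp: \<eta>_eq)
  show "\<eta> $ s \<le> \<sigma>"
    using \<sigma> card_ge_1 by (simp add: \<eta>_eq divide_le_eq mult_le_cancel_left1)
  then show "\<eta> $ s \<le> D"
    using \<sigma>_le_D by simp
qed

definition xbox :: "(real^('a \<times> 's)) \<times> (real^'s) \<Rightarrow> bool" where
  "xbox x \<longleftrightarrow> (\<forall>i. 0 \<le> fst x $ i \<and> fst x $ i \<le> D) \<and> (\<forall>s. 0 \<le> snd x $ s \<and> snd x $ s \<le> D)"

definition ybox :: "(real^('a \<times> 's)) \<times> (real^('a \<times> 's)) \<Rightarrow> bool" where
  "ybox y \<longleftrightarrow> (\<forall>i. 0 \<le> fst y $ i \<and> fst y $ i \<le> D) \<and> (\<forall>i. 0 \<le> snd y $ i \<and> snd y $ i \<le> U)"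

lemma yboxD:
  assumes "ybox y"
  shows "0 \<le> fst y $ i" "fst y $ i \<le> D" "0 \<le> snd y $ i" "snd y $ i \<le> U"
  using assms unfolding ybox_def by blast+

lemma X_set_iff: "x \<in> X_set \<alpha> \<sigma> \<longleftrightarrow> xbox x"
  unfolding X_set_eq D_eq[symmetric] mem_Times_iff mem_cbox_vec xbox_def ..

lemma Y_set_iff: "y \<in> Y_set \<alpha> \<zeta> \<eta> \<longleftrightarrow> ybox y \<and> fst y \<in> Xi_set \<eta>"
proof -
  have U: "\<sigma> / (\<zeta> * (1 - \<alpha>)) = U"
    by (simp add: U_eq D_eq mult.commute)
  show ?thesis
    unfolding Y_set_def L_set_eq M_set_eq norm1_\<eta> D_eq[symmetric] U mem_Times_iff Int_iff mem_cbox_vec ybox_def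
    by blast
qed

lemma norm1_grad_x:
  assumes "ybox y"
  shows "norm1 (fst (grad_x \<alpha> \<eta> y z)) \<le> 2 * U" "norm1 (snd (grad_x \<alpha> \<eta> y z)) \<le> 2 * U"
proof -
  obtain lam mu where y: "y = (lam, mu)" by (cases y)
  obtain s a s' r su au where z: "z = (s, a, s', r, su, au)" by (cases z) auto
  have lam: "0 \<le> lam $ i" "lam $ i \<le> D" and mu: "0 \<le> mu $ i" "mu $ i \<le> U" for i
    using assms unfolding y ybox_def fst_conv snd_conv by blast+
  have Nlam: "0 \<le> N * lam $ i" "N * lam $ i \<le> N * D" for i
    using lam N_ge_1 by (auto intro: mult_left_mono)
  have "norm1 (fst (grad_x \<alpha> \<eta> y z)) \<le> \<bar>N * lam $ (au, su)\<bar> + \<bar>mu $ (a, s)\<bar>"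
    unfolding grad_x_def y z by (simp flip: N_eq) (rule order_trans[OF norm1_diff], simp)
  also have "\<dots> \<le> 2 * U"
    using Nlam[of "(au, su)"] mu[of "(a, s)"] N_D_le_U by simp
  finally show "norm1 (fst (grad_x \<alpha> \<eta> y z)) \<le> 2 * U" .
  \<comment> \<open>Uniform \<eta> merges the first two terms on one axis. Both \<sigma> and N times
    an entry of \<lambda> lie in [0, U], so their difference costs \<open>U\<close> rather than 2
    U.\<close>
  have "snd (grad_x \<alpha> \<eta> y z) = (\<sigma> - N * lam $ (au, su)) *\<^sub>R axis su 1 + (\<alpha> * mu $ (a, s)) *\<^sub>R axis s' 1"
    unfolding grad_x_def y z prod.case snd_conv \<eta>_bounds(4) N_eq[symmetric] by (simp add: scaleR_left_diff_distrib)
  then have "norm1 (snd (grad_x \<alpha> \<eta> y z)) \<le> \<bar>\<sigma> - N * lam $ (au, su)\<bar> + \<bar>\<alpha> * mu $ (a, s)\<bar>"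
    using norm1_add[of "(\<sigma> - N * lam $ (au, su)) *\<^sub>R axis su 1" "(\<alpha> * mu $ (a, s)) *\<^sub>R axis s' 1"] by simp
  also have "\<bar>\<sigma> - N * lam $ (au, su)\<bar> \<le> U"
    using Nlam[of "(au, su)"] \<sigma> \<sigma>_le_D D_le_U N_D_le_U by linarith
  also have "\<bar>\<alpha> * mu $ (a, s)\<bar> \<le> 1 * U"
    unfolding abs_mult using \<alpha> mu[of "(a, s)"] by (intro mult_mono) auto
  finally show "norm1 (snd (grad_x \<alpha> \<eta> y z)) \<le> 2 * U"
    by simp
qed

lemma norm1_lagr_grad_x:
  assumes "ybox y"
  shows "norm1 (fst (lagr_grad_x \<alpha> P \<eta> \<tau> y)) \<le> 2 * U" "norm1 (snd (lagr_grad_x \<alpha> P \<eta> \<tau> y)) \<le> 2 * U"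
proof -
  obtain lam mu where y: "y = (lam, mu)" by (cases y)
  have lam: "0 \<le> lam $ i" "lam $ i \<le> D" and mu: "0 \<le> mu $ i" "mu $ i \<le> U" for i
    using assms unfolding y ybox_def fst_conv snd_conv by blast+
  have card: "real CARD('a \<times> 's) = N"
    by (simp add: N_eq)
  have "norm1 (fst (lagr_grad_x \<alpha> P \<eta> \<tau> y)) \<le> (\<Sum>i\<in>UNIV. D + pmf \<tau> i * mu $ i)"
    unfolding norm1_def
  proof (rule sum_mono)
    fix i
    have "0 \<le> pmf \<tau> i * mu $ i"
      using mu by simp
    then show "\<bar>fst (lagr_grad_x \<alpha> P \<eta> \<tau> y) $ i\<bar> \<le> D + pmf \<tau> i * mu $ i"
      using lam[of i] by (simp add: lagr_grad_x_def y)
  qed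
  also have "\<dots> \<le> N * D + U"
    using sum_pmf_le[of "\<lambda>i. mu $ i" U \<tau>] mu card by (simp add: sum.distrib)
  finally show "norm1 (fst (lagr_grad_x \<alpha> P \<eta> \<tau> y)) \<le> 2 * U"
    using N_D_le_U by simp
  let ?A = "real CARD('a)"
  let ?f = "\<lambda>s. \<alpha> * (\<Sum>i\<in>UNIV. pmf (P (fst i) (snd i)) s * (pmf \<tau> i * mu $ i))"
  have f: "0 \<le> ?f s" for s
    using \<alpha> mu by (intro mult_nonneg_nonneg sum_nonneg) auto
  have sumf: "(\<Sum>s\<in>UNIV. ?f s) \<le> U"
  proof -
    have "(\<Sum>s\<in>UNIV. ?f s) = \<alpha> * (\<Sum>i\<in>UNIV. pmf \<tau> i * mu $ i)"
      unfolding sum_distrib_left[symmetric]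
      by (subst sum.swap) (simp add: sum_distrib_right[symmetric] sum_pmf_eq_1)
    also have "\<dots> \<le> 1 * U"
      using \<alpha> mu sum_pmf_le[of "\<lambda>i. mu $ i" U \<tau>] by (intro mult_mono) (auto intro!: sum_nonneg)
    finally show ?thesis by simp
  qed
  have AD: "D \<le> ?A * D"
    using card_ge_1 D_pos by (simp add: mult_le_cancel_left1)
  have sumlam: "0 \<le> (\<Sum>a\<in>UNIV. lam $ (a, s))" "(\<Sum>a\<in>UNIV. lam $ (a, s)) \<le> ?A * D" for s
    using lam sum_mono[of UNIV "\<lambda>a. lam $ (a, s)" "\<lambda>_. D"] by (auto intro: sum_nonneg)
  have "norm1 (snd (lagr_grad_x \<alpha> P \<eta> \<tau> y)) \<le> (\<Sum>s\<in>(UNIV::'s set). ?A * D + ?f s)"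
    unfolding norm1_def
  proof (rule sum_mono)
    fix s
    have "snd (lagr_grad_x \<alpha> P \<eta> \<tau> y) $ s = \<eta> $ s - (\<Sum>a\<in>UNIV. lam $ (a, s)) + ?f s"
      by (simp add: lagr_grad_x_def y)
    then show "\<bar>snd (lagr_grad_x \<alpha> P \<eta> \<tau> y) $ s\<bar> \<le> ?A * D + ?f s"
      using f[of s] sumlam[of s] \<eta>_bounds(1,3)[of s] AD by linarith
  qed
  also have "\<dots> = real CARD('s) * (?A * D) + (\<Sum>s\<in>UNIV. ?f s)"
    by (simp add: sum.distrib)
  also have "\<dots> \<le> N * D + U"
    using sumf by (simp add: N_eq)
  finally show "norm1 (snd (lagr_grad_x \<alpha> P \<eta> \<tau> y)) \<le> 2 * U"
    using N_D_le_U by simp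
qed

lemma norm1_grad_y:
  assumes "xbox x" and r: "0 \<le> r" "r \<le> \<sigma>"
  shows "norm1 (fst (grad_y \<alpha> x (s, a, s', r, su, au))) \<le> N * D"
    "norm1 (snd (grad_y \<alpha> x (s, a, s', r, su, au))) \<le> D"
proof -
  obtain Q V where x: "x = (Q, V)" by (cases x)
  have Q: "0 \<le> Q $ i" "Q $ i \<le> D" and V: "0 \<le> V $ t" "V $ t \<le> D" for i t
    using assms unfolding x xbox_def fst_conv snd_conv by blast+
  have "norm1 (fst (grad_y \<alpha> x (s, a, s', r, su, au))) = N * \<bar>Q $ (au, su) - V $ su\<bar>"
    using N_ge_1 by (simp add: grad_y_def x abs_mult N_eq)
  also have "\<dots> \<le> N * D"
    using N_ge_1 Q[of "(au, su)"] V[of su] by (intro mult_left_mono) (auto simp: abs_le_iff)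
  finally show "norm1 (fst (grad_y \<alpha> x (s, a, s', r, su, au))) \<le> N * D" .
  \<comment> \<open>As \<alpha> D + \<sigma> = D, the target \<alpha> V + r stays in [0, D] like Q,
    and the temporal difference is at most D.\<close>
  have "0 \<le> \<alpha> * V $ s'" "\<alpha> * V $ s' \<le> \<alpha> * D"
    using \<alpha> V[of s'] by (auto intro: mult_left_mono)
  then show "norm1 (snd (grad_y \<alpha> x (s, a, s', r, su, au))) \<le> D"
    using Q[of "(a, s)"] r discounted_D by (simp add: grad_y_def x abs_le_iff)
qed

lemma norm1_lagr_grad_y:
  assumes "xbox x"
  shows "norm1 (fst (lagr_grad_y \<alpha> P rew \<tau> x)) \<le> N * D" "norm1 (snd (lagr_grad_y \<alpha> P rew \<tau> x)) \<le> D"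
proof -
  obtain Q V where x: "x = (Q, V)" by (cases x)
  have Q: "0 \<le> Q $ i" "Q $ i \<le> D" and V: "0 \<le> V $ t" "V $ t \<le> D" for i t
    using assms unfolding x xbox_def fst_conv snd_conv by blast+
  have "norm1 (fst (lagr_grad_y \<alpha> P rew \<tau> x)) \<le> (\<Sum>i\<in>(UNIV::('a \<times> 's) set). D)"
    unfolding norm1_def
  proof (rule sum_mono)
    fix i
    show "\<bar>fst (lagr_grad_y \<alpha> P rew \<tau> x) $ i\<bar> \<le> D"
      using Q[of i] V[of "snd i"] by (simp add: lagr_grad_y_def x)
  qed
  then show "norm1 (fst (lagr_grad_y \<alpha> P rew \<tau> x)) \<le> N * D"
    by (simp add: N_eq mult_ac)
  have av: "0 \<le> action_value \<alpha> P rew V $ i" "action_value \<alpha> P rew V $ i \<le> D" for i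
    using action_value_bounds[OF mdp, of V P i] V by (auto simp: D_eq)
  have "norm1 (snd (lagr_grad_y \<alpha> P rew \<tau> x)) = (\<Sum>i\<in>UNIV. pmf \<tau> i * \<bar>action_value \<alpha> P rew V $ i - Q $ i\<bar>)"
    by (simp add: norm1_def lagr_grad_y_def x abs_mult)
  also have "\<dots> \<le> D"
  proof (rule sum_pmf_le)
    fix i
    show "\<bar>action_value \<alpha> P rew V $ i - Q $ i\<bar> \<le> D"
      using av[of i] Q[of i] by simp
  qed simp
  finally show "norm1 (snd (lagr_grad_y \<alpha> P rew \<tau> x)) \<le> D" .
qed

lemma norm_grad_x: "ybox y \<Longrightarrow> (norm (grad_x \<alpha> \<eta> y z))\<^sup>2 \<le> 8 * U\<^sup>2"
  using norm_prod_le[OF norm1_grad_x, of y z] by (simp add: power_mult_distrib)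

lemma norm_grad_y:
  assumes "xbox x" "0 \<le> r" "r \<le> \<sigma>"
  shows "(norm (grad_y \<alpha> x (s, a, s', r, su, au)))\<^sup>2 \<le> 2 * U\<^sup>2"
proof -
  have "(norm (grad_y \<alpha> x (s, a, s', r, su, au)))\<^sup>2 \<le> (N * D)\<^sup>2 + D\<^sup>2"
    by (intro norm_prod_le norm1_grad_y assms)
  also have "\<dots> \<le> U\<^sup>2 + U\<^sup>2"
    using N_D_le_U D_le_U D_pos N_ge_1 by (intro add_mono power_mono) auto
  finally show ?thesis by simp
qed

lemma norm1_noise_x:
  assumes "ybox y"
  shows "norm1 (fst (noise_x \<alpha> P rew \<eta> \<tau> x y z)) \<le> 4 * U" "norm1 (snd (noise_x \<alpha> P rew \<eta> \<tau> x y z)) \<le> 4 * U"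
  using norm1_grad_x[OF assms, of z] norm1_lagr_grad_x[OF assms, of \<tau>]
    norm1_diff[of "fst (grad_x \<alpha> \<eta> y z)" "fst (lagr_grad_x \<alpha> P \<eta> \<tau> y)"]
    norm1_diff[of "snd (grad_x \<alpha> \<eta> y z)" "snd (lagr_grad_x \<alpha> P \<eta> \<tau> y)"]
  by (simp_all add: noise_x_eq)

lemma norm_noise_x: "ybox y \<Longrightarrow> (norm (noise_x \<alpha> P rew \<eta> \<tau> x y z))\<^sup>2 \<le> 32 * U\<^sup>2"
  using norm_prod_le[OF norm1_noise_x, of y \<tau> x z] by (simp add: power_mult_distrib)

lemma inner_noise_x:
  assumes "ybox y" "xbox u" "xbox u'"
  shows "\<bar>noise_x \<alpha> P rew \<eta> \<tau> x y z \<bullet> (u - u')\<bar> \<le> 8 * U * D"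
proof -
  let ?e = "noise_x \<alpha> P rew \<eta> \<tau> x y z"
  have "\<bar>fst ?e \<bullet> (fst u - fst u')\<bar> \<le> norm1 (fst ?e) * D" "\<bar>snd ?e \<bullet> (snd u - snd u')\<bar> \<le> norm1 (snd ?e) * D"
    using assms(2,3) by (intro abs_inner_le_norm1; auto simp: xbox_def intro!: abs_diff_le_box)+
  moreover have "norm1 (fst ?e) * D \<le> 4 * U * D" "norm1 (snd ?e) * D \<le> 4 * U * D"
    using norm1_noise_x[OF assms(1)] D_pos by (auto intro!: mult_right_mono)
  moreover have "?e \<bullet> (u - u') = fst ?e \<bullet> (fst u - fst u') + snd ?e \<bullet> (snd u - snd u')"
    by (simp add: inner_prod_def)
  ultimately show ?thesis by linarith
qed

text \<open>Hoelder has to be applied blockwise: the \<lambda> block pairs noise of size 2 U with a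
  box of width D, the \<mu> block noise of size 2 D with a box of width U. A joint estimate would
  produce U^2.\<close>

lemma inner_noise_y:
  assumes "xbox x" "0 \<le> r" "r \<le> \<sigma>" "ybox v" "ybox v'"
  shows "\<bar>noise_y \<alpha> P rew \<eta> \<tau> x y (s, a, s', r, su, au) \<bullet> (v - v')\<bar> \<le> 4 * U * D"
proof -
  let ?e = "noise_y \<alpha> P rew \<eta> \<tau> x y (s, a, s', r, su, au)"
  have n: "norm1 (fst ?e) \<le> 2 * U" "norm1 (snd ?e) \<le> 2 * D"
    using norm1_grad_y[OF assms(1-3), of s a s' su au] norm1_lagr_grad_y[OF assms(1), of \<tau>] N_D_le_U
      norm1_diff[of "fst (grad_y \<alpha> x (s, a, s', r, su, au))" "fst (lagr_grad_y \<alpha> P rew \<tau> x)"]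
      norm1_diff[of "snd (grad_y \<alpha> x (s, a, s', r, su, au))" "snd (lagr_grad_y \<alpha> P rew \<tau> x)"]
    by (simp_all add: noise_y_eq)
  have "\<bar>fst ?e \<bullet> (fst v - fst v')\<bar> \<le> norm1 (fst ?e) * D" "\<bar>snd ?e \<bullet> (snd v - snd v')\<bar> \<le> norm1 (snd ?e) * U"
    using assms(4,5) by (intro abs_inner_le_norm1; auto simp: ybox_def intro!: abs_diff_le_box)+
  moreover have "norm1 (fst ?e) * D \<le> 2 * U * D" "norm1 (snd ?e) * U \<le> 2 * D * U"
    using n D_pos U_pos by (auto intro!: mult_right_mono)
  moreover have "?e \<bullet> (v - v') = fst ?e \<bullet> (fst v - fst v') + snd ?e \<bullet> (snd v - snd v')"
    by (simp add: inner_prod_def)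
  ultimately show ?thesis by (simp add: mult_ac)
qed

lemma xbox_diameter:
  assumes "xbox u" "xbox u'"
  shows "(norm (u - u'))\<^sup>2 \<le> 2 * N * D\<^sup>2"
proof -
  have "(norm (fst u - fst u'))\<^sup>2 \<le> real CARD('a \<times> 's) * D\<^sup>2" "(norm (snd u - snd u'))\<^sup>2 \<le> real CARD('s) * D\<^sup>2"
    using assms by (intro norm_box_le; auto simp: xbox_def intro!: abs_diff_le_box)+
  moreover have "real CARD('s) * D\<^sup>2 \<le> N * D\<^sup>2"
    unfolding N_eq using card_ge_1 by (intro mult_right_mono) (auto simp: mult_le_cancel_left1)
  moreover have "real CARD('a \<times> 's) = N"
    by (simp add: N_eq)
  moreover have "(norm (u - u'))\<^sup>2 = (norm (fst u - fst u'))\<^sup>2 + (norm (snd u - snd u'))\<^sup>2"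
    by (simp add: norm_prod_def)
  ultimately show ?thesis by (simp only:)
qed

lemma ybox_diameter:
  assumes "ybox v" "ybox v'"
  shows "(norm (v - v'))\<^sup>2 \<le> 2 * N * U\<^sup>2"
proof -
  have "(norm (fst v - fst v'))\<^sup>2 \<le> real CARD('a \<times> 's) * D\<^sup>2" "(norm (snd v - snd v'))\<^sup>2 \<le> real CARD('a \<times> 's) * U\<^sup>2"
    using assms by (intro norm_box_le; auto simp: ybox_def intro!: abs_diff_le_box)+
  moreover have "real CARD('a \<times> 's) * D\<^sup>2 \<le> real CARD('a \<times> 's) * U\<^sup>2"
    using D_le_U D_pos by (intro mult_left_mono power_mono) auto
  moreover have "real CARD('a \<times> 's) = N"
    by (simp add: N_eq)
  moreover have "(norm (v - v'))\<^sup>2 = (norm (fst v - fst v'))\<^sup>2 + (norm (snd v - snd v'))\<^sup>2"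
    by (simp add: norm_prod_def)
  ultimately show ?thesis by (simp only:)
qed

end

subsection \<open>The noise of a run\<close>

text \<open>\<open>matrix_inv\<close> chooses some two-sided inverse, so the diagonal candidate must
  also be shown to be the only one.\<close>

lemma matrix_inv_weight_matrix:
  assumes "\<And>i. pmf \<tau> i \<noteq> 0"
  shows "matrix_inv (weight_matrix \<tau>) = (\<chi> i j. if i = j then 1 / pmf \<tau> i else 0)"
proof -
  let ?W = "weight_matrix \<tau>" and ?D = "\<chi> i j. if i = j then 1 / pmf \<tau> i else 0"
  have inv: "?W ** ?D = mat 1" "?D ** ?W = mat 1"
    using assms by (auto simp: vec_eq_iff matrix_matrix_mult_def weight_matrix_def mat_def
      if_distrib[of "\<lambda>c. c * _"] if_distrib[of "\<lambda>c. _ * c"] simp del: split_paired_All cong: if_cong)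
  show ?thesis
    unfolding matrix_inv_def
  proof (rule some_equality)
    fix A assume "?W ** A = mat 1 \<and> A ** ?W = mat 1"
    then have "A ** (?W ** ?D) = ?D"
      by (simp only: matrix_mul_assoc matrix_mul_lid)
    then show "A = ?D"
      by (simp only: inv matrix_mul_rid)
  qed (simp only: inv simp_thms)
qed

text \<open>Testing the operator norm on a basis vector reads off one entry. This turns the
  assumption on inverse weight matrices into a drift bound for each state-action pair.\<close>

lemma diagonal_le_spectral_norm: "\<bar>B $ i $ i\<bar> \<le> spectral_norm B"
proof -
  have "(B *v axis i 1) $ i = B $ i $ i"
    by (simp add: matrix_vector_mult_basis column_def)
  then have "\<bar>B $ i $ i\<bar> \<le> norm (B *v axis i 1)"
    by (metis component_le_norm_cart)
  also have "\<dots> \<le> onorm (\<lambda>v. B *v v) * norm (axis i (1::real))"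
    by (rule onorm[OF matrix_vector_mul_bounded_linear])
  finally show ?thesis
    by (simp add: spectral_norm_def)
qed

text \<open>In the value series every term is a polynomial in the action probabilities, so a
  randomly chosen policy has a measurable value.\<close>

lemma borel_measurable_policy_value:
  fixes P :: "'a::finite \<Rightarrow> 's::finite \<Rightarrow> 's pmf" and \<pi> :: "'w \<Rightarrow> 's \<Rightarrow> 'a pmf"
  assumes mdp: "discounted_mdp \<alpha> \<sigma> rew"
    and \<pi> [measurable]: "\<And>s a. (\<lambda>\<omega>. pmf (\<pi> \<omega> s) a) \<in> borel_measurable M"
  shows "(\<lambda>\<omega>. policy_value \<alpha> P rew (\<pi> \<omega>) $ s) \<in> borel_measurable M"
proof -
  have [measurable]: "(\<lambda>\<omega>. policy_trans P (\<pi> \<omega>) s t) \<in> borel_measurable M" for s t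
    unfolding policy_trans_def by measurable
  have [measurable]: "(\<lambda>\<omega>. policy_reward P rew (\<pi> \<omega>) s) \<in> borel_measurable M" for s
    unfolding policy_reward_def by measurable
  have [measurable]: "(\<lambda>\<omega>. (transition_operator P (\<pi> \<omega>) ^^ n) (policy_reward P rew (\<pi> \<omega>)) s) \<in> borel_measurable M" for n s
  proof (induction n arbitrary: s)
    case (Suc n)
    note [measurable] = Suc
    show ?case
      unfolding funpow.simps comp_def
      unfolding apply_kernel_def[of _ "(transition_operator P (\<pi> _) ^^ n) (policy_reward P rew (\<pi> _))"]
      by measurable
  qed simp
  show ?thesis
    unfolding policy_value_series[OF mdp] by measurable
qed

text \<open>\<open>cond_mean_zero\<close> speaks of coordinates. Expanding the inner product in the
  basis lets the bounded \<open>G\<close>-measurable coordinates of \<open>w\<close> be pulled out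
  one by one.\<close>

lemma cond_exp_inner_zero:
  fixes f w :: "'w \<Rightarrow> 'v::euclidean_space"
  assumes M: "prob_space M" and f: "cond_mean_zero M G f"
    and w: "w \<in> borel_measurable G" "\<And>\<omega>. \<omega> \<in> space M \<Longrightarrow> norm (w \<omega>) \<le> B"
  shows "integrable M (\<lambda>\<omega>. f \<omega> \<bullet> w \<omega>)" "AE \<omega> in M. real_cond_exp M G (\<lambda>\<omega>. f \<omega> \<bullet> w \<omega>) \<omega> = 0"
proof -
  interpret prob_space M by (rule M)
  have sub: "subalgebra M G" and int: "integrable M f"
    and zero: "\<And>b. b \<in> Basis \<Longrightarrow> AE \<omega> in M. real_cond_exp M G (\<lambda>\<omega>. f \<omega> \<bullet> b) \<omega> = 0"
    using f by (auto simp: cond_mean_zero_def)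
  interpret finite_measure_subalgebra M G
    by unfold_locales (rule sub)
  have wM: "w \<in> borel_measurable M"
    by (rule measurable_from_subalg[OF sub w(1)])
  note [measurable] = wM w(1) borel_measurable_integrable[OF int]
  have int_b: "integrable M (\<lambda>\<omega>. (w \<omega> \<bullet> b) * (f \<omega> \<bullet> b))" for b
  proof (rule Bochner_Integration.integrable_bound)
    show "integrable M (\<lambda>\<omega>. (B * norm b) * (f \<omega> \<bullet> b))"
      using int by simp
    show "AE \<omega> in M. norm ((w \<omega> \<bullet> b) * (f \<omega> \<bullet> b)) \<le> norm ((B * norm b) * (f \<omega> \<bullet> b))"
    proof (rule AE_I2)
      fix \<omega> assume \<omega>: "\<omega> \<in> space M"
      have "\<bar>w \<omega> \<bullet> b\<bar> \<le> norm (w \<omega>) * norm b"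
        by (rule Cauchy_Schwarz_ineq2)
      also have "\<dots> \<le> B * norm b"
        by (intro mult_right_mono w \<omega>) simp
      finally show "norm ((w \<omega> \<bullet> b) * (f \<omega> \<bullet> b)) \<le> norm ((B * norm b) * (f \<omega> \<bullet> b))"
        unfolding real_norm_def abs_mult[of "w \<omega> \<bullet> b"] abs_mult[of "B * norm b"] by (intro mult_right_mono) auto
    qed
  qed measurable
  have eq: "(\<lambda>\<omega>. f \<omega> \<bullet> w \<omega>) = (\<lambda>\<omega>. \<Sum>b\<in>Basis. (w \<omega> \<bullet> b) * (f \<omega> \<bullet> b))"
    by (subst euclidean_inner) (simp add: mult.commute)
  show "integrable M (\<lambda>\<omega>. f \<omega> \<bullet> w \<omega>)"
    unfolding eq using int_b by simp
  have "AE \<omega> in M. real_cond_exp M G (\<lambda>\<omega>. \<Sum>b\<in>Basis. (w \<omega> \<bullet> b) * (f \<omega> \<bullet> b)) \<omega> =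
      (\<Sum>b\<in>Basis. real_cond_exp M G (\<lambda>\<omega>. (w \<omega> \<bullet> b) * (f \<omega> \<bullet> b)) \<omega>)"
    by (rule real_cond_exp_sum[OF int_b])
  moreover have "AE \<omega> in M. \<forall>b\<in>Basis. real_cond_exp M G (\<lambda>\<omega>. (w \<omega> \<bullet> b) * (f \<omega> \<bullet> b)) \<omega> = 0"
  proof (rule AE_finite_allI[OF finite_Basis])
    fix b :: 'v assume b: "b \<in> Basis"
    have "AE \<omega> in M. real_cond_exp M G (\<lambda>\<omega>. (w \<omega> \<bullet> b) * (f \<omega> \<bullet> b)) \<omega> = (w \<omega> \<bullet> b) * real_cond_exp M G (\<lambda>\<omega>. f \<omega> \<bullet> b) \<omega>"
      by (rule real_cond_exp_mult[OF _ _ int_b]) measurable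
    with zero[OF b] show "AE \<omega> in M. real_cond_exp M G (\<lambda>\<omega>. (w \<omega> \<bullet> b) * (f \<omega> \<bullet> b)) \<omega> = 0"
      by eventually_elim simp
  qed
  ultimately show "AE \<omega> in M. real_cond_exp M G (\<lambda>\<omega>. f \<omega> \<bullet> w \<omega>) \<omega> = 0"
    unfolding eq by eventually_elim simp
qed

section \<open>A fixed run: comparison points, shadow sequence, martingale differences\<close>

text \<open>The average uses the iterates 0 to T - 1, so \<open>T_ge_2\<close> ensures that at least
  one projected dual iterate enters it and the dual policy is well defined.\<close>

locale spd_run = spd_bounds P rew \<alpha> \<sigma> \<zeta> D U N \<eta>
  for P :: "'a::finite \<Rightarrow> 's::finite \<Rightarrow> 's pmf" and rew \<alpha> \<sigma> \<zeta> D U N \<eta> +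
  fixes \<tau> :: "nat \<Rightarrow> ('a \<times> 's) pmf" and \<gamma>\<^sub>0 \<beta>\<^sub>0 :: real and T :: nat
    and M :: "'w measure" and F :: "nat \<Rightarrow> 'w measure" and smp :: "nat \<Rightarrow> 'w \<Rightarrow> ('s, 'a) sample"
    and x :: "nat \<Rightarrow> 'w \<Rightarrow> (real^('a \<times> 's)) \<times> (real^'s)"
    and y :: "nat \<Rightarrow> 'w \<Rightarrow> (real^('a \<times> 's)) \<times> (real^('a \<times> 's))"
  assumes environment: "state_action_distributions P \<zeta> (\<lambda>k. \<beta>\<^sub>0 / (real k + 1)) \<tau>"
    and run: "spd_q_learning M F \<alpha> \<sigma> P rew \<eta> \<zeta> \<tau> (\<lambda>k. \<gamma>\<^sub>0 / sqrt (real k + 1)) T smp x y"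
    and \<gamma>\<^sub>0_pos: "0 < \<gamma>\<^sub>0" and \<beta>\<^sub>0_pos: "0 < \<beta>\<^sub>0" and T_ge_2: "2 \<le> T"
begin

lemma \<tau>_ge: "\<zeta> \<le> pmf (\<tau> k) i"
  using environment unfolding state_action_distributions_def by blast

lemma \<tau>_pos: "0 < pmf (\<tau> k) i"
  using \<tau>_ge[of k i] \<zeta>_pos by simp

lemma inverse_\<tau>_diff: "\<bar>1 / pmf (\<tau> k) i - 1 / pmf (\<tau> (Suc k)) i\<bar> \<le> \<beta>\<^sub>0 / (real k + 1)"
proof -
  let ?B = "matrix_inv (weight_matrix (\<tau> k)) - matrix_inv (weight_matrix (\<tau> (Suc k)))"
  have "?B $ i $ i = 1 / pmf (\<tau> k) i - 1 / pmf (\<tau> (Suc k)) i"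
    using \<tau>_pos by (simp add: matrix_inv_weight_matrix less_imp_neq[symmetric])
  moreover have "spectral_norm ?B \<le> \<beta>\<^sub>0 / (real k + 1)"
    using environment unfolding state_action_distributions_def by blast
  ultimately show ?thesis
    using diagonal_le_spectral_norm[of ?B i] by simp
qed

text \<open>One \<open>lam\<close> has to serve all \<open>k\<close>: consecutive comparison points
  then differ only through the weights, whose drift is controlled.\<close>

definition admissible_dual :: "real^('a \<times> 's) \<Rightarrow> bool" where
  "admissible_dual lam \<longleftrightarrow>
     (\<forall>k. (lam, \<chi> i. lam $ i / pmf (\<tau> k) i) \<in> Y_set \<alpha> \<zeta> \<eta>) \<and>
     (\<forall>k z. Lagrangian \<alpha> P rew \<eta> (weight_matrix (\<tau> k)) z (lam, \<chi> i. lam $ i / pmf (\<tau> k) i)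
        = \<eta> \<bullet> optimal_value \<alpha> P rew)"

text \<open>The occupancy measure of an optimal policy, split over actions. Its state marginal
  dominates \<eta>, which is membership in \<Xi>; its entries are at most D because \<eta> sums to
  \<sigma>, and dividing by weights of at least \<zeta> gives U.\<close>

lemma exists_admissible_dual: "\<exists>lam. admissible_dual lam"
proof -
  obtain \<pi> where \<pi>: "optimal_value \<alpha> P rew = policy_value \<alpha> P rew \<pi>"
    using optimal_value_attained[OF mdp] by metis
  obtain \<rho> where balance: "\<And>t. \<rho> t = \<eta> $ t + \<alpha> * (\<Sum>s\<in>UNIV. \<rho> s * policy_trans P \<pi> s t)"
    and ge: "\<And>t. \<eta> $ t \<le> \<rho> t" and le: "\<And>t. \<rho> t \<le> (\<Sum>s\<in>UNIV. \<eta> $ s) / (1 - \<alpha>)"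
    using exists_occupancy[OF mdp, of "\<lambda>s. \<eta> $ s" P \<pi>] \<eta>_bounds(1) by metis
  have \<rho>: "0 \<le> \<rho> s" "\<rho> s \<le> D" for s
    using ge[of s] \<eta>_bounds(1)[of s] le[of s] by (simp_all add: \<eta>_eq D_eq)
  define lam where "lam = (\<chi> i. \<rho> (snd i) * pmf (\<pi> (snd i)) (fst i))"
  have lam: "lam $ (a, s) = \<rho> s * pmf (\<pi> s) a" for a s
    by (simp add: lam_def)
  have bounds: "0 \<le> lam $ i" "lam $ i \<le> D" for i
  proof -
    show "0 \<le> lam $ i"
      using \<rho> by (simp add: lam_def)
    have "\<rho> (snd i) * pmf (\<pi> (snd i)) (fst i) \<le> D * 1"
      using \<rho> D_pos by (intro mult_mono pmf_le_1) auto
    then show "lam $ i \<le> D" by (simp add: lam_def)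
  qed
  have mu: "0 \<le> lam $ i / pmf (\<tau> k) i" "lam $ i / pmf (\<tau> k) i \<le> U" for i k
    using bounds[of i] \<tau>_pos[of k i] \<tau>_ge[of k i] \<zeta>_pos D_pos unfolding U_eq by (auto intro: frac_le)
  have Xi: "lam \<in> Xi_set \<eta>"
    using ge by (simp add: Xi_set_def lam sum_distrib_left[symmetric] sum_pmf_eq_1)
  have "(lam, \<chi> i. lam $ i / pmf (\<tau> k) i) \<in> Y_set \<alpha> \<zeta> \<eta>" for k
    unfolding Y_set_iff ybox_def fst_conv snd_conv using bounds mu Xi by simp
  moreover have "Lagrangian \<alpha> P rew \<eta> (weight_matrix (\<tau> k)) z (lam, \<chi> i. lam $ i / pmf (\<tau> k) i)
      = \<eta> \<bullet> optimal_value \<alpha> P rew" for k z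
    using \<tau>_pos[of k] unfolding \<pi>
    by (cases z, simp only:) (rule Lagrangian_occupancy[OF mdp balance lam], simp add: less_imp_neq[symmetric])
  ultimately show ?thesis
    unfolding admissible_dual_def by blast
qed

definition opt_dual :: "nat \<Rightarrow> (real^('a \<times> 's)) \<times> (real^('a \<times> 's))" where
  "opt_dual k = ((SOME lam. admissible_dual lam), \<chi> i. (SOME lam. admissible_dual lam) $ i / pmf (\<tau> k) i)"

lemma opt_dual_in_Y_set: "opt_dual k \<in> Y_set \<alpha> \<zeta> \<eta>"
  and Lagrangian_opt_dual: "Lagrangian \<alpha> P rew \<eta> (weight_matrix (\<tau> k)) z (opt_dual k) = \<eta> \<bullet> optimal_value \<alpha> P rew"
  using someI_ex[OF exists_admissible_dual] unfolding opt_dual_def admissible_dual_def[of "SOME lam. _ lam"] by blast+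

lemma opt_dual_box: "ybox (opt_dual k)"
  using opt_dual_in_Y_set Y_set_iff by blast

text \<open>Only the \<mu> part moves. Each of the N entries changes by at most D
  \<open>\<beta>\<^sub>0\<close>/(k+1), and factoring the difference of squares contributes a second
  factor of at most 2 U.\<close>

lemma opt_dual_drift:
  assumes "ybox v"
  shows "(norm (v - opt_dual (Suc k)))\<^sup>2 \<le> (norm (v - opt_dual k))\<^sup>2 + (2 * \<beta>\<^sub>0 * N * D * U) / (real k + 1)"
proof -
  let ?a = "snd (opt_dual k)" and ?b = "snd (opt_dual (Suc k))"
  have snd: "(norm w)\<^sup>2 = (\<Sum>i\<in>UNIV. (w $ i)\<^sup>2)" for w :: "real^('a \<times> 's)"
    by (simp add: norm_vec_def L2_set_def sum_nonneg)
  have "(norm (snd v - ?b))\<^sup>2 - (norm (snd v - ?a))\<^sup>2 = (\<Sum>i\<in>UNIV. (snd v $ i - ?b $ i)\<^sup>2 - (snd v $ i - ?a $ i)\<^sup>2)"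
    by (simp add: snd sum_subtractf)
  also have "\<dots> \<le> (\<Sum>i\<in>(UNIV::('a \<times> 's) set). 2 * \<beta>\<^sub>0 * D * U / (real k + 1))"
  proof (rule sum_mono)
    fix i :: "'a \<times> 's"
    let ?l = "fst (opt_dual k) $ i"
    have l: "0 \<le> ?l" "?l \<le> D"
      using yboxD(1,2)[OF opt_dual_box] by auto
    have mu: "0 \<le> ?a $ i" "?a $ i \<le> U" "0 \<le> ?b $ i" "?b $ i \<le> U" "0 \<le> snd v $ i" "snd v $ i \<le> U"
      using yboxD(3,4)[OF opt_dual_box] yboxD(3,4)[OF assms] by auto
    have "?a $ i - ?b $ i = ?l * (1 / pmf (\<tau> k) i - 1 / pmf (\<tau> (Suc k)) i)"
      by (simp add: opt_dual_def right_diff_distrib)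
    then have "\<bar>?a $ i - ?b $ i\<bar> = ?l * \<bar>1 / pmf (\<tau> k) i - 1 / pmf (\<tau> (Suc k)) i\<bar>"
      using l by (simp add: abs_mult)
    also have "\<dots> \<le> D * (\<beta>\<^sub>0 / (real k + 1))"
      using l D_pos inverse_\<tau>_diff by (intro mult_mono) auto
    finally have diff: "\<bar>?a $ i - ?b $ i\<bar> \<le> D * (\<beta>\<^sub>0 / (real k + 1))" .
    have "(snd v $ i - ?b $ i)\<^sup>2 - (snd v $ i - ?a $ i)\<^sup>2 = (?a $ i - ?b $ i) * (2 * snd v $ i - ?a $ i - ?b $ i)"
      by (simp add: power2_eq_square algebra_simps)
    also have "\<dots> \<le> \<bar>?a $ i - ?b $ i\<bar> * \<bar>2 * snd v $ i - ?a $ i - ?b $ i\<bar>"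
      by (simp flip: abs_mult)
    also have "\<dots> \<le> D * (\<beta>\<^sub>0 / (real k + 1)) * (2 * U)"
      using diff mu D_pos \<beta>\<^sub>0_pos by (intro mult_mono) auto
    finally show "(snd v $ i - ?b $ i)\<^sup>2 - (snd v $ i - ?a $ i)\<^sup>2 \<le> 2 * \<beta>\<^sub>0 * D * U / (real k + 1)"
      by (simp add: mult_ac)
  qed
  also have "\<dots> = (2 * \<beta>\<^sub>0 * N * D * U) / (real k + 1)"
    by (simp add: N_eq mult_ac)
  finally have "(norm (snd v - ?b))\<^sup>2 \<le> (norm (snd v - ?a))\<^sup>2 + (2 * \<beta>\<^sub>0 * N * D * U) / (real k + 1)"
    by simp
  moreover have "fst (opt_dual (Suc k)) = fst (opt_dual k)"
    by (simp add: opt_dual_def)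
  ultimately show ?thesis
    by (simp add: norm_prod_def)
qed

lemma prob_space_M: "prob_space M"
  and filtration_F: "filtration (space M) F"
  and initial: "\<omega> \<in> space M \<Longrightarrow>
        (\<forall>i. fst (x 0 \<omega>) $ i \<in> {0..\<sigma> / (1 - \<alpha>)}) \<and>
        (\<forall>s. snd (x 0 \<omega>) $ s \<in> {0..\<sigma> / (1 - \<alpha>)}) \<and>
        (\<forall>i. fst (y 0 \<omega>) $ i \<in> {0..norm1 \<eta> / (1 - \<alpha>)}) \<and>
        (\<forall>i. snd (y 0 \<omega>) $ i \<in> {0..norm1 \<eta> / (\<zeta> * (1 - \<alpha>))})"
  and step_x: "k < T \<Longrightarrow> \<omega> \<in> space M \<Longrightarrow> x (Suc k) \<omega> =
        closest_point (X_set \<alpha> \<sigma>) (x k \<omega> - (\<gamma>\<^sub>0 / sqrt (real k + 1)) *\<^sub>R grad_x \<alpha> \<eta> (y k \<omega>) (smp k \<omega>))"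
  and step_y: "k < T \<Longrightarrow> \<omega> \<in> space M \<Longrightarrow> y (Suc k) \<omega> =
        closest_point (Y_set \<alpha> \<zeta> \<eta>) (y k \<omega> + (\<gamma>\<^sub>0 / sqrt (real k + 1)) *\<^sub>R grad_y \<alpha> (x k \<omega>) (smp k \<omega>))"
  and sample_law: "k < T \<Longrightarrow> has_sample_law M P rew (\<tau> k) (smp k)"
  and adapted: "k < T \<Longrightarrow> x k \<in> borel_measurable (F k)" "k < T \<Longrightarrow> y k \<in> borel_measurable (F k)"
  using run unfolding spd_q_learning_def by blast+

definition noise_x_at :: "nat \<Rightarrow> 'w \<Rightarrow> (real^('a \<times> 's)) \<times> (real^'s)" where
  "noise_x_at k \<omega> = noise_x \<alpha> P rew \<eta> (\<tau> k) (x k \<omega>) (y k \<omega>) (smp k \<omega>)"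

definition noise_y_at :: "nat \<Rightarrow> 'w \<Rightarrow> (real^('a \<times> 's)) \<times> (real^('a \<times> 's))" where
  "noise_y_at k \<omega> = noise_y \<alpha> P rew \<eta> (\<tau> k) (x k \<omega>) (y k \<omega>) (smp k \<omega>)"

lemma noise_at:
  assumes "k < T"
  shows "noise_x_at k \<in> borel_measurable (F (Suc k))" "cond_mean_zero M (F k) (noise_x_at k)"
    "noise_y_at k \<in> borel_measurable (F (Suc k))" "cond_mean_zero M (F k) (noise_y_at k)"
  using run assms unfolding spd_q_learning_def Let_def noise_x_at_def[abs_def] noise_y_at_def[abs_def] by blast+

lemma zero_in_X_set: "(0 :: (real^('a \<times> 's)) \<times> (real^'s)) \<in> X_set \<alpha> \<sigma>"
  unfolding X_set_iff xbox_def using D_pos by simp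

lemma closest_point_X_set:
  fixes z :: "(real^('a \<times> 's)) \<times> (real^'s)"
  shows "xbox (closest_point (X_set \<alpha> \<sigma>) z)"
  unfolding X_set_iff[symmetric] using zero_in_X_set by (intro closest_point_in_set convex_closed_X_set) blast

lemma x_box: "k \<le> T \<Longrightarrow> \<omega> \<in> space M \<Longrightarrow> xbox (x k \<omega>)"
proof (cases k)
  case 0
  assume "\<omega> \<in> space M"
  from initial[OF this] show ?thesis
    unfolding 0 xbox_def D_eq[symmetric] by auto
next
  case (Suc j)
  assume "k \<le> T" "\<omega> \<in> space M"
  then show ?thesis
    by (simp add: Suc step_x closest_point_X_set)
qed

lemma Suc_y_in_Y_set: "k < T \<Longrightarrow> \<omega> \<in> space M \<Longrightarrow> y (Suc k) \<omega> \<in> Y_set \<alpha> \<zeta> \<eta>"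
  using closest_point_in_set[OF convex_closed_Y_set(2)] opt_dual_in_Y_set by (subst step_y) blast+

lemma y_box: "k \<le> T \<Longrightarrow> \<omega> \<in> space M \<Longrightarrow> ybox (y k \<omega>)"
proof (cases k)
  case 0
  assume "\<omega> \<in> space M"
  moreover have "\<sigma> / (\<zeta> * (1 - \<alpha>)) = U"
    by (simp add: U_eq D_eq mult.commute)
  ultimately show ?thesis
    using initial[of \<omega>] unfolding 0 ybox_def norm1_\<eta> D_eq[symmetric] by auto
next
  case (Suc j)
  assume "k \<le> T" "\<omega> \<in> space M"
  then show ?thesis
    using Suc_y_in_Y_set[of j \<omega>] Y_set_iff by (simp add: Suc)
qed

text \<open>Steps go along the noise with positive sign, as the regret bound for the negative
  pairing requires. Halving the step turns the noise bound 32 U^2 into a contribution of 16 U^2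
  \<open>\<gamma>\<^sub>0\<close>, at the price of doubling the diameter term.\<close>

primrec shadow :: "nat \<Rightarrow> 'w \<Rightarrow> (real^('a \<times> 's)) \<times> (real^'s)" where
  "shadow 0 \<omega> = 0"
| "shadow (Suc k) \<omega> = closest_point (X_set \<alpha> \<sigma>) (shadow k \<omega> + ((\<gamma>\<^sub>0 / 2) / sqrt (real k + 1)) *\<^sub>R noise_x_at k \<omega>)"

lemma shadow_box: "xbox (shadow k \<omega>)"
proof (cases k)
  case 0
  then show ?thesis
    using zero_in_X_set unfolding X_set_iff by simp
next
  case (Suc j)
  then show ?thesis
    by (simp add: closest_point_X_set)
qed

text \<open>The dual noise is paired with the iterate directly: \<open>opt_dual\<close> is
  deterministic, so no shadow sequence is needed on that side.\<close>

definition increment :: "nat \<Rightarrow> 'w \<Rightarrow> real" where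
  "increment k \<omega> = noise_x_at k \<omega> \<bullet> (shadow k \<omega> - x k \<omega>) + noise_y_at k \<omega> \<bullet> (y k \<omega> - opt_dual k)"

text \<open>Collects the null sets of all steps, so that the estimates below can be made at one
  sample point.\<close>

definition rewards_bounded :: "'w \<Rightarrow> bool" where
  "rewards_bounded \<omega> \<longleftrightarrow> (\<forall>k<T. \<forall>s a s' r su au. smp k \<omega> = (s, a, s', r, su, au) \<longrightarrow> 0 \<le> r \<and> r \<le> \<sigma>)"

lemma AE_rewards_bounded: "AE \<omega> in M. rewards_bounded \<omega>"
proof -
  have "AE \<omega> in M. \<forall>k\<in>{..<T}. \<forall>s a s' r su au. smp k \<omega> = (s, a, s', r, su, au) \<longrightarrow> 0 \<le> r \<and> r \<le> \<sigma>"
    using AE_sample_reward[OF mdp prob_space_M sample_law] by (intro AE_finite_allI) auto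
  then show ?thesis
    unfolding rewards_bounded_def by eventually_elim blast
qed

lemma abs_increment_le:
  assumes "k < T" "\<omega> \<in> space M" "rewards_bounded \<omega>"
  shows "\<bar>increment k \<omega>\<bar> \<le> 12 * U * D"
proof -
  obtain s a s' r su au where z: "smp k \<omega> = (s, a, s', r, su, au)" by (cases "smp k \<omega>") auto
  then have r: "0 \<le> r" "r \<le> \<sigma>"
    using assms by (auto simp: rewards_bounded_def)
  have "\<bar>noise_x_at k \<omega> \<bullet> (shadow k \<omega> - x k \<omega>)\<bar> \<le> 8 * U * D"
    unfolding noise_x_at_def using assms by (intro inner_noise_x y_box x_box shadow_box) auto
  moreover have "\<bar>noise_y_at k \<omega> \<bullet> (y k \<omega> - opt_dual k)\<bar> \<le> 4 * U * D"
    unfolding noise_y_at_def z using assms r by (intro inner_noise_y y_box x_box opt_dual_box) auto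
  ultimately show ?thesis
    unfolding increment_def by linarith
qed

lemma subalgebra_F: "k < T \<Longrightarrow> subalgebra M (F k)"
  using noise_at(2)[of k] by (simp add: cond_mean_zero_def)

lemma measurable_F_mono:
  assumes "f \<in> borel_measurable (F i)" "i \<le> j"
  shows "f \<in> borel_measurable (F j)"
proof (rule measurable_from_subalg[OF _ assms(1)])
  show "subalgebra (F j) (F i)"
    using filtration.space_F[OF filtration_F] filtration.sets_F_mono[OF filtration_F assms(2)]
    by (auto simp: subalgebra_def)
qed

text \<open>The projection is continuous and \<open>shadow k\<close> uses only the noise before step
  \<open>k\<close>, so it is known before the sample of step \<open>k\<close> is drawn. This is what
  the comparison point of the primal regret lacks.\<close>

lemma measurable_shadow: "k \<le> T \<Longrightarrow> shadow k \<in> borel_measurable (F k)"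
proof (induction k)
  case (Suc k)
  have [measurable]: "closest_point (X_set \<alpha> \<sigma>) \<in> borel_measurable (borel :: ((real^('a \<times> 's)) \<times> (real^'s)) measure)"
    using zero_in_X_set
    by (intro borel_measurable_continuous_onI continuous_on_closest_point convex_closed_X_set) blast
  have [measurable]: "shadow k \<in> borel_measurable (F (Suc k))"
    by (rule measurable_F_mono[of _ k]) (use Suc in auto)
  have [measurable]: "noise_x_at k \<in> borel_measurable (F (Suc k))"
    by (rule noise_at) (use Suc in auto)
  show ?case
    unfolding shadow.simps[abs_def] by measurable
qed (simp add: shadow.simps[abs_def])

lemma measurable_increment:
  assumes "k < T"
  shows "increment k \<in> borel_measurable (F (Suc k))" "increment k \<in> borel_measurable M"
proof -
  note k = assms
  show "increment k \<in> borel_measurable (F (Suc k))"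
  proof -
    have [measurable]: "shadow k \<in> borel_measurable (F (Suc k))" "x k \<in> borel_measurable (F (Suc k))"
      "y k \<in> borel_measurable (F (Suc k))"
      using k by (auto intro!: measurable_F_mono[of _ k "Suc k"] measurable_shadow adapted)
    note [measurable] = noise_at(1,3)[OF k]
    show ?thesis unfolding increment_def[abs_def] by measurable
  qed
  \<comment> \<open>For k = T - 1 the algebra \<open>F (Suc k)\<close> is not known to lie inside
    that of \<open>M\<close>, so measurability is taken from \<open>F k\<close> and from the
    integrability of the noise.\<close>
  have [measurable]: "shadow k \<in> borel_measurable M" "x k \<in> borel_measurable M" "y k \<in> borel_measurable M"
    using k by (auto intro!: measurable_from_subalg[OF subalgebra_F[OF k]] measurable_shadow adapted)
  have [measurable]: "noise_x_at k \<in> borel_measurable M" "noise_y_at k \<in> borel_measurable M"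
    using noise_at(2,4)[OF k] by (auto simp: cond_mean_zero_def)
  show "increment k \<in> borel_measurable M"
    unfolding increment_def[abs_def] by measurable
qed

text \<open>Both noises are paired with vectors that are \<open>F k\<close>-measurable and bounded
  by the diameters of the boxes.\<close>

lemma cond_exp_increment:
  assumes k: "k < T"
  shows "AE \<omega> in M. real_cond_exp M (F k) (increment k) \<omega> = 0"
proof -
  interpret prob_space M by (rule prob_space_M)
  interpret finite_measure_subalgebra M "F k"
    by unfold_locales (rule subalgebra_F[OF k])
  note [measurable] = adapted[OF k]
  have [measurable]: "shadow k \<in> borel_measurable (F k)"
    using k by (simp add: measurable_shadow)
  let ?v = "\<lambda>\<omega>. shadow k \<omega> - x k \<omega>" and ?w = "\<lambda>\<omega>. y k \<omega> - opt_dual k"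
  have vm: "?v \<in> borel_measurable (F k)" and wm: "?w \<in> borel_measurable (F k)"
    by measurable
  have v: "norm (?v \<omega>) \<le> sqrt (2 * N * D\<^sup>2)" and w: "norm (?w \<omega>) \<le> sqrt (2 * N * U\<^sup>2)" if "\<omega> \<in> space M" for \<omega>
    using xbox_diameter[OF shadow_box x_box, of k \<omega> k] ybox_diameter[OF y_box opt_dual_box, of k \<omega> k] k that
    by (auto intro: real_le_rsqrt)
  have cx: "integrable M (\<lambda>\<omega>. noise_x_at k \<omega> \<bullet> ?v \<omega>)"
      "AE \<omega> in M. real_cond_exp M (F k) (\<lambda>\<omega>. noise_x_at k \<omega> \<bullet> ?v \<omega>) \<omega> = 0"
    by (rule cond_exp_inner_zero[OF prob_space_M noise_at(2)[OF k] vm], erule v)+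
  have cy: "integrable M (\<lambda>\<omega>. noise_y_at k \<omega> \<bullet> ?w \<omega>)"
      "AE \<omega> in M. real_cond_exp M (F k) (\<lambda>\<omega>. noise_y_at k \<omega> \<bullet> ?w \<omega>) \<omega> = 0"
    by (rule cond_exp_inner_zero[OF prob_space_M noise_at(4)[OF k] wm], erule w)+
  have "AE \<omega> in M. real_cond_exp M (F k) (increment k) \<omega> =
      real_cond_exp M (F k) (\<lambda>\<omega>. noise_x_at k \<omega> \<bullet> ?v \<omega>) \<omega> + real_cond_exp M (F k) (\<lambda>\<omega>. noise_y_at k \<omega> \<bullet> ?w \<omega>) \<omega>"
    unfolding increment_def[abs_def] by (rule real_cond_exp_add[OF cx(1) cy(1)])
  with cx(2) cy(2) show ?thesis
    by eventually_elim simp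
qed

sublocale increments: bounded_martingale_differences M F increment T "12 * U * D"
proof (intro bounded_martingale_differences.intro bounded_martingale_differences_axioms.intro)
  show "0 < 12 * U * D"
    using U_pos D_pos by simp
  show "(\<lambda>\<omega>. \<Sum>j<k. increment j \<omega>) \<in> borel_measurable (F k)" if "k < T" for k
    using that by (intro borel_measurable_sum measurable_F_mono[OF measurable_increment(1)]) auto
  show "AE \<omega> in M. \<bar>increment k \<omega>\<bar> \<le> 12 * U * D" if "k < T" for k
    using AE_rewards_bounded AE_space by eventually_elim (rule abs_increment_le[OF that])
qed (fact prob_space_M subalgebra_F measurable_increment(2) cond_exp_increment)+

end

subsection \<open>The optimality gap\<close>

context spd_run
begin

abbreviation avg_policy :: "'w \<Rightarrow> 's \<Rightarrow> 'a pmf" where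
  "avg_policy \<omega> \<equiv> dual_policy (dual_average T y \<omega>)"

lemma dual_average_nth: "dual_average T y \<omega> $ i = (\<Sum>k<T. fst (y k \<omega>) $ i) / real T"
  by (simp add: dual_average_def)

lemma dual_average_nonneg: "\<omega> \<in> space M \<Longrightarrow> 0 \<le> dual_average T y \<omega> $ i"
  unfolding dual_average_nth by (intro divide_nonneg_nonneg sum_nonneg yboxD(1)[OF y_box]) auto

text \<open>The initial dual iterate need not lie in \<open>\<Xi>\<close>; all later ones do.\<close>

lemma dual_average_sum_pos:
  assumes "\<omega> \<in> space M"
  shows "0 < (\<Sum>a\<in>UNIV. dual_average T y \<omega> $ (a, s))"
proof -
  have "y (Suc 0) \<omega> \<in> Y_set \<alpha> \<zeta> \<eta>"
    using T_ge_2 assms by (intro Suc_y_in_Y_set) auto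
  then have "fst (y (Suc 0) \<omega>) \<in> Xi_set \<eta>"
    using Y_set_iff by blast
  then have "\<eta> $ s \<le> (\<Sum>a\<in>UNIV. fst (y (Suc 0) \<omega>) $ (a, s))"
    by (simp add: Xi_set_def)
  moreover have "0 < \<eta> $ s"
    using \<sigma> by (simp add: \<eta>_eq)
  ultimately have "0 < (\<Sum>a\<in>UNIV. fst (y (Suc 0) \<omega>) $ (a, s))"
    by simp
  also have "\<dots> \<le> (\<Sum>a\<in>UNIV. \<Sum>k<T. fst (y k \<omega>) $ (a, s))"
    using T_ge_2 assms by (intro sum_mono member_le_sum yboxD(1)[OF y_box]) auto
  finally show ?thesis
    unfolding dual_average_nth sum_divide_distrib[symmetric] using T_ge_2 by simp
qed

lemma pmf_avg_policy:
  assumes "\<omega> \<in> space M"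
  shows "pmf (avg_policy \<omega> s) a = dual_average T y \<omega> $ (a, s) / (\<Sum>a'\<in>UNIV. dual_average T y \<omega> $ (a', s))"
  by (rule pmf_dual_policy[OF dual_average_nonneg dual_average_sum_pos]) (use assms in auto)

lemma measurable_avg_policy_value:
  "(\<lambda>\<omega>. policy_value \<alpha> P rew (avg_policy \<omega>) $ s) \<in> borel_measurable M"
proof (rule borel_measurable_policy_value[OF mdp])
  fix s a
  have "(\<lambda>\<omega>. fst (y k \<omega>) $ i) \<in> borel_measurable M" if "k < T" for k i
  proof -
    have [measurable]: "y k \<in> borel_measurable M"
      by (rule measurable_from_subalg[OF subalgebra_F[OF that] adapted(2)[OF that]])
    have "continuous_on UNIV (\<lambda>v::(real^('a \<times> 's)) \<times> (real^('a \<times> 's)). fst v $ i)"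
      by (intro continuous_intros)
    then have "(\<lambda>v::(real^('a \<times> 's)) \<times> (real^('a \<times> 's)). fst v $ i) \<in> borel_measurable borel"
      by (rule borel_measurable_continuous_onI)
    then show ?thesis by measurable
  qed
  then have [measurable]: "(\<lambda>\<omega>. dual_average T y \<omega> $ i) \<in> borel_measurable M" for i
    unfolding dual_average_nth by (intro borel_measurable_divide borel_measurable_sum) auto
  have "(\<lambda>\<omega>. dual_average T y \<omega> $ (a, s) / (\<Sum>a'\<in>UNIV. dual_average T y \<omega> $ (a', s))) \<in> borel_measurable M"
    by measurable
  then show "(\<lambda>\<omega>. pmf (avg_policy \<omega> s) a) \<in> borel_measurable M"
    by (subst measurable_cong[OF pmf_avg_policy])
qed

text \<open>The three square-root terms are, in this order, the regrets of the primal iterates, of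
  the shadow sequence and of the dual iterates. Beyond them only the sum of increments is left for
  probability.\<close>

lemma duality_gap_bound:
  assumes \<omega>: "\<omega> \<in> space M" and rewards: "rewards_bounded \<omega>"
  shows "real T * (\<eta> \<bullet> (optimal_value \<alpha> P rew - policy_value \<alpha> P rew (avg_policy \<omega>))) \<le>
    sqrt (real T) * (N * D\<^sup>2 / \<gamma>\<^sub>0 + 8 * U\<^sup>2 * \<gamma>\<^sub>0)
    + sqrt (real T) * (2 * N * D\<^sup>2 / \<gamma>\<^sub>0 + 16 * U\<^sup>2 * \<gamma>\<^sub>0)
    + sqrt (real T) * (N * U\<^sup>2 / \<gamma>\<^sub>0 + 2 * U\<^sup>2 * \<gamma>\<^sub>0 + 2 * \<beta>\<^sub>0 * N * D * U / \<gamma>\<^sub>0)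
    + (\<Sum>k<T. increment k \<omega>)"
proof -
  define V where "V = policy_value \<alpha> P rew (avg_policy \<omega>)"
  define Q where "Q = action_value \<alpha> P rew V"
  define gx where "gx k = grad_x \<alpha> \<eta> (y k \<omega>) (smp k \<omega>)" for k
  define gy where "gy k = grad_y \<alpha> (x k \<omega>) (smp k \<omega>)" for k
  define e where "e k = noise_x_at k \<omega>" for k
  define f where "f k = noise_y_at k \<omega>" for k
  define adv where "adv k = (\<Sum>i\<in>UNIV. fst (y k \<omega>) $ i * (Q $ i - V $ (snd i)))" for k
  have V: "0 \<le> V $ s" "V $ s \<le> D" for s
    using policy_value_bounds[OF mdp] by (auto simp: V_def D_eq)
  have Q: "0 \<le> Q $ i" "Q $ i \<le> D" for i
    using action_value_bounds[OF mdp, of V P i] V by (auto simp: Q_def D_eq)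
  have xs: "xbox (Q, V)"
    unfolding xbox_def fst_conv snd_conv using V Q by blast
  have T: "0 < T" using T_ge_2 by simp
  \<comment> \<open>The value at (x k, y k) occurs in both Lagrangian differences and cancels,
    leaving the two comparison values. The primal noise is split at \<open>shadow k\<close>, and its
    part towards \<open>x k\<close> goes into \<open>increment k\<close>.\<close>
  have identity: "\<eta> \<bullet> (optimal_value \<alpha> P rew - V) - adv k =
      gx k \<bullet> (x k \<omega> - (Q, V)) - e k \<bullet> (shadow k \<omega> - (Q, V)) - gy k \<bullet> (y k \<omega> - opt_dual k) + increment k \<omega>"
    if "k < T" for k
  proof -
    let ?L = "\<lambda>x y. Lagrangian \<alpha> P rew \<eta> (weight_matrix (\<tau> k)) x y"
    have "?L (x k \<omega>) (opt_dual k) = \<eta> \<bullet> optimal_value \<alpha> P rew"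
      by (rule Lagrangian_opt_dual)
    moreover have "?L (Q, V) (y k \<omega>) = \<eta> \<bullet> V + adv k"
      by (cases "y k \<omega>") (simp add: Lagrangian_weight_matrix Q_def adv_def)
    moreover have "?L (x k \<omega>) (y k \<omega>) - ?L (Q, V) (y k \<omega>) = (gx k - e k) \<bullet> (x k \<omega> - (Q, V))"
      unfolding lagr_grad_x_inner_diff[symmetric] by (simp add: e_def gx_def noise_x_at_def noise_x_eq)
    moreover have "?L (x k \<omega>) (y k \<omega>) - ?L (x k \<omega>) (opt_dual k) = (gy k - f k) \<bullet> (y k \<omega> - opt_dual k)"
      unfolding lagr_grad_y_inner_diff[symmetric] by (simp add: f_def gy_def noise_y_at_def noise_y_eq)
    moreover have "increment k \<omega> = e k \<bullet> (shadow k \<omega> - x k \<omega>) + f k \<bullet> (y k \<omega> - opt_dual k)"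
      by (simp add: increment_def e_def f_def)
    moreover have "e k \<bullet> (shadow k \<omega> - x k \<omega>) = e k \<bullet> (shadow k \<omega> - (Q, V)) - e k \<bullet> (x k \<omega> - (Q, V))"
      by (simp add: inner_diff_right)
    ultimately show ?thesis
      unfolding inner_diff_left inner_diff_right[of \<eta>] by linarith
  qed
  have regret_x: "(\<Sum>k<T. - (- gx k \<bullet> (x k \<omega> - (Q, V)))) \<le>
      sqrt (real T) * ((2 * N * D\<^sup>2) / (2 * \<gamma>\<^sub>0) + (8 * U\<^sup>2) * \<gamma>\<^sub>0 + 0 / \<gamma>\<^sub>0)"
  proof (rule projected_gradient_regret[OF convex_closed_X_set \<gamma>\<^sub>0_pos T])
    show "x (Suc k) \<omega> = closest_point (X_set \<alpha> \<sigma>) (x k \<omega> + (\<gamma>\<^sub>0 / sqrt (real k + 1)) *\<^sub>R - gx k)" if "k < T" for k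
      using step_x[OF that \<omega>] by (simp add: gx_def)
    show "(norm (- gx k))\<^sup>2 \<le> 8 * U\<^sup>2" if "k < T" for k
      unfolding norm_minus_cancel gx_def using that \<omega> by (intro norm_grad_x y_box) auto
    show "(norm (x k \<omega> - (Q, V)))\<^sup>2 \<le> 2 * N * D\<^sup>2" if "k < T" for k
      using that \<omega> by (intro xbox_diameter x_box xs) auto
  qed (use xs X_set_iff in auto)
  have regret_shadow: "(\<Sum>k<T. - (e k \<bullet> (shadow k \<omega> - (Q, V)))) \<le>
      sqrt (real T) * ((2 * N * D\<^sup>2) / (2 * (\<gamma>\<^sub>0 / 2)) + (32 * U\<^sup>2) * (\<gamma>\<^sub>0 / 2) + 0 / (\<gamma>\<^sub>0 / 2))"
  proof (rule projected_gradient_regret[OF convex_closed_X_set _ T])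
    show "shadow (Suc k) \<omega> = closest_point (X_set \<alpha> \<sigma>) (shadow k \<omega> + (\<gamma>\<^sub>0 / 2 / sqrt (real k + 1)) *\<^sub>R e k)" for k
      by (simp add: e_def)
    show "(norm (e k))\<^sup>2 \<le> 32 * U\<^sup>2" if "k < T" for k
      unfolding e_def noise_x_at_def using that \<omega> by (intro norm_noise_x y_box) auto
    show "(norm (shadow k \<omega> - (Q, V)))\<^sup>2 \<le> 2 * N * D\<^sup>2" for k
      by (intro xbox_diameter shadow_box xs)
  qed (use xs X_set_iff \<gamma>\<^sub>0_pos in auto)
  have regret_y: "(\<Sum>k<T. - (gy k \<bullet> (y k \<omega> - opt_dual k))) \<le>
      sqrt (real T) * ((2 * N * U\<^sup>2) / (2 * \<gamma>\<^sub>0) + (2 * U\<^sup>2) * \<gamma>\<^sub>0 + (2 * \<beta>\<^sub>0 * N * D * U) / \<gamma>\<^sub>0)"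
  proof (rule projected_gradient_regret[OF convex_closed_Y_set \<gamma>\<^sub>0_pos T])
    show "y (Suc k) \<omega> = closest_point (Y_set \<alpha> \<zeta> \<eta>) (y k \<omega> + (\<gamma>\<^sub>0 / sqrt (real k + 1)) *\<^sub>R gy k)" if "k < T" for k
      using step_y[OF that \<omega>] by (simp add: gy_def)
    show "(norm (gy k))\<^sup>2 \<le> 2 * U\<^sup>2" if "k < T" for k
    proof -
      obtain s a s' r su au where z: "smp k \<omega> = (s, a, s', r, su, au)" by (cases "smp k \<omega>") auto
      then have "0 \<le> r" "r \<le> \<sigma>"
        using rewards that by (auto simp: rewards_bounded_def)
      then show ?thesis
        unfolding gy_def z using that \<omega> by (intro norm_grad_y x_box) auto
    qed
    show "(norm (y k \<omega> - opt_dual k))\<^sup>2 \<le> 2 * N * U\<^sup>2" if "k < T" for k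
      using that \<omega> by (intro ybox_diameter y_box opt_dual_box) auto
    show "(norm (y (Suc k) \<omega> - opt_dual (Suc k)))\<^sup>2 \<le> (norm (y (Suc k) \<omega> - opt_dual k))\<^sup>2 + 2 * \<beta>\<^sub>0 * N * D * U / (real k + 1)"
      if "k < T" for k
      using that \<omega> by (intro opt_dual_drift y_box) auto
    show "0 \<le> 2 * \<beta>\<^sub>0 * N * D * U"
      using \<beta>\<^sub>0_pos N_ge_1 D_pos U_pos by simp
  qed (auto intro: opt_dual_in_Y_set)
  \<comment> \<open>The single \<open>adv k\<close> need not vanish. Their sum is T times the
    advantage sum of the averaged dual vector, which is a state weight times the policy whose values
    are \<open>V\<close> and \<open>Q\<close>.\<close>
  have "(\<Sum>k<T. adv k) = (\<Sum>i\<in>UNIV. (\<Sum>k<T. fst (y k \<omega>) $ i) * (Q $ i - V $ (snd i)))"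
    unfolding adv_def sum_distrib_right by (rule sum.swap)
  also have "\<dots> = real T * (\<Sum>i\<in>UNIV. dual_average T y \<omega> $ i * (Q $ i - V $ (snd i)))"
    unfolding sum_distrib_left by (rule sum.cong) (use T in \<open>simp_all add: dual_average_nth\<close>)
  also have "(\<Sum>i\<in>UNIV. dual_average T y \<omega> $ i * (Q $ i - V $ (snd i))) = 0"
    unfolding Q_def V_def
  proof (rule advantage_sum_eq_0[OF mdp])
    show "dual_average T y \<omega> $ (a, s) = (\<Sum>a'\<in>UNIV. dual_average T y \<omega> $ (a', s)) * pmf (avg_policy \<omega> s) a" for a s
      using dual_average_sum_pos[OF \<omega>, of s] by (simp add: pmf_avg_policy[OF \<omega>])
  qed
  finally have "(\<Sum>k<T. adv k) = 0" by simp
  then have "real T * (\<eta> \<bullet> (optimal_value \<alpha> P rew - V)) = (\<Sum>k<T. \<eta> \<bullet> (optimal_value \<alpha> P rew - V) - adv k)"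
    by (simp add: sum_subtractf)
  also have "\<dots> = (\<Sum>k<T. gx k \<bullet> (x k \<omega> - (Q, V)) - e k \<bullet> (shadow k \<omega> - (Q, V)) - gy k \<bullet> (y k \<omega> - opt_dual k) + increment k \<omega>)"
    by (intro sum.cong identity) auto
  also have "\<dots> = (\<Sum>k<T. - (- gx k \<bullet> (x k \<omega> - (Q, V)))) + (\<Sum>k<T. - (e k \<bullet> (shadow k \<omega> - (Q, V))))
      + (\<Sum>k<T. - (gy k \<bullet> (y k \<omega> - opt_dual k))) + (\<Sum>k<T. increment k \<omega>)"
    by (simp add: sum.distrib sum_subtractf sum_negf)
  finally show ?thesis
    using regret_x regret_shadow regret_y by (simp add: V_def mult_ac)
qed

text \<open>No policy beats the optimal value at any state, so all gaps are nonnegative and one of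
  them is at most the \<eta>-weighted sum divided by its own weight \<sigma>/|S|.\<close>

lemma optimality_gap_le:
  assumes \<omega>: "\<omega> \<in> space M" and rewards: "rewards_bounded \<omega>"
    and noise: "(\<Sum>k<T. increment k \<omega>) \<le> 12 * U * D * sqrt (2 * real T * L)"
    and "0 < \<epsilon>" "1 \<le> L"
    and \<kappa>\<^sub>1: "((12 + 4 * \<beta>\<^sub>0) / (\<zeta>\<^sup>2 * real CARD('s)^2 * real CARD('a)^2 * \<gamma>\<^sub>0) + 26 * \<gamma>\<^sub>0)\<^sup>2 \<le> \<kappa>"
    and \<kappa>\<^sub>2: "(2184 + 416 * sqrt 26) * \<gamma>\<^sub>0^2 + (1066 + 416 * sqrt 26) * \<gamma>\<^sub>0 + 832 + 16 * sqrt 26 \<le> \<kappa>"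
    and T: "\<kappa> * (\<sigma>^2 * real CARD('s)^6 * real CARD('a)^4 / (\<zeta>^4 * (1 - \<alpha>)^6)) * (1 / \<epsilon>^2) * L \<le> real T"
  shows "infnorm (optimal_value \<alpha> P rew - policy_value \<alpha> P rew (avg_policy \<omega>)) \<le> \<epsilon>"
  unfolding infnorm_le_cart_iff
proof
  fix s
  define gap where "gap t = optimal_value \<alpha> P rew $ t - policy_value \<alpha> P rew (avg_policy \<omega>) $ t" for t
  have gap_nonneg: "0 \<le> gap t" for t
    using optimal_value_attained[OF mdp, of P] unfolding gap_def by (metis diff_ge_0_iff_ge)
  have "\<sigma> / real CARD('s) * gap s = \<eta> $ s * gap s"
    by (simp add: \<eta>_eq)
  also have "\<dots> \<le> (\<Sum>t\<in>UNIV. \<eta> $ t * gap t)"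
    by (rule member_le_sum) (use gap_nonneg \<eta>_bounds in auto)
  also have "\<dots> = \<eta> \<bullet> (optimal_value \<alpha> P rew - policy_value \<alpha> P rew (avg_policy \<omega>))"
    by (simp add: inner_vec_def gap_def)
  finally have gap: "real T * (\<sigma> / real CARD('s) * gap s) \<le>
      real T * (\<eta> \<bullet> (optimal_value \<alpha> P rew - policy_value \<alpha> P rew (avg_policy \<omega>)))"
    by (rule mult_left_mono) simp
  have N_le: "N \<le> 1 / \<zeta>"
    using N_\<zeta> \<zeta>_pos by (simp add: pos_le_divide_eq)
  have k1: "((12 + 4 * \<beta>\<^sub>0) * (1 / \<zeta>)\<^sup>2 / (N\<^sup>2 * \<gamma>\<^sub>0) + 26 * \<gamma>\<^sub>0)\<^sup>2 \<le> \<kappa>"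
    using \<kappa>\<^sub>1 by (simp add: N_eq power_mult_distrib power_divide mult_ac)
  have "0 \<le> \<kappa>"
    using k1 by (rule order_trans[OF zero_le_power2])
  have "gap s \<le> \<epsilon>"
  proof (rule error_bound[where L=L and S="real CARD('s)" and \<kappa>=\<kappa>])
    show "N \<le> 1 / \<zeta>" by (rule N_le)
    show "(4 * (1 / \<zeta>)^3 + 2 * \<beta>\<^sub>0 * (1 / \<zeta>)\<^sup>2) / \<gamma>\<^sub>0 + 26 * (1 / \<zeta>)\<^sup>2 * \<gamma>\<^sub>0 + 17 * (1 / \<zeta>) \<le> N\<^sup>2 * (1 / \<zeta>)\<^sup>2 * sqrt \<kappa>"
      by (rule kappa_bound[OF \<gamma>\<^sub>0_pos \<beta>\<^sub>0_pos N_ge_1 N_le k1 \<kappa>\<^sub>2])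
    have "real CARD('s)^2 * N^4 * (1 / \<zeta>)^4 = real CARD('s)^6 * real CARD('a)^4 / \<zeta>^4"
      by (simp add: N_eq power_mult_distrib power_divide mult.assoc[symmetric] power_add[symmetric])
    then have "\<sigma>\<^sup>2 * real CARD('s)^2 * N^4 * (1 / \<zeta>)^4 / (1 - \<alpha>)^6 =
        \<sigma>^2 * real CARD('s)^6 * real CARD('a)^4 / (\<zeta>^4 * (1 - \<alpha>)^6)"
      by (simp add: mult.assoc)
    then show "\<kappa> * (\<sigma>\<^sup>2 * (real CARD('s))\<^sup>2 * N^4 * (1 / \<zeta>)^4 / (1 - \<alpha>)^6) * (1 / \<epsilon>\<^sup>2) * L \<le> real T"
      using T by simp
    show "real T * (\<sigma> / real CARD('s) * gap s) \<le> sqrt (real T) * (N * D\<^sup>2 / \<gamma>\<^sub>0 + 8 * U\<^sup>2 * \<gamma>\<^sub>0)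
      + sqrt (real T) * (2 * N * D\<^sup>2 / \<gamma>\<^sub>0 + 16 * U\<^sup>2 * \<gamma>\<^sub>0)
      + sqrt (real T) * (N * U\<^sup>2 / \<gamma>\<^sub>0 + 2 * U\<^sup>2 * \<gamma>\<^sub>0 + 2 * \<beta>\<^sub>0 * N * D * U / \<gamma>\<^sub>0)
      + 12 * U * D * sqrt (2 * real T * L)"
      using gap duality_gap_bound[OF \<omega> rewards] noise by linarith
    show "U = 1 / \<zeta> * D"
      by (simp add: U_eq)
  qed (use \<gamma>\<^sub>0_pos \<beta>\<^sub>0_pos \<open>0 < \<epsilon>\<close> \<open>1 \<le> L\<close> \<sigma> \<alpha> N_ge_1 \<open>0 \<le> \<kappa>\<close> D_eq T_ge_2 in auto)
  then show "\<bar>(optimal_value \<alpha> P rew - policy_value \<alpha> P rew (avg_policy \<omega>)) $ s\<bar> \<le> \<epsilon>"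
    using gap_nonneg[of s] by (simp add: gap_def)
qed

end

theorem theorem17:
  fixes P :: "'a::finite \<Rightarrow> 's::finite \<Rightarrow> 's pmf"
    and rew :: "'s \<Rightarrow> 's \<Rightarrow> 'a \<Rightarrow> real measure"
    and \<tau> :: "nat \<Rightarrow> ('a \<times> 's) pmf"
    and M :: "'w measure" and F :: "nat \<Rightarrow> 'w measure"
    and smp :: "nat \<Rightarrow> 'w \<Rightarrow> ('s, 'a) sample"
    and x :: "nat \<Rightarrow> 'w \<Rightarrow> (real^('a \<times> 's)) \<times> (real^'s)"
    and y :: "nat \<Rightarrow> 'w \<Rightarrow> (real^('a \<times> 's)) \<times> (real^('a \<times> 's))"
    and \<alpha> \<sigma> \<zeta> \<gamma>\<^sub>0 \<beta>\<^sub>0 \<kappa>\<^sub>1 \<kappa>\<^sub>2 \<kappa> \<epsilon> \<delta> :: real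
    and \<eta> :: "real^'s" and \<gamma> \<beta> :: "nat \<Rightarrow> real" and T :: nat
  assumes "discounted_mdp \<alpha> \<sigma> rew"
    and "0 < \<gamma>\<^sub>0" and "\<gamma> = (\<lambda>k. \<gamma>\<^sub>0 / sqrt (real k + 1))"
    and "0 < \<beta>\<^sub>0" and "\<beta> = (\<lambda>k. \<beta>\<^sub>0 / (real k + 1))"
    and "\<eta> = (\<chi> s. \<sigma> / real CARD('s))"
    and "state_action_distributions P \<zeta> \<beta> \<tau>"
    and "spd_q_learning M F \<alpha> \<sigma> P rew \<eta> \<zeta> \<tau> \<gamma> T smp x y"
    and "\<kappa>\<^sub>1 = ((12 + 4 * \<beta>\<^sub>0) / (\<zeta>^2 * real CARD('s)^2 * real CARD('a)^2 * \<gamma>\<^sub>0) + 26 * \<gamma>\<^sub>0)^2"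
    and "\<kappa>\<^sub>2 = (2184 + 416 * sqrt 26) * \<gamma>\<^sub>0^2 + (1066 + 416 * sqrt 26) * \<gamma>\<^sub>0 + 832 + 16 * sqrt 26"
    and "\<kappa> = max \<kappa>\<^sub>1 \<kappa>\<^sub>2"
    and "0 < \<epsilon>" and "\<epsilon> < 1" and "0 < \<delta>" and "\<delta> < 1 / exp 1"
    and "real T \<ge> \<kappa> * (\<sigma>^2 * real CARD('s)^6 * real CARD('a)^4 / (\<zeta>^4 * (1 - \<alpha>)^6))
                   * (1 / \<epsilon>^2) * ln (1 / \<delta>)"
  shows "measure M {\<omega> \<in> space M.
           infnorm (optimal_value \<alpha> P rew - policy_value \<alpha> P rew (dual_policy (dual_average T y \<omega>))) \<le> \<epsilon>}
         \<ge> 1 - \<delta>"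
proof -
  define L where "L = ln (1 / \<delta>)"
  define N where "N = real CARD('s) * real CARD('a)"
  note \<alpha> = discounted_mdpD(1-3)[OF assms(1)]
  have \<zeta>: "0 < \<zeta>" "\<zeta> \<le> pmf (\<tau> k) i" for k i
    using assms(7) unfolding state_action_distributions_def by blast+
  \<comment> \<open>The condition \<delta> < 1/e is what makes L at least 1.\<close>
  have "exp 1 < 1 / \<delta>"
    using \<open>0 < \<delta>\<close> \<open>\<delta> < 1 / exp 1\<close> by (simp add: field_simps)
  then have L: "1 \<le> L"
    unfolding L_def using \<open>0 < \<delta>\<close> by (subst ln_ge_iff) auto
  have "\<delta> < 1"
    using \<open>\<delta> < 1 / exp 1\<close> by (rule order_less_le_trans) simp
  have N_\<zeta>: "N * \<zeta> \<le> 1"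
  proof -
    have "(\<Sum>i\<in>(UNIV::('a \<times> 's) set). \<zeta>) \<le> (\<Sum>i\<in>UNIV. pmf (\<tau> 0) i)"
      by (intro sum_mono \<zeta>)
    then show ?thesis
      by (simp add: sum_pmf_eq_1 N_def mult_ac)
  qed
  have card: "1 \<le> real CARD('s)" "1 \<le> real CARD('a)"
    by (simp_all add: Suc_le_eq)
  have "1 \<le> N"
    unfolding N_def using mult_mono[OF card] by simp
  then have "1 * \<zeta> \<le> N * \<zeta>"
    using \<zeta>(1) by (intro mult_right_mono) auto
  then have "\<zeta> \<le> 1"
    using N_\<zeta> by simp
  have k: "\<kappa>\<^sub>1 \<le> \<kappa>" "\<kappa>\<^sub>2 \<le> \<kappa>"
    using assms(11) by auto
  \<comment> \<open>The constant part of \<open>\<kappa>\<^sub>2\<close> alone exceeds 832. As every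
    other factor in the requirement on \<open>T\<close> is at least 1, this yields the two steps
    demanded by the locale of runs.\<close>
  have "2 \<le> \<kappa>\<^sub>2"
    using \<open>0 < \<gamma>\<^sub>0\<close> unfolding assms(10) by (simp add: add_increasing)
  then have "2 \<le> \<kappa>"
    using k by simp
  have "1 * 1 * 1 \<le> \<sigma>^2 * real CARD('s)^6 * real CARD('a)^4"
    using \<alpha> card by (intro mult_mono one_le_power) auto
  moreover have "\<zeta>^4 * (1 - \<alpha>)^6 \<le> 1"
    using \<alpha> \<zeta>(1) \<open>\<zeta> \<le> 1\<close> by (intro mult_le_one power_le_one) auto
  moreover have "0 < \<zeta>^4 * (1 - \<alpha>)^6"
    using \<alpha> \<zeta>(1) by simp
  ultimately have "1 \<le> \<sigma>^2 * real CARD('s)^6 * real CARD('a)^4 / (\<zeta>^4 * (1 - \<alpha>)^6)" (is "1 \<le> ?c")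
    by (simp only: pos_le_divide_eq)
  moreover have "1 \<le> 1 / \<epsilon>^2"
    using \<open>0 < \<epsilon>\<close> \<open>\<epsilon> < 1\<close> by (simp add: power_le_one)
  ultimately have "2 * 1 * 1 * 1 \<le> \<kappa> * ?c * (1 / \<epsilon>^2) * L"
    using \<open>2 \<le> \<kappa>\<close> L by (intro mult_mono) auto
  then have T: "2 \<le> T"
    using assms(16) unfolding L_def by linarith
  interpret spd_run P rew \<alpha> \<sigma> \<zeta> "\<sigma> / (1 - \<alpha>)" "\<sigma> / (1 - \<alpha>) / \<zeta>" N \<eta> \<tau> \<gamma>\<^sub>0 \<beta>\<^sub>0 T M F smp x y
    using assms N_\<zeta> \<zeta>(1) T by unfold_locales (auto simp: N_def)
  let ?c = "12 * (\<sigma> / (1 - \<alpha>) / \<zeta>) * (\<sigma> / (1 - \<alpha>))"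
  let ?good = "{\<omega> \<in> space M. infnorm (optimal_value \<alpha> P rew - policy_value \<alpha> P rew (avg_policy \<omega>)) \<le> \<epsilon>}"
  let ?bad = "{\<omega> \<in> space M. ?c * sqrt (2 * real T * L) < (\<Sum>k<T. increment k \<omega>)}"
  have bad: "measure M ?bad \<le> \<delta>"
    using increments.Azuma_Hoeffding[of \<delta>] T \<open>0 < \<delta>\<close> \<open>\<delta> < 1\<close> unfolding L_def by simp
  have good_sets: "?good \<in> sets M"
    unfolding infnorm_le_cart_iff vector_minus_component using measurable_avg_policy_value by measurable
  have bad_sets: "?bad \<in> sets M"
    using increments.measurable_partial_sum[of T] by measurable
  \<comment> \<open>Off the bad event the bound may still fail where rewards leave [0, \<sigma>], so
    measures are compared through an almost sure inclusion. The failure probability \<delta> is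
    spent entirely on \<open>?bad\<close>.\<close>
  have "AE \<omega> in M. \<omega> \<in> space M - ?bad \<longrightarrow> \<omega> \<in> ?good"
    using AE_rewards_bounded
  proof eventually_elim
    case (elim \<omega>)
    show ?case
    proof
      assume "\<omega> \<in> space M - ?bad"
      then have "\<omega> \<in> space M" "(\<Sum>k<T. increment k \<omega>) \<le> ?c * sqrt (2 * real T * L)"
        by auto
      then show "\<omega> \<in> ?good"
        using optimality_gap_le[of \<omega> L \<epsilon> \<kappa>] elim \<open>0 < \<epsilon>\<close> L k assms(9,10,16) by (simp add: L_def)
    qed
  qed
  then have "measure M (space M - ?bad) \<le> measure M ?good"
    by (intro increments.finite_measure_mono_AE good_sets)
  then show ?thesis
    using bad increments.prob_compl[OF bad_sets] by simp
qed

end
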